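(* Let $E/\mathbb Q$ be an elliptic curve, $K/\mathbb Q$ a number field of degree $6$, and $H=E(K)_{\mathrm{tors}}$. Then: (i) if $H\cong\mathbb Z/15\mathbb Z$, then $E$ has Cremona label 50a3, 50a4, 50b1, 50b2, 450b4, or 450b3; (ii) if $H\cong\mathbb Z/30\mathbb Z$, then $E$ has Cremona label 50a3, 50b1, 50b2, or 450b4.
   Context: Cremona labels refer to Cremona's tables of elliptic curves over $\mathbb Q$ (labels identify curves up to $\mathbb Q$-isomorphism). *)

theory Defs
  imports Complex_Main "HOL-Algebra.Elementary_Groups"
begin

text \<open>
  Weierstrass equations
  \<open>y\<^sup>2 + a\<^sub>1 x y + a\<^sub>3 y = x\<^sup>3 + a\<^sub>2 x\<^sup>2 + a\<^sub>4 x + a\<^sub>6\<close>,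
  with the usual associated quantities (Silverman, The Arithmetic of Elliptic Curves, III.1).
\<close>

record 'a weierstrass =
  a\<^sub>1 :: 'a
  a\<^sub>2 :: 'a
  a\<^sub>3 :: 'a
  a\<^sub>4 :: 'a
  a\<^sub>6 :: 'a

definition weierstrass_of :: "'a \<times> 'a \<times> 'a \<times> 'a \<times> 'a \<Rightarrow> 'a weierstrass" where
  "weierstrass_of = (\<lambda>(c1, c2, c3, c4, c6).
     \<lparr>a\<^sub>1 = c1, a\<^sub>2 = c2, a\<^sub>3 = c3, a\<^sub>4 = c4, a\<^sub>6 = c6\<rparr>)"

definition discriminant :: "'a::comm_ring_1 weierstrass \<Rightarrow> 'a" where
  "discriminant W =
    (let b2 = (a\<^sub>1 W)^2 + 4 * a\<^sub>2 W;
         b4 = 2 * a\<^sub>4 W + a\<^sub>1 W * a\<^sub>3 W;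
         b6 = (a\<^sub>3 W)^2 + 4 * a\<^sub>6 W;
         b8 = (a\<^sub>1 W)^2 * a\<^sub>6 W + 4 * a\<^sub>2 W * a\<^sub>6 W - a\<^sub>1 W * a\<^sub>3 W * a\<^sub>4 W
                + a\<^sub>2 W * (a\<^sub>3 W)^2 - (a\<^sub>4 W)^2
     in - (b2^2 * b8) - 8 * b4^3 - 27 * b6^2 + 9 * b2 * b4 * b6)"

definition elliptic_curve :: "'a::field weierstrass \<Rightarrow> bool" where
  "elliptic_curve W \<longleftrightarrow> discriminant W \<noteq> 0"

definition base_change :: "rat weierstrass \<Rightarrow> 'k::field_char_0 weierstrass" where
  "base_change W = \<lparr>a\<^sub>1 = of_rat (a\<^sub>1 W), a\<^sub>2 = of_rat (a\<^sub>2 W), a\<^sub>3 = of_rat (a\<^sub>3 W),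
                    a\<^sub>4 = of_rat (a\<^sub>4 W), a\<^sub>6 = of_rat (a\<^sub>6 W)\<rparr>"

datatype 'a ec_point = Infty | Affine 'a 'a

definition ec_points :: "'a::field weierstrass \<Rightarrow> 'a ec_point set" where
  "ec_points W = insert Infty
     {Affine x y | x y. y^2 + a\<^sub>1 W * x * y + a\<^sub>3 W * y = x^3 + a\<^sub>2 W * x^2 + a\<^sub>4 W * x + a\<^sub>6 W}"

text \<open>
  The chord-tangent law. Two points on the curve with equal abscissa that are not opposite
  coincide, so the second branch for the slope is the tangent.
\<close>

fun ec_add :: "'a::field weierstrass \<Rightarrow> 'a ec_point \<Rightarrow> 'a ec_point \<Rightarrow> 'a ec_point" where
  "ec_add W Infty Q = Q"
| "ec_add W (Affine x1 y1) Infty = Affine x1 y1"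
| "ec_add W (Affine x1 y1) (Affine x2 y2) =
    (if x1 = x2 \<and> y1 + y2 + a\<^sub>1 W * x2 + a\<^sub>3 W = 0 then Infty
     else
       let l = (if x1 \<noteq> x2 then (y2 - y1) / (x2 - x1)
                else (3 * x1^2 + 2 * a\<^sub>2 W * x1 + a\<^sub>4 W - a\<^sub>1 W * y1)
                       / (2 * y1 + a\<^sub>1 W * x1 + a\<^sub>3 W));
           x3 = l^2 + a\<^sub>1 W * l - a\<^sub>2 W - x1 - x2
       in Affine x3 (- (l + a\<^sub>1 W) * x3 - (y1 - l * x1) - a\<^sub>3 W))"

definition ec_group :: "'a::field weierstrass \<Rightarrow> 'a ec_point monoid" where
  "ec_group W = \<lparr>carrier = ec_points W, mult = ec_add W, one = Infty\<rparr>"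

definition torsion_subgroup :: "('a, 'b) monoid_scheme \<Rightarrow> ('a, 'b) monoid_scheme" where
  "torsion_subgroup G =
     G\<lparr>carrier := {x \<in> carrier G. \<exists>n::nat. n > 0 \<and> x [^]\<^bsub>G\<^esub> n = \<one>\<^bsub>G\<^esub>}\<rparr>"

text \<open>The group \<open>E(K)\<^sub>t\<^sub>o\<^sub>r\<^sub>s\<close>, where the field \<open>K\<close> is the type \<open>'k\<close>.\<close>

definition torsion_over :: "rat weierstrass \<Rightarrow> 'k::field_char_0 itself \<Rightarrow> 'k ec_point monoid" where
  "torsion_over E K = torsion_subgroup (ec_group (base_change E :: 'k weierstrass))"

text \<open>
  The degree of a field of characteristic zero over its prime field. The library sets the
  dimension of an infinite-dimensional space to \<open>0\<close>, so a positive degree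
  means that the field is a number field of that degree.
\<close>

definition degree_over_rat :: "'k::field_char_0 itself \<Rightarrow> nat" where
  "degree_over_rat K = vector_space.dim (\<lambda>(q::rat) (x::'k). of_rat q * x) (UNIV :: 'k set)"

lemma vector_space_over_rat: "vector_space (\<lambda>(q::rat) (x::'k::field_char_0). of_rat q * x)"
  by unfold_locales (simp_all add: algebra_simps of_rat_add of_rat_mult)

text \<open>
  Isomorphism over \<open>\<rat>\<close>: \<open>W'\<close> arises from \<open>W\<close> by an admissible substitution
  \<open>x = u\<^sup>2 x' + r\<close>, \<open>y = u\<^sup>3 y' + s u\<^sup>2 x' + t\<close> with rational \<open>u \<noteq> 0, r, s, t\<close>.
\<close>

definition rat_isomorphic :: "rat weierstrass \<Rightarrow> rat weierstrass \<Rightarrow> bool" where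
  "rat_isomorphic W W' \<longleftrightarrow> (\<exists>u r s t :: rat. u \<noteq> 0 \<and>
     u * a\<^sub>1 W' = a\<^sub>1 W + 2 * s \<and>
     u^2 * a\<^sub>2 W' = a\<^sub>2 W - s * a\<^sub>1 W + 3 * r - s^2 \<and>
     u^3 * a\<^sub>3 W' = a\<^sub>3 W + r * a\<^sub>1 W + 2 * t \<and>
     u^4 * a\<^sub>4 W' = a\<^sub>4 W - s * a\<^sub>3 W + 2 * r * a\<^sub>2 W - (t + r * s) * a\<^sub>1 W + 3 * r^2 - 2 * s * t \<and>
     u^6 * a\<^sub>6 W' = a\<^sub>6 W + r * a\<^sub>4 W + r^2 * a\<^sub>2 W + r^3 - t * a\<^sub>3 W - t^2 - r * t * a\<^sub>1 W)"

text \<open>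
  The reduced minimal models \<open>[a\<^sub>1, a\<^sub>2, a\<^sub>3, a\<^sub>4, a\<^sub>6]\<close> listed in Cremona's tables. The
  \<open>j\<close>-invariants of 50a3, 50b1, 450b3 are all \<open>-121945/32\<close>, those of 50a4, 50b2, 450b4 all
  \<open>46969655/32768\<close>; 50b1 and 50b2 are the quadratic twists by \<open>5\<close>, and 450b3 and 450b4 the
  quadratic twists by \<open>-3\<close>, of 50a3 and 50a4 respectively.
\<close>

definition cremona_50a3 :: "rat weierstrass" where
  "cremona_50a3 = weierstrass_of (1, 0, 1, -76, 298)"

definition cremona_50a4 :: "rat weierstrass" where
  "cremona_50a4 = weierstrass_of (1, 0, 1, 549, -2202)"

definition cremona_50b1 :: "rat weierstrass" where
  "cremona_50b1 = weierstrass_of (1, 1, 1, -3, 1)"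

definition cremona_50b2 :: "rat weierstrass" where
  "cremona_50b2 = weierstrass_of (1, 1, 1, 22, -9)"

definition cremona_450b3 :: "rat weierstrass" where
  "cremona_450b3 = weierstrass_of (1, -1, 1, -680, -8053)"

definition cremona_450b4 :: "rat weierstrass" where
  "cremona_450b4 = weierstrass_of (1, -1, 1, 4945, 59447)"

end

theory Submission
  imports Defs "HOL-Computational_Algebra.Primes" "HOL-Computational_Algebra.Polynomial"
    "HOL-Computational_Algebra.Nth_Powers"
begin

text \<open>
  A point of order 5 over \<open>K\<close> puts \<open>E\<close> over \<open>K\<close> in Tate normal form with parameter \<open>t\<close>. Because
  \<open>j(E)\<close> is rational, the Hauptmodul \<open>h = t - 1/t - 11\<close> of \<open>X\<^sub>0(5)\<close> has degree 1, 2, 3 or 6 over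
  \<open>\<rat>\<close>. The Weil pairing puts a square root of \<open>5\<close> in the 5-torsion field; accordingly, in degrees
  2, 3 and 6 a norm computation would make \<open>5\<close> a rational square. Hence \<open>h\<close>, and then \<open>t\<close>, is rational
  and \<open>E\<close> is the quadratic twist by some \<open>k\<close>, a square in \<open>K\<close>, of the Tate curve of \<open>t\<close>.
  A point of order 3 over \<open>K\<close> forces a rational root of the 3-division polynomial, hence a rational
  point on a curve isomorphic to \<open>Y\<^sup>2 = X(X - 1)(X + 15)\<close>; a 2-descent, ending in Fermat's
  descent for \<open>p\<^sup>2 + e\<^sup>2\<close>, \<open>p\<^sup>2 + 16 e\<^sup>2\<close> both squares, leaves \<open>t \<in> {1/2, -2, 8, -1/8}\<close>.
  The point of order 3 also provides a square root of \<open>5\<close> or \<open>-15\<close> in \<open>K\<close>; as \<open>K\<close> contains no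
  biquadratic field, this leaves the six twists. When the point of order 3 does not lie in the
  rational subgroup, \<open>K\<close> contains a pure cubic field, and then it has no room for a root of the
  2-division polynomial, whose discriminant is not \<open>-3\<close> times a square.
\<close>

section \<open>Number fields as rational algebras\<close>

text \<open>\<open>K\<close> need not be Galois, so points of \<open>E(K)\<close> cannot be
  conjugated inside it; degree counts and norms to the rationals take over. Dimensions of subfields
  divide 6, so an element of \<open>K\<close> that is quadratic over a subfield of even degree lies
  in that subfield. The six values of \<open>h\<close> are the roots of
  \<open>(x^2 + 10 x + 5)^3 - j x\<close>, and \<open>t^2 - (h + 11) t - 1\<close> has discriminant
  \<open>h^2 + 22 h + 125\<close>; through these two polynomials the factor 5 enters the norms. The
  map \<open>t -> -1/t\<close> fixes \<open>h\<close> and replaces the point \<open>P\<close> of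
  order 5 by \<open>2 P\<close>, so the four values of \<open>t\<close> yield only two curves up to
  twist. The classes 5 and -15 belong, in one order or the other, to the rational subgroup of order
  3 and to the quotient of the 3-torsion by it; their product is -3 up to squares, as the Weil
  pairing on the 3-torsion demands.\<close>

definition rscale :: "rat \<Rightarrow> 'k::field_char_0 \<Rightarrow> 'k" where
  "rscale q x = of_rat q * x"

interpretation rat_vs: vector_space "rscale :: rat \<Rightarrow> 'k::field_char_0 \<Rightarrow> 'k"
  using vector_space_over_rat unfolding rscale_def .

lemma degree_over_rat_dim: "degree_over_rat TYPE('k::field_char_0) = rat_vs.dim (UNIV :: 'k::field_char_0 set)"
  unfolding degree_over_rat_def rscale_def ..

lemma finite_degree_basis:
  fixes T :: "'k::field_char_0 itself"
  assumes "degree_over_rat TYPE('k) > 0"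
  obtains B :: "'k set" where "finite_dimensional_vector_space rscale B"
proof -
  obtain B :: "'k set" where B: "rat_vs.independent B" "UNIV \<subseteq> rat_vs.span B"
      "card B = rat_vs.dim (UNIV :: 'k set)"
    using rat_vs.basis_exists by blast
  then have "finite B"
    using assms by (metis card.infinite degree_over_rat_dim less_numeral_extra(3))
  then have "finite_dimensional_vector_space rscale B"
    using B by unfold_locales auto
  then show thesis ..
qed

definition rat_subalgebra :: "'k::field_char_0 set \<Rightarrow> bool" where
  "rat_subalgebra L \<longleftrightarrow> rat_vs.subspace L \<and> 1 \<in> L \<and> (\<forall>x\<in>L. \<forall>y\<in>L. x * y \<in> L)"

lemma linear_mult_left: "Vector_Spaces.linear rscale rscale (\<lambda>y. x * y :: 'k::field_char_0)"
  by unfold_locales (simp_all add: rscale_def algebra_simps of_rat_add of_rat_mult)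

lemma subspace_mult_image:
  assumes "rat_vs.subspace L"
  shows "rat_vs.subspace ((\<lambda>y. x * y :: 'k::field_char_0) ` L)"
  using assms linear_mult_left module_hom.subspace_image
  by (metis module_hom_iff_linear)

lemma dim_mult_image:
  fixes x :: "'k::field_char_0"
  assumes "degree_over_rat TYPE('k) > 0" "x \<noteq> 0"
  shows "rat_vs.dim ((\<lambda>y. x * y) ` L) = rat_vs.dim L"
proof -
  obtain B :: "'k set" where "finite_dimensional_vector_space rscale B"
    using finite_degree_basis[OF assms(1)] .
  then interpret finite_dimensional_vector_space "rscale :: rat \<Rightarrow> 'k \<Rightarrow> 'k" B .
  interpret finite_dimensional_vector_space_pair_1 "rscale :: rat \<Rightarrow> 'k \<Rightarrow> 'k" B
      "rscale :: rat \<Rightarrow> 'k \<Rightarrow> 'k" by unfold_locales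
  show ?thesis
    using assms(2) by (intro dim_image_eq linear_mult_left) (auto simp: inj_on_def)
qed

text \<open>Multiplication by \<open>x\<close> is injective on the finite-dimensional space
  \<open>L\<close>, hence onto, so a subalgebra is a subfield. For \<open>x = 0\<close> the quotient
  is 0 by convention.\<close>

lemma subalgebra_divide:
  fixes x :: "'k::field_char_0"
  assumes deg: "degree_over_rat TYPE('k) > 0" and L: "rat_subalgebra L"
    and "x \<in> L" "y \<in> L"
  shows "y / x \<in> L"
proof (cases "x = 0")
  case True
  then show ?thesis using L rat_vs.subspace_0 unfolding rat_subalgebra_def by auto
next
  case False
  obtain B :: "'k set" where "finite_dimensional_vector_space rscale B"
    using finite_degree_basis[OF assms(1)] .
  then interpret finite_dimensional_vector_space "rscale :: rat \<Rightarrow> 'k \<Rightarrow> 'k" B .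
  have "(\<lambda>z. x * z) ` L = L"
    using L \<open>x \<in> L\<close> dim_mult_image[OF deg False, of L]
    by (intro subspace_dim_equal) (auto simp: rat_subalgebra_def intro: subspace_mult_image)
  then obtain z where "z \<in> L" "y = x * z" using \<open>y \<in> L\<close> by blast
  then show ?thesis using False by simp
qed

text \<open>The tower law. An \<open>L\<close>-stable subspace \<open>W\<close> of \<open>M\<close>
  grows by one summand \<open>w * L\<close> at a time, starting from 0. Each summand has the
  dimension of \<open>L\<close> and meets \<open>W\<close> only in 0, because \<open>L\<close>
  contains inverses.\<close>

lemma subalgebra_dim_dvd:
  fixes L M :: "'k::field_char_0 set"
  assumes deg: "degree_over_rat TYPE('k) > 0"
    and L: "rat_subalgebra L" and M: "rat_subalgebra M" and "L \<subseteq> M"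
  shows "rat_vs.dim L dvd rat_vs.dim M"
proof -
  obtain B :: "'k set" where "finite_dimensional_vector_space rscale B"
    using finite_degree_basis[OF assms(1)] .
  then interpret finite_dimensional_vector_space "rscale :: rat \<Rightarrow> 'k \<Rightarrow> 'k" B .
  note sub = L[unfolded rat_subalgebra_def] M[unfolded rat_subalgebra_def]
  have "rat_vs.dim L dvd rat_vs.dim M"
    if "rat_vs.subspace W" "W \<subseteq> M" "\<And>l w. l \<in> L \<Longrightarrow> w \<in> W \<Longrightarrow> l * w \<in> W"
      "rat_vs.dim L dvd rat_vs.dim W" for W
    using that
  proof (induction "rat_vs.dim M - rat_vs.dim W" arbitrary: W rule: less_induct)
    case less
    show ?case
    proof (cases "W = M")
      case True
      then show ?thesis using less by simp
    next
      case False
      then obtain w where w: "w \<in> M" "w \<notin> W" using less.prems by blast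
      then have w0: "w \<noteq> 0" using rat_vs.subspace_0[OF less.prems(1)] by auto
      define V where "V = (\<lambda>y. w * y) ` L"
      define W' where "W' = {x + y |x y. x \<in> W \<and> y \<in> V}"
      have V: "rat_vs.subspace V" "rat_vs.dim V = rat_vs.dim L"
        unfolding V_def using sub subspace_mult_image dim_mult_image[OF deg w0] by auto
      have "w * l \<notin> W" if "l \<in> L" "l \<noteq> 0" for l
      proof
        assume "w * l \<in> W"
        then have "1 / l * (w * l) \<in> W"
          using subalgebra_divide[OF deg L that(1), of 1] sub less.prems(3) by blast
        then show False using w that by simp
      qed
      then have "W \<inter> V = {0}"
        using rat_vs.subspace_0[OF less.prems(1)] rat_vs.subspace_0[OF V(1)]
        by (auto simp: V_def)
      then have dim: "rat_vs.dim W' = rat_vs.dim W + rat_vs.dim L"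
        using dim_sums_Int[OF less.prems(1) V(1)] V(2) unfolding W'_def by simp
      have W': "rat_vs.subspace W'"
        unfolding W'_def by (rule rat_vs.subspace_sums[OF less.prems(1) V(1)])
      have sub': "W' \<subseteq> M"
        unfolding W'_def V_def using less.prems(2) w sub \<open>L \<subseteq> M\<close>
        by (auto intro!: rat_vs.subspace_add)
      have mult: "l * v \<in> W'" if l: "l \<in> L" and v: "v \<in> W'" for l v
      proof -
        obtain x y where "v = x + w * y" "x \<in> W" "y \<in> L"
          using v unfolding W'_def V_def by blast
        then have "l * v = l * x + w * (l * y)" "l * x \<in> W" "l * y \<in> L"
          using less.prems(3) l sub by (auto simp: algebra_simps)
        then show ?thesis unfolding W'_def V_def by blast
      qed
      have "rat_vs.dim L > 0"
        using sub dim_eq_0[of L] by (metis gr0I singletonD subsetD zero_neq_one)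
      moreover have "rat_vs.dim W' \<le> rat_vs.dim M"
        using dim_subset[OF sub'] .
      ultimately show ?thesis
        using less.hyps[OF _ W' sub' mult] less.prems(4) dim by simp
    qed
  qed
  from this[of "{0}"] show ?thesis
    using sub dim_eq_0[of "{0}"] by (auto simp: rat_vs.subspace_0)
qed

section \<open>Evaluation of rational polynomials, generated subfields and minimal
  polynomials\<close>

definition evalq :: "rat poly \<Rightarrow> 'k::field_char_0 \<Rightarrow> 'k" where
  "evalq p x = poly (map_poly of_rat p) x"

lemma evalq_0 [simp]: "evalq 0 x = 0"
  and evalq_pCons [simp]: "evalq (pCons a p) x = of_rat a + x * evalq p x"
  by (simp_all add: evalq_def map_poly_pCons)

lemma evalq_1 [simp]: "evalq 1 x = 1"
  by (simp add: one_pCons)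

lemma evalq_add [simp]: "evalq (p + q) x = evalq p x + evalq q x"
  by (induction p q rule: poly_induct2) (simp_all add: of_rat_add algebra_simps)

lemma evalq_smult [simp]: "evalq (smult a p) x = of_rat a * evalq p x"
  by (induction p) (simp_all add: of_rat_mult algebra_simps)

lemma evalq_minus [simp]: "evalq (- p) x = - evalq p x"
  using evalq_smult[of "-1" p x] by simp

lemma evalq_diff [simp]: "evalq (p - q) x = evalq p x - evalq q x"
  using evalq_add[of p "- q" x] by simp

lemma evalq_mult [simp]: "evalq (p * q) x = evalq p x * evalq q x"
  by (induction p) (simp_all add: algebra_simps)

lemma evalq_monom: "evalq (monom a n) x = of_rat a * x ^ n"
  by (induction n) (simp_all add: monom_0 monom_Suc algebra_simps)

lemma evalq_sum: "evalq (\<Sum>i\<in>A. f i) x = (\<Sum>i\<in>A. evalq (f i) x)"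
  by (induction A rule: infinite_finite_induct) simp_all

lemma evalq_altdef: "evalq p x = (\<Sum>i\<le>degree p. of_rat (coeff p i) * x ^ i)"
proof -
  have "evalq p x = evalq (\<Sum>i\<le>degree p. monom (coeff p i) i) x"
    by (simp add: poly_as_sum_of_monoms)
  then show ?thesis by (simp only: evalq_sum evalq_monom)
qed

definition adjoin :: "'k::field_char_0 \<Rightarrow> 'k set" where
  "adjoin x = range (\<lambda>p. evalq p x)"

lemma adjoin_subalgebra: "rat_subalgebra (adjoin x)"
  unfolding rat_subalgebra_def
proof (intro conjI ballI)
  show "rat_vs.subspace (adjoin x)"
  proof (rule rat_vs.subspaceI)
    show "0 \<in> adjoin x" unfolding adjoin_def using evalq_0 by (metis rangeI)
    show "y + z \<in> adjoin x" if "y \<in> adjoin x" "z \<in> adjoin x" for y z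
      using that unfolding adjoin_def by (auto simp flip: evalq_add)
    show "rscale c y \<in> adjoin x" if "y \<in> adjoin x" for c y
      using that unfolding adjoin_def rscale_def by (auto simp flip: evalq_smult)
  qed
  show "1 \<in> adjoin x" unfolding adjoin_def using evalq_1 by (metis rangeI)
  show "y * z \<in> adjoin x" if "y \<in> adjoin x" "z \<in> adjoin x" for y z
    using that unfolding adjoin_def by (auto simp flip: evalq_mult)
qed

lemma subalgebra_of_rat: "rat_subalgebra L \<Longrightarrow> of_rat q \<in> L"
  using rat_vs.subspace_scale[of L 1 q] by (simp add: rat_subalgebra_def rscale_def)

lemma subalgebra_add: "rat_subalgebra L \<Longrightarrow> y \<in> L \<Longrightarrow> z \<in> L \<Longrightarrow> y + z \<in> L"
  and subalgebra_mult: "rat_subalgebra L \<Longrightarrow> y \<in> L \<Longrightarrow> z \<in> L \<Longrightarrow> y * z \<in> L"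
  by (auto simp: rat_subalgebra_def rat_vs.subspace_add)

lemma subalgebra_evalq: "rat_subalgebra L \<Longrightarrow> y \<in> L \<Longrightarrow> evalq p y \<in> L"
proof (induction p)
  case 0
  then show ?case using subalgebra_of_rat[of L 0] by simp
next
  case (pCons a p)
  then show ?case by (simp add: subalgebra_of_rat subalgebra_add subalgebra_mult)
qed

lemma adjoin_self: "x \<in> adjoin x"
  using evalq_monom[of 1 1 x] unfolding adjoin_def by (metis mult_1 of_rat_1 power_one_right rangeI)

lemma adjoin_subset: "rat_subalgebra L \<Longrightarrow> y \<in> L \<Longrightarrow> adjoin y \<subseteq> L"
  using subalgebra_evalq unfolding adjoin_def by blast

lemma independent_powers:
  fixes x :: "'k::field_char_0"
  assumes nz: "\<And>q. degree q < n \<Longrightarrow> evalq q x = 0 \<Longrightarrow> q = 0"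
  shows "inj_on (\<lambda>i. x ^ i) {..<n}" "rat_vs.independent ((\<lambda>i. x ^ i) ` {..<n})"
proof -
  show inj: "inj_on (\<lambda>i. x ^ i) {..<n}"
  proof (rule inj_onI)
    fix i j assume ij: "i \<in> {..<n}" "j \<in> {..<n}" "x ^ i = x ^ j"
    let ?q = "monom 1 i - monom 1 j :: rat poly"
    have "degree ?q < n"
      using ij by (intro le_less_trans[OF degree_diff_le_max]) (auto simp: degree_monom_eq)
    moreover have "evalq ?q x = 0" using ij by (simp add: evalq_monom)
    ultimately have "?q = 0" by (rule nz)
    then show "i = j" by (metis degree_monom_eq eq_iff_diff_eq_0 zero_neq_one)
  qed
  show "rat_vs.independent ((\<lambda>i. x ^ i) ` {..<n})"
    unfolding rat_vs.dependent_finite[OF finite_imageI[OF finite_lessThan]]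
  proof safe
    fix c and i
    assume i: "i < n" "c (x ^ i) \<noteq> 0"
      and sum: "(\<Sum>v\<in>(\<lambda>i. x ^ i) ` {..<n}. rscale (c v) v) = 0"
    let ?q = "\<Sum>i<n. monom (c (x ^ i)) i"
    have "evalq ?q x = 0"
      using sum by (simp add: sum.reindex[OF inj] evalq_sum evalq_monom rscale_def)
    moreover have "degree ?q < n"
      using i(1) by (intro degree_sum_less) (auto intro: le_less_trans[OF degree_monom_le])
    ultimately have "?q = 0" using nz by blast
    moreover have "coeff ?q i = c (x ^ i)"
      using i(1) by (simp add: coeff_sum)
    ultimately show False using i(2) by simp
  qed
qed

text \<open>Independent powers of \<open>x\<close> cannot outnumber the dimension of
  \<open>K\<close>, so an annihilating polynomial exists; one of least degree \<open>n\<close>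
  works. Remainders modulo it show that \<open>n\<close> powers of \<open>x\<close> form a basis of
  \<open>adjoin x\<close>, and the tower law gives the divisibility.\<close>

lemma minimal_polynomial:
  fixes x :: "'k::field_char_0"
  assumes deg: "degree_over_rat TYPE('k) > 0"
  obtains p where "lead_coeff p = 1" "evalq p x = 0" "\<And>q. evalq q x = 0 \<Longrightarrow> p dvd q"
    "degree p = rat_vs.dim (adjoin x)" "degree p dvd degree_over_rat TYPE('k)"
proof -
  obtain B :: "'k set" where "finite_dimensional_vector_space rscale B"
    using finite_degree_basis[OF deg] .
  then interpret finite_dimensional_vector_space "rscale :: rat \<Rightarrow> 'k \<Rightarrow> 'k" B .
  have "\<exists>q. q \<noteq> 0 \<and> evalq q x = 0"
  proof (rule ccontr)
    assume "\<not> ?thesis"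
    then have *: "inj_on (\<lambda>i. x ^ i) {..<n}" "rat_vs.independent ((\<lambda>i. x ^ i) ` {..<n})" for n
      using independent_powers[of n x] by blast+
    have "n \<le> rat_vs.dim (UNIV :: 'k set)" for n
      using independent_card_le_dim[OF subset_UNIV *(2)[of n]] card_image[OF *(1)[of n]] by simp
    then show False using not_less_eq_eq by blast
  qed
  then obtain p0 where p0: "p0 \<noteq> 0" "evalq p0 x = 0"
    and min0: "\<And>q. q \<noteq> 0 \<Longrightarrow> evalq q x = 0 \<Longrightarrow> degree p0 \<le> degree q"
    using ex_has_least_nat[of "\<lambda>q. q \<noteq> 0 \<and> evalq q x = 0" _ degree] by blast
  define p where "p = smult (1 / lead_coeff p0) p0"
  define n where "n = degree p"
  have p: "lead_coeff p = 1" "evalq p x = 0"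
    using p0 by (simp_all add: p_def)
  have min: "q = 0" if "degree q < n" "evalq q x = 0" for q
    using that min0[of q] p0(1) by (auto simp: n_def p_def)
  have "p \<noteq> 0" using p(1) by auto
  have "n \<noteq> 0"
  proof
    assume "n = 0"
    then obtain a where "p = [:a:]" unfolding n_def using degree_eq_zeroE by blast
    then show False using p by simp
  qed
  have modp: "evalq (q mod p) x = evalq q x" for q
    using p(2) div_mult_mod_eq[of q p] by (metis add_0 evalq_add evalq_mult mult_zero_right)
  have degmod: "degree (q mod p) < n" for q
    using degree_mod_less[OF \<open>p \<noteq> 0\<close>, of q] \<open>n \<noteq> 0\<close> unfolding n_def by auto
  have "p dvd q" if "evalq q x = 0" for q
    using min[OF degmod[of q]] modp[of q] that by auto
  moreover have dim: "n = rat_vs.dim (adjoin x)"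
  proof -
    let ?B = "(\<lambda>i. x ^ i) ` {..<n}"
    have ind: "inj_on (\<lambda>i. x ^ i) {..<n}" "rat_vs.independent ?B"
      by (rule independent_powers, rule min; assumption)+
    have "adjoin x \<subseteq> rat_vs.span ?B"
    proof
      fix y assume "y \<in> adjoin x"
      then obtain q where "y = evalq q x" unfolding adjoin_def by blast
      then have "y = evalq (q mod p) x" using modp by simp
      then have "y = (\<Sum>i\<le>degree (q mod p). rscale (coeff (q mod p) i) (x ^ i))"
        by (simp add: evalq_altdef rscale_def)
      moreover have "x ^ i \<in> rat_vs.span ?B" if "i \<le> degree (q mod p)" for i
        using degmod[of q] that by (intro rat_vs.span_base) auto
      ultimately show "y \<in> rat_vs.span ?B"
        by (auto intro!: rat_vs.span_sum rat_vs.span_scale)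
    qed
    moreover have "?B \<subseteq> adjoin x"
      unfolding adjoin_def using evalq_monom[of 1 _ x] by (auto simp: image_iff) metis
    ultimately have "card ?B = rat_vs.dim (adjoin x)"
      using ind(2) rat_vs.basis_card_eq_dim by blast
    then show ?thesis using card_image[OF ind(1)] by simp
  qed
  moreover have "n dvd degree_over_rat TYPE('k)"
    unfolding dim degree_over_rat_dim
    by (rule subalgebra_dim_dvd[OF deg adjoin_subalgebra])
       (auto simp: rat_subalgebra_def)
  ultimately show thesis
    by (intro that[of p] p) (simp_all add: n_def)
qed

section \<open>Elements of a sextic field that are quadratic over a subfield\<close>

lemma quadratic_dim:
  fixes y :: "'k::field_char_0"
  assumes deg: "degree_over_rat TYPE('k) > 0" and L: "rat_subalgebra L" and "y \<notin> L"
  shows "rat_vs.dim {u + y * v | u v. u \<in> L \<and> v \<in> L} = 2 * rat_vs.dim L"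
proof -
  obtain B :: "'k set" where "finite_dimensional_vector_space rscale B"
    using finite_degree_basis[OF deg] .
  then interpret finite_dimensional_vector_space "rscale :: rat \<Rightarrow> 'k \<Rightarrow> 'k" B .
  have s: "rat_vs.subspace L" using L unfolding rat_subalgebra_def by blast
  have "y \<noteq> 0" using \<open>y \<notin> L\<close> rat_vs.subspace_0[OF s] by auto
  have "v = 0" if "y * v \<in> L" "v \<in> L" for v
    using subalgebra_divide[OF deg L that(2,1)] \<open>y \<notin> L\<close> by (auto split: if_splits)
  then have "L \<inter> (\<lambda>v. y * v) ` L = {0}"
    using rat_vs.subspace_0[OF s] by (auto intro: rev_image_eqI)
  then have "rat_vs.dim {u + w | u w. u \<in> L \<and> w \<in> (\<lambda>v. y * v) ` L} = 2 * rat_vs.dim L"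
    using dim_sums_Int[OF s subspace_mult_image[OF s], of y] dim_mult_image[OF deg \<open>y \<noteq> 0\<close>, of L]
    by simp
  moreover have "{u + w | u w. u \<in> L \<and> w \<in> (\<lambda>v. y * v) ` L} = {u + y * v | u v. u \<in> L \<and> v \<in> L}"
    by blast
  ultimately show ?thesis by simp
qed

text \<open>Otherwise \<open>L + y L\<close> is a subalgebra whose dimension is a multiple of 4 and
  divides 6. This is what forces square roots over a quadratic subfield of \<open>K\<close> back
  into that subfield.\<close>

lemma quadratic_over_even_subalgebra:
  fixes y :: "'k::field_char_0"
  assumes deg: "degree_over_rat TYPE('k) = 6" and L: "rat_subalgebra L"
    and even: "even (rat_vs.dim L)"
    and y: "y * y = b + y * c" "b \<in> L" "c \<in> L"
  shows "y \<in> L"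
proof (rule ccontr)
  assume "y \<notin> L"
  let ?M = "{u + y * v | u v. u \<in> L \<and> v \<in> L}"
  have deg0: "degree_over_rat TYPE('k) > 0" using deg by simp
  have s: "rat_vs.subspace L" "1 \<in> L" using L unfolding rat_subalgebra_def by blast+
  have dim: "rat_vs.dim ?M = 2 * rat_vs.dim L" using quadratic_dim[OF deg0 L \<open>y \<notin> L\<close>] .
  have "rat_subalgebra ?M"
    unfolding rat_subalgebra_def
  proof (intro conjI ballI)
    have "?M = {u + w | u w. u \<in> L \<and> w \<in> (\<lambda>v. y * v) ` L}" by blast
    then show "rat_vs.subspace ?M"
      using rat_vs.subspace_sums[OF s(1) subspace_mult_image[OF s(1), of y]] by simp
    have "1 = 1 + y * 0" by simp
    then show "1 \<in> ?M" using s rat_vs.subspace_0[OF s(1)] by blast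
    fix m m' assume "m \<in> ?M" "m' \<in> ?M"
    then obtain u v u' v' where m: "m = u + y * v" "m' = u' + y * v'"
      and uv: "u \<in> L" "v \<in> L" "u' \<in> L" "v' \<in> L" by blast
    have "m * m' = u * u' + (y * y) * (v * v') + y * (u * v' + u' * v)"
      unfolding m by (simp add: algebra_simps)
    also have "\<dots> = (u * u' + b * (v * v')) + y * (u * v' + u' * v + c * (v * v'))"
      unfolding y(1) by (simp add: algebra_simps)
    finally show "m * m' \<in> ?M"
      using uv y(2,3) by (blast intro: subalgebra_add[OF L] subalgebra_mult[OF L])
  qed
  then have "rat_vs.dim ?M dvd rat_vs.dim (UNIV :: 'k set)"
    by (rule subalgebra_dim_dvd[OF deg0]) (auto simp: rat_subalgebra_def)
  then have "2 * rat_vs.dim L dvd 6" using dim deg degree_over_rat_dim by metis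
  then have "2 * 2 dvd (6::nat)" using even by (meson dvd_trans mult_dvd_mono dvd_refl)
  then show False by simp
qed

text \<open>If \<open>y\<close> is not in \<open>L\<close>, then \<open>L + y L\<close> already has
  dimension 6 and contains \<open>y * y\<close>.\<close>

lemma quadratic_over_cubic_subalgebra:
  fixes y :: "'k::field_char_0"
  assumes deg: "degree_over_rat TYPE('k) = 6" and L: "rat_subalgebra L"
    and dim: "rat_vs.dim L = 3"
  obtains b c where "y * y = b + y * c" "b \<in> L" "c \<in> L"
proof (cases "y \<in> L")
  case True
  then show thesis using that[of "y * y" 0] L subalgebra_of_rat[OF L, of 0] subalgebra_mult[OF L] by simp
next
  case False
  let ?M = "{u + y * v | u v. u \<in> L \<and> v \<in> L}"
  have deg0: "degree_over_rat TYPE('k) > 0" using deg by simp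
  obtain B :: "'k set" where "finite_dimensional_vector_space rscale B"
    using finite_degree_basis[OF deg0] .
  then interpret finite_dimensional_vector_space "rscale :: rat \<Rightarrow> 'k \<Rightarrow> 'k" B .
  have s: "rat_vs.subspace L" using L unfolding rat_subalgebra_def by blast
  have "?M = {u + w | u w. u \<in> L \<and> w \<in> (\<lambda>v. y * v) ` L}" by blast
  then have "rat_vs.subspace ?M"
    using rat_vs.subspace_sums[OF s(1) subspace_mult_image[OF s(1), of y]] by simp
  then have "?M = UNIV"
    using quadratic_dim[OF deg0 L False] deg dim degree_over_rat_dim[where 'k='k]
    by (intro subspace_dim_equal) auto
  then have "y * y \<in> ?M" by simp
  then show thesis using that by blast
qed

lemma degree_six_cases:
  fixes x :: "'k::field_char_0"
  assumes deg: "degree_over_rat TYPE('k) = 6"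
  obtains (rational) a where "x = of_rat a"
  | (quadratic) s p where "x \<notin> \<rat>" "x * x = of_rat s * x - of_rat p"
  | (cubic) p q r where "evalq [:r, q, p, 1:] x = 0"
      "\<And>f. evalq f x = 0 \<Longrightarrow> [:r, q, p, 1:] dvd f" "rat_vs.dim (adjoin x) = 3"
  | (sextic) p where "lead_coeff p = 1" "degree p = 6" "evalq p x = 0"
      "\<And>f. evalq f x = 0 \<Longrightarrow> degree f < 6 \<Longrightarrow> f = 0" "rat_vs.dim (adjoin x) = 6"
proof -
  obtain p where p: "lead_coeff p = 1" "evalq p x = 0" "\<And>q. evalq q x = 0 \<Longrightarrow> p dvd q"
    and dim: "degree p = rat_vs.dim (adjoin x)" and dvd: "degree p dvd degree_over_rat TYPE('k)"
    using minimal_polynomial[of x] deg by auto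
  have "degree p dvd 6" using dvd deg by simp
  then have "degree p \<le> 6" by (rule dvd_imp_le) simp
  then have "degree p \<in> {0..6}" by simp
  also have "{0..6::nat} = {0, 1, 2, 3, 4, 5, 6}" by auto
  finally consider "degree p = 1" | "degree p = 2" | "degree p = 3" | "degree p = 6"
    using \<open>degree p dvd 6\<close> by auto
  then show thesis
  proof cases
    case 1
    have "p = [:coeff p 0, 1:]"
      using 1 p(1) by (intro poly_eqI) (auto simp: coeff_pCons coeff_eq_0 split: nat.split)
    then obtain a where "p = [:a, 1:]" by blast
    then have "x = of_rat (- a)" using p(2) by (simp add: of_rat_minus eq_neg_iff_add_eq_0 add.commute)
    then show thesis by (rule rational)
  next
    case 2
    have "p = [:coeff p 0, coeff p 1, 1:]"
      using 2 p(1) by (intro poly_eqI) (auto simp: coeff_pCons numeral_2_eq_2 coeff_eq_0 split: nat.split)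
    then have eq: "evalq [:coeff p 0, coeff p 1, 1:] x = 0" using p(2) by simp
    have "x \<notin> \<rat>"
    proof
      assume "x \<in> \<rat>"
      then obtain a where "x = of_rat a" by (elim Rats_cases)
      then have "p dvd [:- a, 1:]" by (intro p(3)) (simp add: of_rat_minus)
      then show False using dvd_imp_degree_le[of p "[:- a, 1:]"] 2 by simp
    qed
    moreover have "x * x = of_rat (- coeff p 1) * x - of_rat (coeff p 0)"
      using eq by (simp add: of_rat_minus algebra_simps eq_neg_iff_add_eq_0)
    ultimately show thesis by (rule quadratic)
  next
    case 3
    have "p = [:coeff p 0, coeff p 1, coeff p 2, 1:]"
      using 3 p(1) by (intro poly_eqI) (auto simp: coeff_pCons numeral_2_eq_2 numeral_3_eq_3 coeff_eq_0 split: nat.split)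
    then show thesis using cubic p(2,3) dim 3 by metis
  next
    case 4
    have "f = 0" if "evalq f x = 0" "degree f < 6" for f
      using p(3)[OF that(1)] dvd_imp_degree_le[of p f] 4 that(2) by auto
    then show thesis using sextic[of p] p(1,2) 4 dim by auto
  qed
qed

lemma rat_indep2:
  assumes "(x::'k::field_char_0) \<notin> \<rat>" "of_rat a + of_rat b * x = of_rat c + of_rat d * x"
  shows "a = c" "b = d"
proof -
  have *: "of_rat (b - d) * x = of_rat (c - a)"
    using assms(2) by (simp add: of_rat_diff algebra_simps)
  show "b = d"
  proof (rule ccontr)
    assume "b \<noteq> d"
    then have "x = of_rat ((c - a) / (b - d))"
      using * by (simp add: of_rat_divide of_rat_diff field_simps)
    then show False using assms(1) by simp
  qed
  then show "a = c" using assms(2) by simp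
qed

lemma adjoin_quadratic:
  fixes x :: "'k::field_char_0"
  assumes deg: "degree_over_rat TYPE('k) = 6"
    and x: "x \<notin> \<rat>" "x * x = of_rat s * x - of_rat p"
  shows "rat_vs.dim (adjoin x) = 2" "adjoin x = {of_rat a + of_rat b * x | a b. True}"
proof -
  have ev: "evalq [:p, - s, 1:] x = 0"
    using x(2) by (simp add: of_rat_minus algebra_simps)
  obtain m where m: "lead_coeff m = 1" "evalq m x = 0" "\<And>q. evalq q x = 0 \<Longrightarrow> m dvd q"
    "degree m = rat_vs.dim (adjoin x)" "degree m dvd degree_over_rat TYPE('k)"
    by (rule minimal_polynomial[of x, unfolded deg]) (simp_all add: deg)
  have "degree m \<le> 2" using dvd_imp_degree_le[OF m(3)[OF ev]] by simp
  moreover have "\<not> degree m \<le> 1"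
  proof
    assume "degree m \<le> 1"
    then have "m = [:coeff m 0, coeff m 1:]"
      by (intro poly_eqI) (auto simp: coeff_pCons coeff_eq_0 split: nat.split)
    then have "evalq [:coeff m 0, coeff m 1:] x = 0"
      by (rule subst) (rule m(2))
    then have e: "of_rat (coeff m 0) + of_rat (coeff m 1) * x = of_rat 0 + of_rat 0 * x"
      by (simp add: mult.commute)
    have "m = 0" using rat_indep2[OF x(1) e] \<open>m = [:coeff m 0, coeff m 1:]\<close> by simp
    then show False using m(1) by simp
  qed
  ultimately show "rat_vs.dim (adjoin x) = 2" using m(4) by simp
  have "\<exists>a b. evalq q x = of_rat a + of_rat b * x" for q
  proof (induction q)
    case 0
    then show ?case by (intro exI[of _ 0]) simp
  next
    case (pCons c q)
    then obtain a b where "evalq q x = of_rat a + of_rat b * x" by blast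
    then have "evalq (pCons c q) x = of_rat c + of_rat a * x + of_rat b * (x * x)"
      by (simp add: algebra_simps)
    also have "\<dots> = of_rat (c - b * p) + of_rat (a + b * s) * x"
      unfolding x(2) by (simp add: of_rat_diff of_rat_add of_rat_mult algebra_simps)
    finally show ?case by blast
  qed
  moreover have "of_rat a + of_rat b * x \<in> adjoin x" for a b
    by (intro subalgebra_add[OF adjoin_subalgebra] subalgebra_mult[OF adjoin_subalgebra]
        adjoin_self subalgebra_of_rat[OF adjoin_subalgebra])
  ultimately show "adjoin x = {of_rat a + of_rat b * x | a b. True}"
    unfolding adjoin_def by auto
qed

lemma quadratic_over_quadratic:
  fixes x y :: "'k::field_char_0"
  assumes deg: "degree_over_rat TYPE('k) = 6"
    and x: "x \<notin> \<rat>" "x * x = of_rat s * x - of_rat p"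
    and y: "y * y = of_rat a + of_rat b * x + y * (of_rat c + of_rat d * x)"
  obtains e f where "y = of_rat e + of_rat f * x"
proof -
  note A = adjoin_quadratic[OF deg x]
  have "y \<in> adjoin x"
    using A by (intro quadratic_over_even_subalgebra[OF deg adjoin_subalgebra _ y]) auto
  then show thesis using that A(2) by auto
qed

text \<open>\<open>K\<close> contains no biquadratic field: if \<open>u\<close> is irrational,
  \<open>v\<close> lies in the field of \<open>u\<close>, and \<open>(a + b u)^2\<close> is rational
  only when \<open>a\<close> or \<open>b\<close> vanishes.\<close>

lemma square_classes:
  fixes u v :: "'k::field_char_0"
  assumes deg: "degree_over_rat TYPE('k) = 6"
    and "u^2 = of_rat k" "v^2 = of_rat d"
  obtains w where "k = w^2" | w where "d = w^2" | w where "d = k * w^2"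
proof (cases "u \<in> \<rat>")
  case True
  then obtain w where "u = of_rat w" by (elim Rats_cases)
  then have "k = w^2" using assms(2) by (simp flip: of_rat_power)
  then show thesis by (rule that)
next
  case False
  have "u * u = of_rat 0 * u - of_rat (- k)" "v * v = of_rat d + of_rat 0 * u + v * (of_rat 0 + of_rat 0 * u)"
    using assms by (simp_all add: power2_eq_square of_rat_minus)
  then obtain a b where v: "v = of_rat a + of_rat b * u"
    using quadratic_over_quadratic[OF deg False] by metis
  have "of_rat d = v^2" using assms by simp
  also have "\<dots> = of_rat (a^2 + b^2 * k) + of_rat (2 * a * b) * u"
    unfolding v using assms(2)
    by (simp add: power2_eq_square of_rat_add of_rat_mult algebra_simps)
  finally have "of_rat d + of_rat 0 * u = of_rat (a^2 + b^2 * k) + of_rat (2 * a * b) * u" by simp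
  note rat_indep2[OF False this]
  then show thesis using that(2)[of a] that(3)[of b] by (auto simp: algebra_simps)
qed

text \<open>The quartic is the 3-division polynomial of \<open>y^2 = x^3 + a x^2 + b x + c\<close>;
  \<open>odd\<close> and \<open>ev\<close> say that both square roots of \<open>e\<close> are roots
  of it, so the cofactor is \<open>3 x^2 + 4 a x + 6 b + 3 e\<close>. By \<open>n1\<close> and
  \<open>n2\<close> the ordinate over a square root of \<open>e\<close> lies in the quadratic field,
  and its norm turns the discriminant of the cofactor into a square.\<close>

lemma flex_quadratic_identity:
  fixes e a b c \<alpha> \<beta> :: rat
  assumes "e \<noteq> 0" and odd: "4 * a * e + 12 * c = 0" and ev: "3 * e^2 + 6 * b * e + 4 * a * c - b^2 = 0"
    and n1: "\<alpha>^2 + \<beta>^2 * e = a * e + c" and n2: "2 * \<alpha> * \<beta> = e + b"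
  obtains x where "3 * x^4 + 4 * a * x^3 + 6 * b * x^2 + 12 * c * x + (4 * a * c - b^2) = 0"
proof -
  \<comment> \<open>The bracket is the norm of the ordinate; its square is the norm of the value of
    the cubic. Rescaled by \<open>3 / e\<close> it becomes a square root of the discriminant
    \<open>16 a^2 - 12 (6 b + 3 e)\<close> of the cofactor.\<close>
  define \<delta> where "\<delta> = 3 * (\<alpha>^2 - \<beta>\<^sup>2 * e) / e"
  define x where "x = (\<delta> - 4 * a) / 6"
  have c: "c = - a * e / 3" using odd by (simp add: field_simps)
  have "(\<alpha>^2 - \<beta>\<^sup>2 * e)^2 = (a * e + c)^2 - e * (e + b)^2"
    unfolding n1[symmetric] n2[symmetric] by algebra
  moreover have "\<delta> * e = 3 * (\<alpha>^2 - \<beta>\<^sup>2 * e)" using \<open>e \<noteq> 0\<close> by (simp add: \<delta>_def)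
  ultimately have d: "\<delta>^2 * e^2 = 9 * ((a * e + c)^2 - e * (e + b)^2)" by algebra
  have ev': "4 * a^2 * e = 9 * e^2 + 18 * b * e - 3 * b^2"
    using ev unfolding c by (simp add: power2_eq_square field_simps)
  have "e^2 * \<delta>^2 = e^2 * (16 * a^2 - 12 * (6 * b + 3 * e))"
  proof -
    have "3 * (a * e + c) = 2 * a * e" unfolding c by simp
    then show ?thesis using d ev' by algebra
  qed
  then have "\<delta>^2 = 16 * a^2 - 12 * (6 * b + 3 * e)" using \<open>e \<noteq> 0\<close> by simp
  moreover have "\<delta> = 6 * x + 4 * a" by (simp add: x_def field_simps)
  ultimately have q: "3 * x^2 + 4 * a * x + 6 * b + 3 * e = 0"
    by (simp add: power2_eq_square algebra_simps)
  have "3 * x^4 + 4 * a * x^3 + 6 * b * x^2 + 12 * c * x + (4 * a * c - b^2)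
      = (x^2 - e) * (3 * x^2 + 4 * a * x + 6 * b + 3 * e)"
    using odd ev by algebra
  then show thesis using q that by simp
qed

lemma of_rat_simps: 
  "of_rat (a + b) = (of_rat a + of_rat b :: 'k::field_char_0)"
  "of_rat (a - b) = (of_rat a - of_rat b :: 'k)"
  "of_rat (a * b) = (of_rat a * of_rat b :: 'k)"
  "of_rat (- a) = (- of_rat a :: 'k)"
  "of_rat (a ^ n) = (of_rat a ^ n :: 'k)"
  "of_rat (a / b) = (of_rat a / of_rat b :: 'k)"
  by (simp_all add: of_rat_add of_rat_diff of_rat_mult of_rat_minus of_rat_power of_rat_divide)

text \<open>\<open>X\<close> is a root of a rational quartic, so degree 6 is impossible and degree 3
  leaves a linear cofactor. In degree 2 the quartic alone does not suffice: the ordinate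
  \<open>Y\<close> must lie in \<open>K\<close>, hence in the field of \<open>X\<close>.\<close>

lemma rational_flex:
  fixes X Y :: "'k::field_char_0"
  assumes deg: "degree_over_rat TYPE('k) = 6"
    and curve: "Y^2 = X^3 + of_rat A * X + of_rat B"
    and flex: "3 * X^4 + 6 * of_rat A * X^2 + 12 * of_rat B * X - (of_rat A)^2 = 0"
  obtains x :: rat where "3 * x^4 + 6 * A * x^2 + 12 * B * x - A^2 = 0"
proof -
  let ?f = "[: - A\<^sup>2, 12 * B, 6 * A, 0, 3 :]"
  have ev: "evalq ?f X = 0"
    using flex by (simp add: of_rat_simps algebra_simps power2_eq_square power4_eq_xxxx)
  show thesis
  proof (rule degree_six_cases[OF deg, of X])
    fix a assume "X = of_rat a"
    then have "of_rat (3 * a^4 + 6 * A * a^2 + 12 * B * a - A^2) = (0 :: 'k)"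
      using flex by (simp add: of_rat_simps)
    then show thesis using that by (simp only: of_rat_eq_0_iff)
  next
    fix s p assume X: "X \<notin> \<rat>" "X * X = of_rat s * X - of_rat p"
    define c where "c = s / 2"
    define e where "e = c^2 - p"
    define S where "S = X - of_rat c"
    have S: "S \<notin> \<rat>"
    proof
      assume "S \<in> \<rat>"
      then have "S + of_rat c \<in> \<rat>" by (intro Rats_add) auto
      then show False using X(1) by (simp add: S_def)
    qed
    have "of_rat s = 2 * (of_rat c :: 'k)" by (simp add: c_def of_rat_simps)
    then have S2: "S^2 = of_rat e"
      using X(2) by (simp add: S_def e_def of_rat_simps power2_eq_square algebra_simps)
    have "e \<noteq> 0"
    proof
      assume "e = 0"
      then have "S = 0" using S2 by simp
      then show False using S by simp
    qed
    define b where "b = 3 * c^2 + A"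
    define d where "d = c^3 + A * c + B"
    have XS: "X = S + of_rat c" by (simp add: S_def)
    let ?c = "of_rat c :: 'k" and ?A = "of_rat A :: 'k" and ?B = "of_rat B :: 'k" and ?e = "of_rat e :: 'k"
      and ?b = "of_rat b :: 'k" and ?d = "of_rat d :: 'k"
    have bd: "?b = 3 * ?c^2 + ?A" "?d = ?c^3 + ?A * ?c + ?B"
      by (simp_all add: b_def d_def of_rat_simps)
    have "(3 * ?e^2 + 6 * ?b * ?e + 4 * (3 * ?c) * ?d - ?b^2) + (4 * (3 * ?c) * ?e + 12 * ?d) * S
      = 3 * X^4 + 6 * ?A * X^2 + 12 * ?B * X - ?A^2"
      using bd XS S2 by algebra
    then have "of_rat (3 * e^2 + 6 * b * e + 4 * (3 * c) * d - b^2) + of_rat (4 * (3 * c) * e + 12 * d) * S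
       = of_rat 0 + of_rat 0 * S"
      using flex by (simp add: of_rat_simps)
    note r1 = rat_indep2[OF S this]
    have Y2: "Y^2 = of_rat (3 * c * e + d) + of_rat (e + b) * S"
      using bd XS S2 curve unfolding of_rat_simps of_rat_numeral_eq by algebra
    then have "Y * Y = of_rat (3 * c * e + d) + of_rat (e + b) * S + Y * (of_rat 0 + of_rat 0 * S)"
      by (simp add: power2_eq_square)
    moreover have "S * S = of_rat 0 * S - of_rat (- e)"
      using S2 by (simp add: power2_eq_square of_rat_minus)
    ultimately obtain \<alpha> \<beta> where Y: "Y = of_rat \<alpha> + of_rat \<beta> * S"
      using quadratic_over_quadratic[OF deg S] by metis
    have "Y^2 = (of_rat \<alpha>)^2 + (of_rat \<beta>)^2 * S^2 + 2 * of_rat \<alpha> * of_rat \<beta> * S"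
      unfolding Y by algebra
    then have "of_rat (\<alpha>^2 + \<beta>^2 * e) + of_rat (2 * \<alpha> * \<beta>) * S = Y^2"
      unfolding S2 by (simp add: of_rat_simps)
    then have "of_rat (\<alpha>^2 + \<beta>^2 * e) + of_rat (2 * \<alpha> * \<beta>) * S = of_rat (3 * c * e + d) + of_rat (e + b) * S"
      using Y2 by simp
    note r2 = rat_indep2[OF S this]
    obtain x where "3 * x^4 + 4 * (3 * c) * x^3 + 6 * b * x^2 + 12 * d * x + (4 * (3 * c) * d - b^2) = 0"
      using flex_quadratic_identity[OF \<open>e \<noteq> 0\<close> r1(2,1) r2] by blast
    then have "3 * (x + c)^4 + 6 * A * (x + c)^2 + 12 * B * (x + c) - A^2 = 0"
      unfolding b_def d_def by algebra
    then show thesis by (rule that)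
  next
    fix p q r assume "\<And>f. evalq f X = 0 \<Longrightarrow> [:r, q, p, 1:] dvd f"
    then have "[:r, q, p, 1:] dvd ?f" using ev by blast
    then obtain k where k: "?f = [:r, q, p, 1:] * k" by (elim dvdE)
    then have "k \<noteq> 0" by auto
    then have "degree ?f = 3 + degree k" unfolding k by (subst degree_mult_eq) auto
    then have "degree k = 1" by simp
    then obtain u v where uv: "k = [:u, v:]" "v \<noteq> 0"
      by (metis degree_eq_zeroE degree_pCons_eq_if nat.inject One_nat_def pCons_cases zero_neq_one pCons_eq_0_iff)
    have "poly ?f (- u / v) = 0" unfolding k uv by (simp add: uv(2))
    then show thesis using that[of "- u / v"]
      by (simp add: algebra_simps power2_eq_square power4_eq_xxxx)
  next
    fix p assume "\<And>f. evalq f X = 0 \<Longrightarrow> degree f < 6 \<Longrightarrow> f = 0"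
    from this[OF ev] show thesis by simp
  qed
qed

section \<open>Fields of definition of 5-isogenies\<close>

text \<open>Otherwise the valuation at \<open>p\<close> is even on the left and odd on the right. It
  serves for the factors 5 and \<open>6 = 2 * 3\<close>.\<close>

lemma rat_square_prime_mult:
  fixes x y :: rat and p m :: int
  assumes "prime p" "\<not> p dvd m" and eq: "x^2 = of_int (p * m) * y^2"
  shows "y = 0"
proof (rule ccontr)
  assume "y \<noteq> 0"
  obtain a b where ab: "quotient_of (x / y) = (a, b)" by fastforce
  then have b: "b > 0" and cop: "coprime a b" and xy: "x / y = of_int a / of_int b"
    using quotient_of_denom_pos quotient_of_coprime quotient_of_div by blast+
  have "(x / y)^2 = of_int (p * m)" using eq \<open>y \<noteq> 0\<close> by (simp add: power_divide)
  then have "(of_int a :: rat)^2 = of_int (p * m) * (of_int b)^2"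
    unfolding xy using b by (simp add: power_divide field_simps)
  then have "(of_int (a^2) :: rat) = of_int (p * m * b^2)" by simp
  then have *: "a^2 = p * m * b^2" unfolding of_int_eq_iff .
  then have "p dvd a^2" by simp
  then have "p dvd a" using assms(1) by (simp add: prime_dvd_power_iff)
  then obtain k where "a = p * k" by (elim dvdE)
  then have "p * (m * b^2) = p * (p * k^2)" using * by algebra
  then have "m * b^2 = p * k^2" using prime_gt_0_int[OF assms(1)] by simp
  then have "p dvd m * b^2" by simp
  then have "p dvd b" using assms(1,2) by (simp add: prime_dvd_mult_iff prime_dvd_power_iff)
  then show False using \<open>p dvd a\<close> cop assms(1) by (meson coprime_common_divisor not_prime_unit)
qed

lemma rat_square_5:
  assumes "(x::rat)^2 = 5 * y^2"
  shows "x = 0" "y = 0"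
proof -
  have "prime (5::int)" by simp
  then show "y = 0" using rat_square_prime_mult[of 5 1 x y] assms by simp
  then show "x = 0" using assms by simp
qed

text \<open>
  The curve below parametrises unordered pairs of 5-isogenies with sum \<open>S\<close> and product \<open>P\<close> of
  their Hauptmodul values; it is the modular curve of the normaliser of a split Cartan group.
\<close>

lemma split_cartan_curve:
  fixes S P :: "'a::field_char_0"
  assumes "P * (S^4 - 3 * S^2 * P + P^2 + 30 * (S^3 - 2 * S * P) + 315 * (S^2 - P) + 1300 * S + 1575) = 125"
  shows "P * (S^2 + 15 * S + 45 + P)^2 = 5 * (5 + P * (S + 9))^2"
    and "S^2 + 15 * S + 45 + P = 0 \<Longrightarrow> (S = - 4 \<and> P = - 1) \<or> (S = - 10 \<and> P = 5)"
proof -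
  \<comment> \<open>The assumption says that \<open>x^2 - S x + P\<close> divides
    \<open>(x^2 + 10 x + 5)^3 - J x\<close> for some \<open>J\<close>: it is the constant term of
    the remainder, which is free of \<open>J\<close>. The groups of terms with coefficients 1, 30,
    315 and 1300 are the complete symmetric polynomials of degrees 4, 3, 2, 1 in the two
    roots.\<close>
  show *: "P * (S^2 + 15 * S + 45 + P)^2 = 5 * (5 + P * (S + 9))^2"
  proof -
    have "P * (S^2 + 15 * S + 45 + P)^2 - 5 * (5 + P * (S + 9))^2
      = P * (S^4 - 3 * S^2 * P + P^2 + 30 * (S^3 - 2 * S * P) + 315 * (S^2 - P) + 1300 * S + 1575) - 125"
      by algebra
    then show ?thesis using assms by simp
  qed
  assume A: "S^2 + 15 * S + 45 + P = 0"
  then have B: "5 + P * (S + 9) = 0" using * by simp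
  have P: "P = - (S^2 + 15 * S + 45)" using A by (simp add: eq_neg_iff_add_eq_0 algebra_simps)
  have "(S + 4) * (S + 10)^2 = 0" using B unfolding P by algebra
  then have "S = - 4 \<or> S = - 10" by (simp add: eq_neg_iff_add_eq_0)
  then show "(S = - 4 \<and> P = - 1) \<or> (S = - 10 \<and> P = 5)"
    using P by auto
qed

text \<open>The left side is the norm of \<open>h^2 + 22 h + 125\<close> for a root \<open>h\<close>
  of \<open>x^2 - S x + P\<close>. On this curve of genus 0 it becomes 5 times the square of a
  rational function of the uniformiser.\<close>

lemma split_cartan_norm:
  fixes S P :: rat
  assumes curve: "P * (S^4 - 3 * S^2 * P + P^2 + 30 * (S^3 - 2 * S * P) + 315 * (S^2 - P) + 1300 * S + 1575) = 125"
  obtains g where "(125 - P)^2 + (125 - P) * (22 + S) * S + (22 + S)^2 * P = 5 * g^2"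
proof (cases "S^2 + 15 * S + 45 + P = 0")
  case True
  \<comment> \<open>At these two points \<open>A = B = 0\<close> below; they are singular on the
    plane model, and the quotient defining the uniformiser breaks down there.\<close>
  then have "(S = - 4 \<and> P = - 1) \<or> (S = - 10 \<and> P = 5)" using split_cartan_curve(2)[OF curve] by blast
  then show thesis
  proof
    assume "S = - 4 \<and> P = - 1"
    then show thesis by (intro that[of 36]) simp
  next
    assume "S = - 10 \<and> P = 5"
    then show thesis by (intro that[of 12]) simp
  qed
next
  case False
  define A where "A = S^2 + 15 * S + 45 + P"
  define B where "B = 5 + P * (S + 9)"
  have AB: "P * A^2 = 5 * B^2" using split_cartan_curve(1)[OF curve] unfolding A_def B_def .
  have "P \<noteq> 0" using curve by auto
  have "A \<noteq> 0" using False by (simp add: A_def)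
  then have "B \<noteq> 0" using AB \<open>P \<noteq> 0\<close> by auto
  \<comment> \<open>The curve is uniformised by \<open>s\<close>: \<open>w = s\<^sup>2 + 5s + 5\<close>, \<open>P = 125/w\<^sup>2\<close>, \<open>S = (s\<^sup>3 - 15s)/w\<close>.\<close>
  define w where "w = 5 * A / B"
  have wB: "w * B = 5 * A" using \<open>B \<noteq> 0\<close> by (simp add: w_def)
  have "B^2 * (P * w^2) = B^2 * 125"
  proof -
    have "B^2 * (P * w^2) = P * (w * B)^2" by algebra
    also have "\<dots> = 25 * (P * A^2)" unfolding wB by algebra
    finally show ?thesis using AB by simp
  qed
  then have Pw: "P * w^2 = 125" using \<open>B \<noteq> 0\<close> by simp
  then have "w \<noteq> 0" by auto
  have "P * (- (w^3) + w^2 * (S^2 + 15 * S + 45) - w * (25 * S + 225) + 125)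
      = (P * w^2 - 125) * (S^2 + 15 * S + 45 - w) + 25 * (5 * A - w * B)"
    unfolding A_def B_def by algebra
  then have "P * (- (w^3) + w^2 * (S^2 + 15 * S + 45) - w * (25 * S + 225) + 125) = 0"
    unfolding Pw wB by simp
  then have quad: "(S * w + 5 * w - 25)^2 + 5 * (w + 5) * (S * w + 5 * w - 25) + (5 - w) * (w + 5)^2 = 0"
    using \<open>P \<noteq> 0\<close> by simp algebra
  have "w \<noteq> - 5"
  proof
    assume w: "w = - 5"
    then have "S = - 10" using quad by (simp add: algebra_simps)
    moreover have "P = 5" using Pw w by simp
    ultimately show False using False by simp
  qed
  then have w5: "w + 5 \<noteq> 0" by (simp add: eq_neg_iff_add_eq_0)
  define s where "s = (S * w + 5 * w - 25) / (w + 5)"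
  have s: "s * (w + 5) = S * w + 5 * w - 25" using w5 by (simp add: s_def)
  have "(w + 5)^2 * (s^2 + 5 * s + 5 - w) = 0" using quad unfolding s[symmetric] by algebra
  then have w: "w = s^2 + 5 * s + 5" using w5 by simp
  have Sw: "S * w = s^3 - 15 * s" using s w by algebra
  \<comment> \<open>Obtained by substituting the uniformisation into the norm and extracting the
    square root of one fifth of it.\<close>
  define g where "g = 5 * (s + 2) * (s^4 + 14 * s^3 + 74 * s^2 + 170 * s + 145) / w^2"
  have g: "g * w^2 = 5 * (s + 2) * (s^4 + 14 * s^3 + 74 * s^2 + 170 * s + 145)"
    using \<open>w \<noteq> 0\<close> by (simp add: g_def)
  have "w^4 * (125 * (22 + S)^2 + 22 * (22 + S) * (P - 125) + (P - 125)^2)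
      = 125 * w^2 * (22 * w + S * w)^2 + 22 * w * (22 * w + S * w) * (P * w^2 - 125 * w^2) + (P * w^2 - 125 * w^2)^2"
    by algebra
  also have "\<dots> = 5 * (g * w^2)^2"
    unfolding Sw Pw g unfolding w by algebra
  also have "\<dots> = w^4 * (5 * g^2)" by algebra
  finally have "125 * (22 + S)^2 + 22 * (22 + S) * (P - 125) + (P - 125)^2 = 5 * g^2"
    using \<open>w \<noteq> 0\<close> by simp
  moreover have "(125 - P)^2 + (125 - P) * (22 + S) * S + (22 + S)^2 * P
     = 125 * (22 + S)^2 + 22 * (22 + S) * (P - 125) + (P - 125)^2" by algebra
  ultimately show thesis using that by simp
qed

text \<open>As \<open>K\<close> has degree 6, \<open>t\<close> lies in the field of
  \<open>h\<close>, so \<open>h^2 + 22 h + 125 = (2 t - h - 11)^2\<close> is a square there and its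
  norm is a rational square. That norm is also 5 times a square, hence 0. What survives is
  \<open>t^2 = -1\<close>, which means j = 1728.\<close>

lemma hauptmodul_not_quadratic:
  fixes h t :: "'k::field_char_0"
  assumes deg: "degree_over_rat TYPE('k) = 6"
    and t: "t^2 = (h + 11) * t + 1"
    and J: "(h^2 + 10 * h + 5)^3 = of_rat J * h"
    and h: "h \<notin> \<rat>" "h * h = of_rat S * h - of_rat P"
  shows "t^2 = - 1"
proof -
  let ?S = "of_rat S :: 'k" and ?P = "of_rat P :: 'k"
  \<comment> \<open>\<open>c0 + c1 h\<close> is the remainder of the sextic modulo the quadratic
    equation of \<open>h\<close>; \<open>J\<close> occurs only in \<open>c1\<close>.\<close>
  define c0 where "c0 = 125 - P * (S^4 - 3 * S^2 * P + P^2 + 30 * (S^3 - 2 * S * P) + 315 * (S^2 - P) + 1300 * S + 1575)"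
  define c1 where "c1 = S^5 - 4 * S^3 * P + 3 * S * P^2 + 30 * (S^4 - 3 * S^2 * P + P^2)
     + 315 * (S^3 - 2 * S * P) + 1300 * (S^2 - P) + 1575 * S + 750 - J"
  have "of_rat c0 + of_rat c1 * h = (h^2 + 10 * h + 5)^3 - of_rat J * h"
    unfolding c0_def c1_def of_rat_simps of_rat_numeral_eq using h(2) by algebra
  then have "of_rat c0 + of_rat c1 * h = of_rat 0 + of_rat 0 * h" using J by simp
  then have curve: "P * (S^4 - 3 * S^2 * P + P^2 + 30 * (S^3 - 2 * S * P) + 315 * (S^2 - P) + 1300 * S + 1575) = 125"
    using rat_indep2(1)[OF h(1)] unfolding c0_def by fastforce
  obtain g where g: "(125 - P)^2 + (125 - P) * (22 + S) * S + (22 + S)^2 * P = 5 * g^2"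
    using split_cartan_norm[OF curve] .
  have "t * t = of_rat 1 + of_rat 0 * h + t * (of_rat 11 + of_rat 1 * h)"
    using t by (simp add: power2_eq_square algebra_simps)
  then obtain e f where te: "t = of_rat e + of_rat f * h"
    using quadratic_over_quadratic[OF deg h] by metis
  define a where "a = 2 * e - 11"
  define b where "b = 2 * f - 1"
  have v: "2 * t - h - 11 = of_rat a + of_rat b * h"
    unfolding te a_def b_def of_rat_simps by (simp add: algebra_simps)
  have v2: "(2 * t - h - 11)^2 = h^2 + 22 * h + 125" using t by algebra
  have "of_rat (a^2 - b^2 * P) + of_rat (2 * a * b + b^2 * S) * h = (of_rat a + of_rat b * h)^2"
    unfolding of_rat_simps of_rat_numeral_eq using h(2) by algebra
  also have "\<dots> = of_rat (125 - P) + of_rat (22 + S) * h"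
    unfolding v[symmetric] v2 of_rat_simps of_rat_numeral_eq using h(2) by algebra
  finally have "of_rat (a^2 - b^2 * P) + of_rat (2 * a * b + b^2 * S) * h = of_rat (125 - P) + of_rat (22 + S) * h" .
  note ab = rat_indep2[OF h(1) this]
  have "(a^2 + a * b * S + b^2 * P)^2 = (a^2 - b^2 * P)^2 + (a^2 - b^2 * P) * (2 * a * b + b^2 * S) * S
       + (2 * a * b + b^2 * S)^2 * P" by algebra
  then have "(a^2 + a * b * S + b^2 * P)^2 = 5 * g^2" unfolding ab g .
  then have n0: "a^2 + a * b * S + b^2 * P = 0" by (rule rat_square_5)
  have "(of_rat a + of_rat b * h) * (of_rat a + of_rat b * ?S - of_rat b * h) = of_rat (a^2 + a * b * S + b^2 * P)"
    unfolding of_rat_simps using h(2) by algebra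
  then have "of_rat a + of_rat b * h = 0 \<or> of_rat a + of_rat b * ?S - of_rat b * h = 0"
    using n0 by simp
  then have "of_rat a + of_rat b * h = 0"
  proof
    assume "of_rat a + of_rat b * ?S - of_rat b * h = 0"
    then have "of_rat (a + b * S) + of_rat (- b) * h = of_rat 0 + of_rat 0 * h"
      by (simp add: of_rat_simps)
    from rat_indep2[OF h(1) this] show ?thesis by simp
  qed
  then show ?thesis using v t by algebra
qed

text \<open>
  The norm from \<open>\<rat>(x)\<close>, \<open>x\<^sup>3 + p x\<^sup>2 + q x + r = 0\<close>, of \<open>a + b x + c x\<^sup>2\<close>: the determinant of
  multiplication in the basis \<open>1, x, x\<^sup>2\<close>, whose columns are \<open>(a, b, c)\<close> and its images under
  multiplication by \<open>x\<close>.
\<close>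

definition cubic_norm :: "rat \<Rightarrow> rat \<Rightarrow> rat \<Rightarrow> rat \<times> rat \<times> rat \<Rightarrow> rat" where
  "cubic_norm p q r = (\<lambda>(a, b, c).
     let a1 = - r * c; b1 = a - q * c; c1 = b - p * c;
         a2 = - r * c1; b2 = a1 - q * c1; c2 = b1 - p * c1
     in a * (b1 * c2 - b2 * c1) - a1 * (b * c2 - b2 * c) + a2 * (b * c1 - b1 * c))"

definition cubic_mult :: "rat \<Rightarrow> rat \<Rightarrow> rat \<Rightarrow> rat \<times> rat \<times> rat \<Rightarrow> rat \<times> rat \<times> rat \<Rightarrow> rat \<times> rat \<times> rat" where
  "cubic_mult p q r = (\<lambda>(a, b, c) (u, v, w).
     let a1 = - r * c; b1 = a - q * c; c1 = b - p * c;
         a2 = - r * c1; b2 = a1 - q * c1; c2 = b1 - p * c1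
     in (u * a + v * a1 + w * a2, u * b + v * b1 + w * b2, u * c + v * c1 + w * c2))"

lemma cubic_norm_mult:
  "cubic_norm p q r (cubic_mult p q r x y) = cubic_norm p q r x * cubic_norm p q r y"
proof -
  obtain a b c u v w where xy: "x = (a, b, c)" "y = (u, v, w)" by (metis surj_pair)
  show ?thesis
    unfolding xy cubic_norm_def cubic_mult_def Let_def split_conv by algebra
qed

definition cubic_eval :: "'k::field_char_0 \<Rightarrow> rat \<times> rat \<times> rat \<Rightarrow> 'k" where
  "cubic_eval x = (\<lambda>(a, b, c). of_rat a + of_rat b * x + of_rat c * x^2)"

lemma cubic_eval_mult:
  assumes "x^3 + of_rat p * x^2 + of_rat q * x + of_rat r = 0"
  shows "cubic_eval x (cubic_mult p q r y z) = cubic_eval x y * cubic_eval x z"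
proof -
  obtain a b c u v w where yz: "y = (a, b, c)" "z = (u, v, w)" by (metis surj_pair)
  show ?thesis
    unfolding yz cubic_eval_def cubic_mult_def
    using assms by (simp add: Let_def of_rat_simps) algebra
qed

lemma cubic_adjoin:
  fixes x :: "'k::field_char_0"
  assumes x: "evalq [:r, q, p, 1:] x = 0" and "y \<in> adjoin x"
  obtains z where "y = cubic_eval x z"
proof -
  obtain f where f: "y = evalq f x" using assms(2) unfolding adjoin_def by blast
  let ?m = "[:r, q, p, 1:]"
  let ?g = "f mod ?m"
  have "evalq f x = evalq (f div ?m * ?m + ?g) x" by (simp only: div_mult_mod_eq)
  also have "\<dots> = evalq ?g x" using x by (simp only: evalq_add evalq_mult mult_zero_right add_0)
  finally have y: "y = evalq ?g x" using f by simp
  have "degree ?g < 3" using degree_mod_less[of ?m f] by auto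
  then have "?g = [:coeff ?g 0, coeff ?g 1, coeff ?g 2:]"
    by (intro poly_eqI) (auto simp: coeff_pCons numeral_2_eq_2 coeff_eq_0 split: nat.split)
  then obtain u v w where "?g = [:u, v, w:]" by blast
  then have "y = cubic_eval x (u, v, w)"
    unfolding y by (simp add: cubic_eval_def power2_eq_square algebra_simps)
  then show thesis by (rule that)
qed

lemma cubic_eval_inj:
  fixes x :: "'k::field_char_0"
  assumes "\<And>f. evalq f x = 0 \<Longrightarrow> [:r, q, p, 1:] dvd f" and "cubic_eval x y = cubic_eval x z"
  shows "y = z"
proof -
  obtain a b c u v w where yz: "y = (a, b, c)" "z = (u, v, w)" by (metis surj_pair)
  have "evalq [:a - u, b - v, c - w:] x = 0"
    using assms(2) by (simp add: yz cubic_eval_def of_rat_simps power2_eq_square algebra_simps)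
  then have "[:r, q, p, 1:] dvd [:a - u, b - v, c - w:]" by (rule assms(1))
  moreover have "degree [:a - u, b - v, c - w:] < degree [:r, q, p, 1:]"
    by (simp add: degree_pCons_eq_if)
  ultimately have "[:a - u, b - v, c - w:] = 0"
    using dvd_imp_degree_le leD by blast
  then show ?thesis by (simp add: yz)
qed

text \<open>The sum \<open>S\<close> and product \<open>P\<close> of the other two conjugates of
  \<open>h\<close> lie in the field of \<open>h\<close> and give a point of the split Cartan curve
  over it. There \<open>P = - r / h\<close> is 5 times a square; since the degree is odd, taking
  norms makes 5 a rational square.\<close>

lemma hauptmodul_not_cubic:
  fixes h :: "'k::field_char_0"
  assumes deg: "degree_over_rat TYPE('k) = 6"
    and J: "(h^2 + 10 * h + 5)^3 = of_rat J * h"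
    and h: "evalq [:r, q, p, 1:] h = 0" "\<And>f. evalq f h = 0 \<Longrightarrow> [:r, q, p, 1:] dvd f"
  shows False
proof -
  let ?m = "[:r, q, p, 1:]"
  let ?p = "of_rat p :: 'k" and ?q = "of_rat q :: 'k" and ?r = "of_rat r :: 'k" and ?J = "of_rat J :: 'k"
  have h3: "h^3 + ?p * h^2 + ?q * h + ?r = 0"
    using h(1) by (simp add: power2_eq_square power3_eq_cube algebra_simps)
  have nonrat: "h \<noteq> of_rat a" for a
  proof
    assume "h = of_rat a"
    then have "?m dvd [:- a, 1:]" by (intro h(2)) (simp add: of_rat_minus)
    then show False using dvd_imp_degree_le[of ?m "[:- a, 1:]"] by simp
  qed
  have "h \<noteq> 0" using nonrat[of 0] by simp
  have "r \<noteq> 0"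
  proof
    assume "r = 0"
    then have "h * evalq [:q, p, 1:] h = 0" using h(1) by simp
    then have "evalq [:q, p, 1:] h = 0" using \<open>h \<noteq> 0\<close> by simp
    then have "?m dvd [:q, p, 1:]" by (rule h(2))
    then show False using dvd_imp_degree_le[of ?m "[:q, p, 1:]"] by simp
  qed
  let ?F = "[:125, 750 - J, 1575, 1300, 315, 30, 1:]"
  have "evalq ?F h = (h^2 + 10 * h + 5)^3 - ?J * h"
    by (simp add: of_rat_simps power2_eq_square power3_eq_cube algebra_simps)
  then have "evalq ?F h = 0" using J by simp
  then have "?m dvd ?F" by (rule h(2))
  then obtain k where k: "?F = ?m * k" by (elim dvdE)
  then have "k \<noteq> 0" by auto
  then have "degree ?F = 3 + degree k" unfolding k by (subst degree_mult_eq) auto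
  then have "degree k = 3" by simp
  then have "k = [:coeff k 0, coeff k 1, coeff k 2, coeff k 3:]"
    by (intro poly_eqI) (auto simp: coeff_pCons numeral_2_eq_2 numeral_3_eq_3 coeff_eq_0 split: nat.split)
  then obtain k0 k1 k2 k3 where k': "k = [:k0, k1, k2, k3:]" by blast
  have e: "125 = r * k0" "1575 = p * k0 + q * k1 + r * k2" "1300 = k0 + p * k1 + q * k2 + r * k3"
     "315 = k1 + p * k2 + q * k3" "30 = k2 + p * k3" "1 = k3"
    using k[unfolded k'] by (auto simp: algebra_simps)
  define S where "S = - ?p - h"
  define P where "P = - ?r / h"
  have Ph: "P * h = - ?r" using \<open>h \<noteq> 0\<close> by (simp add: P_def)
  have hq: "h * (h * h + ?p * h + ?q - P) = 0" using h3 Ph by algebra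
  then have P: "P = h^2 + ?p * h + ?q" using \<open>h \<noteq> 0\<close> by (simp add: power2_eq_square)
  have "P * (- h * of_rat k0) = 125"
  proof -
    have "P * (- h * of_rat k0) = - (P * h) * of_rat k0" by simp
    then have "P * (- h * of_rat k0) = of_rat (r * k0)" unfolding Ph by (simp add: of_rat_simps)
    then show ?thesis using e(1) by (metis of_rat_numeral_eq)
  qed
  moreover have "- h * of_rat k0 = S^4 - 3 * S^2 * P + P^2 + 30 * (S^3 - 2 * S * P) + 315 * (S^2 - P) + 1300 * S + 1575"
  proof -
    have k3: "k3 = 1" using e(6) by simp
    have k2: "k2 = 30 - p" using e(5) k3 by simp
    have k1: "k1 = 315 - p * k2 - q" using e(4) k3 by simp
    have k0: "k0 = 1300 - p * k1 - q * k2 - r" using e(3) k3 by simp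
    have K2: "(of_rat k2 :: 'k) = 30 - ?p" unfolding k2 by (simp add: of_rat_simps)
    have K1: "(of_rat k1 :: 'k) = 315 - ?p * of_rat k2 - ?q" unfolding k1 by (simp add: of_rat_simps)
    have K0: "(of_rat k0 :: 'k) = 1300 - ?p * of_rat k1 - ?q * of_rat k2 - ?r" unfolding k0 by (simp add: of_rat_simps)
    have E: "?p * of_rat k0 + ?q * of_rat k1 + ?r * of_rat k2 = 1575"
      using e(2) by (metis of_rat_add of_rat_mult of_rat_numeral_eq)
    have R: "?r = - h * P" using Ph by algebra
    have "- h * of_rat k0 = S^4 - 3 * S^2 * P + P^2 + 30 * (S^3 - 2 * S * P) + 315 * (S^2 - P) + 1300 * S
        + (?p * of_rat k0 + ?q * of_rat k1 + ?r * of_rat k2)"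
      unfolding K0 K1 K2 R P S_def by algebra
    then show ?thesis unfolding E .
  qed
  ultimately have curve: "P * (S^4 - 3 * S^2 * P + P^2 + 30 * (S^3 - 2 * S * P) + 315 * (S^2 - P) + 1300 * S + 1575) = 125"
    by (simp only:)
  define A where "A = S^2 + 15 * S + 45 + P"
  define B where "B = 5 + P * (S + 9)"
  have AB: "P * A^2 = 5 * B^2" using split_cartan_curve(1)[OF curve] unfolding A_def B_def .
  have "S \<noteq> of_rat a" for a
    using nonrat[of "- p - a"] unfolding S_def by (auto simp: of_rat_simps algebra_simps)
  \<comment> \<open>The two exceptional points of the curve have rational \<open>S\<close>, whereas
    \<open>S = - p - h\<close> is irrational.\<close>
  from this[of "- 4"] this[of "- 10"] have "A \<noteq> 0"
    using split_cartan_curve(2)[OF curve] unfolding A_def by (auto simp: of_rat_simps)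
  note sub = adjoin_subalgebra[of h]
  have deg0: "degree_over_rat TYPE('k) > 0" using deg by simp
  have "S = evalq [:- p, - 1:] h" "P = evalq [:q, p, 1:] h"
    by (simp_all add: S_def P of_rat_simps power2_eq_square algebra_simps)
  then have SP: "S \<in> adjoin h" "P \<in> adjoin h" unfolding adjoin_def by blast+
  have num: "numeral n \<in> adjoin h" for n
    using subalgebra_of_rat[OF sub, of "numeral n"] by simp
  have "A \<in> adjoin h" "B \<in> adjoin h"
    unfolding A_def B_def power2_eq_square
    by (intro subalgebra_add[OF sub] subalgebra_mult[OF sub] SP num)+
  then have "5 * B / A \<in> adjoin h"
    by (intro subalgebra_divide[OF deg0 sub] subalgebra_mult[OF sub] num)
  then obtain z where z: "5 * B / A = cubic_eval h z"
    using cubic_adjoin[OF h(1)] by blast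
  have "h * (5 * B / A)^2 = 5 * h * (5 * B^2) / A^2" by (simp add: power2_eq_square)
  also have "\<dots> = 5 * h * P" unfolding AB[symmetric] using \<open>A \<noteq> 0\<close> by simp
  also have "\<dots> = - 5 * ?r" using Ph by (simp add: algebra_simps)
  finally have "cubic_eval h (cubic_mult p q r (0, 1, 0) (cubic_mult p q r z z)) = cubic_eval h (- 5 * r, 0, 0)"
    unfolding cubic_eval_mult[OF h3] z by (simp add: cubic_eval_def power2_eq_square of_rat_simps)
  then have "cubic_mult p q r (0, 1, 0) (cubic_mult p q r z z) = (- 5 * r, 0, 0)"
    by (rule cubic_eval_inj[rotated]) (rule h(2))
  then have "cubic_norm p q r (0, 1, 0) * (cubic_norm p q r z * cubic_norm p q r z) = cubic_norm p q r (- 5 * r, 0, 0)"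
    unfolding cubic_norm_mult[symmetric] by simp
  then have "r * (cubic_norm p q r z)^2 = r * (5 * (5 * r)^2)"
    by (simp add: cubic_norm_def power2_eq_square algebra_simps)
  then have "(cubic_norm p q r z)^2 = 5 * (5 * r)^2" using \<open>r \<noteq> 0\<close> by simp
  then have "5 * r = 0" by (rule rat_square_5)
  then show False using \<open>r \<noteq> 0\<close> by simp
qed

lemma evalq_pcompose: "evalq (pcompose f g) x = evalq f (evalq g x)"
  by (induction f) (simp_all add: pcompose_pCons)

text \<open>Here \<open>t\<close> has degree 6 as well, so no proper subfield is at hand. The norm
  argument moves to the Gaussian numbers, because \<open>i\<close> is fixed by
  \<open>x -> -1/x\<close>, the involution that fixes \<open>x - 1/x\<close>.\<close>

lemma hauptmodul_not_sextic:
  fixes h t :: "'k::field_char_0"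
  assumes deg: "degree_over_rat TYPE('k) = 6"
    and t: "t^2 = (h + 11) * t + 1"
    and J: "(h^2 + 10 * h + 5)^3 = of_rat J * h"
    and h: "\<And>f. evalq f h = 0 \<Longrightarrow> degree f < 6 \<Longrightarrow> f = 0" "rat_vs.dim (adjoin h) = 6"
  shows False
proof -
  define v where "v = h + 11"
  have vmin: "f = 0" if "evalq f v = 0" "degree f < 6" for f
  proof -
    have "evalq (pcompose f [:11, 1:]) h = 0"
      using that(1) by (simp add: evalq_pcompose v_def add.commute)
    then have "pcompose f [:11, 1:] = 0"
      using that(2) by (intro h(1)) (simp_all add: degree_pcompose)
    then show ?thesis by (subst (asm) pcompose_eq_0_iff) auto
  qed
  have t': "t^2 = v * t + 1" using t by (simp add: v_def)
  have "t \<noteq> 0" using t by auto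
  define g where "g = - 1 / t"
  have tg: "t * g = - 1" using \<open>t \<noteq> 0\<close> by (simp add: g_def)
  have "t * (v - t - g) = 0" using tg t' by algebra
  then have "v - t - g = 0" using \<open>t \<noteq> 0\<close> by (simp only: mult_eq_0_iff) simp
  then have v: "v = t + g" by (simp add: algebra_simps)
  note sub = adjoin_subalgebra[of t]
  have deg0: "degree_over_rat TYPE('k) > 0" using deg by simp
  have "h \<in> adjoin t"
  proof -
    have "h = t + (of_rat (- 1) / t + of_rat (- 11))"
      using v by (simp add: v_def g_def of_rat_minus algebra_simps)
    moreover have "of_rat (- 1) / t \<in> adjoin t"
      by (rule subalgebra_divide[OF deg0 sub adjoin_self subalgebra_of_rat[OF sub]])
    ultimately show ?thesis
      using subalgebra_add[OF sub] adjoin_self[of t] subalgebra_of_rat[OF sub, of "- 11"] by metis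
  qed
  then have "rat_vs.dim (adjoin h) dvd rat_vs.dim (adjoin t)"
    by (intro subalgebra_dim_dvd[OF deg0] adjoin_subalgebra adjoin_subset)
  then have dvd: "6 dvd rat_vs.dim (adjoin t)" using h(2) by simp
  obtain m where m: "lead_coeff m = 1" "degree m = 6" "evalq m t = 0"
      "\<And>f. evalq f t = 0 \<Longrightarrow> degree f < 6 \<Longrightarrow> f = 0"
  proof (rule degree_six_cases[OF deg, of t])
    fix a assume "t = of_rat a"
    have "a \<noteq> 0" using \<open>t \<noteq> 0\<close> \<open>t = of_rat a\<close> by auto
    have "h = of_rat (a - 1 / a - 11)"
      using v unfolding v_def g_def \<open>t = of_rat a\<close> by (simp add: of_rat_simps algebra_simps)
    then have "evalq [:- (a - 1 / a - 11), 1:] h = 0" by (simp add: of_rat_simps)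
    from h(1)[OF this] show thesis by simp
  next
    fix s p assume "t \<notin> \<rat>" "t * t = of_rat s * t - of_rat p"
    from adjoin_quadratic(1)[OF deg this] dvd show thesis by simp
  next
    assume "rat_vs.dim (adjoin t) = 3"
    then show thesis using dvd by simp
  qed (use that in blast)
  have mm: "m = [:coeff m 0, coeff m 1, coeff m 2, coeff m 3, coeff m 4, coeff m 5, 1:]"
  proof (rule poly_eqI)
    fix i :: nat
    consider "i = 0" | "i = 1" | "i = 2" | "i = 3" | "i = 4" | "i = 5" | "i = 6" | "i > 6" by linarith
    then show "coeff m i = coeff [:coeff m 0, coeff m 1, coeff m 2, coeff m 3, coeff m 4, coeff m 5, 1:] i"
      using m(1,2) by cases (simp_all add: eval_nat_numeral coeff_eq_0 coeff_pCons split: nat.split)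
  qed
  then obtain m0 m1 m2 m3 m4 m5 where mc: "m = [:m0, m1, m2, m3, m4, m5, 1:]" by blast
  have "m0 \<noteq> 0"
  proof
    assume "m0 = 0"
    then have "t * evalq [:m1, m2, m3, m4, m5, 1:] t = 0" using m(3) mc by simp
    then have "evalq [:m1, m2, m3, m4, m5, 1:] t = 0" using \<open>t \<noteq> 0\<close> by simp
    from m(4)[OF this] show False by simp
  qed
  text \<open>
    For the minimal polynomial \<open>m\<close> of \<open>t\<close>, the product \<open>m(x) m(-1/x)\<close> is a polynomial in \<open>x - 1/x\<close> with
    coefficients \<open>e\<^sub>d\<close> in the Lucas basis \<open>x\<^sup>d + (-1/x)\<^sup>d\<close>. It vanishes at \<open>v\<close>, so it is \<open>m\<^sub>0\<close> times the
    sextic satisfied by \<open>v\<close>; evaluation at \<open>x = i\<close> makes \<open>(-11 + 2i)(1728 - J) m\<^sub>0\<close> a square in \<open>\<rat>(i)\<close>.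
  \<close>
  define e0 where "e0 = m0^2 - m1^2 + m2^2 - m3^2 + m4^2 - m5^2 + 1"
  define e1 where "e1 = m0 * m1 - m1 * m2 + m2 * m3 - m3 * m4 + m4 * m5 - m5"
  define e2 where "e2 = m0 * m2 - m1 * m3 + m2 * m4 - m3 * m5 + m4"
  define e3 where "e3 = m0 * m3 - m1 * m4 + m2 * m5 - m3"
  define e4 where "e4 = m0 * m4 - m1 * m5 + m2"
  define e5 where "e5 = m0 * m5 - m1"
  note e_defs = e0_def e1_def e2_def e3_def e4_def e5_def
  let ?n0 = "of_rat m0 :: 'k" and ?n1 = "of_rat m1 :: 'k" and ?n2 = "of_rat m2 :: 'k"
    and ?n3 = "of_rat m3 :: 'k" and ?n4 = "of_rat m4 :: 'k" and ?n5 = "of_rat m5 :: 'k"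
  have L: "t^2 + g^2 = v^2 + 2" "t^3 + g^3 = v^3 + 3 * v" "t^4 + g^4 = v^4 + 4 * v^2 + 2"
     "t^5 + g^5 = v^5 + 5 * v^3 + 5 * v" "t^6 + g^6 = v^6 + 6 * v^4 + 9 * v^2 + 2"
    using tg v by algebra+
  have z: "(?n0 + ?n1 * t + ?n2 * t^2 + ?n3 * t^3 + ?n4 * t^4 + ?n5 * t^5 + t^6)
      * (?n0 + ?n1 * g + ?n2 * g^2 + ?n3 * g^3 + ?n4 * g^4 + ?n5 * g^5 + g^6) = 0"
    using m(3) unfolding mc by (simp add: power_numeral_reduce algebra_simps)
  have "of_rat e0 + of_rat e1 * (t + g) + of_rat e2 * (t^2 + g^2) + of_rat e3 * (t^3 + g^3)
     + of_rat e4 * (t^4 + g^4) + of_rat e5 * (t^5 + g^5) + ?n0 * (t^6 + g^6) = 0"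
    using z tg unfolding e_defs of_rat_simps of_rat_1 by algebra
  then have z': "of_rat e0 + of_rat e1 * v + of_rat e2 * (v^2 + 2) + of_rat e3 * (v^3 + 3 * v)
     + of_rat e4 * (v^4 + 4 * v^2 + 2) + of_rat e5 * (v^5 + 5 * v^3 + 5 * v)
     + ?n0 * (v^6 + 6 * v^4 + 9 * v^2 + 2) = 0"
    unfolding L v .
  have Jv: "(v^2 - 12 * v + 16)^3 = of_rat J * (v - 11)"
    using J unfolding v_def by algebra
  \<comment> \<open>The difference between the Lucas expansion, rewritten in powers of
    \<open>v\<close>, and \<open>m0 * ((v^2 - 12 v + 16)^3 - J (v - 11))\<close>. The terms of
    degree 6 cancel, so all remaining coefficients must vanish.\<close>
  let ?f = "[: e0 + 2 * e2 + 2 * e4 + 2 * m0 - m0 * (4096 + 11 * J), e1 + 3 * e3 + 5 * e5 + m0 * (9216 + J),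
     e2 + 4 * e4 + 9 * m0 - 7680 * m0, e3 + 5 * e5 + 2880 * m0, e4 + 6 * m0 - 480 * m0, e5 + 36 * m0 :]"
  have "evalq ?f v = 0"
    unfolding evalq_pCons evalq_0 of_rat_simps of_rat_numeral_eq using z' Jv by algebra
  then have "?f = 0" by (rule vmin) simp
  then have f: "e0 + 2 * e2 + 2 * e4 + 2 * m0 = m0 * (4096 + 11 * J)" "e1 + 3 * e3 + 5 * e5 = - (m0 * (9216 + J))"
     "e2 + 4 * e4 + 9 * m0 = 7680 * m0" "e3 + 5 * e5 = - 2880 * m0" "e4 + 6 * m0 = 480 * m0" "e5 = - 36 * m0"
    by (simp_all add: eq_neg_iff_add_eq_0)
  \<comment> \<open>\<open>a + b i\<close> is the value of \<open>m\<close> at \<open>i\<close>. Its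
    square is a rational multiple of \<open>-11 + 2i\<close>, an element of norm 125, and this makes
    5 a square unless \<open>b = 0\<close>.\<close>
  define a where "a = m0 - m2 + m4 - 1"
  define b where "b = m1 - m3 + m5"
  have "a^2 - b^2 = e0 - 2 * e2 + 2 * e4 - 2 * m0" "a * b = e1 - e3 + e5"
    unfolding a_def b_def e_defs by algebra+
  then have ab: "a^2 - b^2 = - 11 * (m0 * (1728 - J))" "a * b = m0 * (1728 - J)"
    using f by (simp_all add: algebra_simps)
  then have "((2 * a + 11 * b) / 5)^2 = 5 * b^2"
    by (simp add: power2_eq_square field_simps)
  then have "b = 0" by (rule rat_square_5)
  then have "J = 1728" using ab \<open>m0 \<noteq> 0\<close> by simp
  have "(v^2 + 4) * (v^2 - 18 * v + 76)^2 = (v^2 - 12 * v + 16)^3 - 1728 * (v - 11)" by algebra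
  then have "v^2 + 4 = 0 \<or> v^2 - 18 * v + 76 = 0" using Jv \<open>J = 1728\<close> by simp
  then have "evalq [:4, 0, 1:] v = 0 \<or> evalq [:76, - 18, 1:] v = 0"
    by (simp add: power2_eq_square algebra_simps of_rat_simps)
  then show False using vmin[of "[:4, 0, 1:]"] vmin[of "[:76, - 18, 1:]"] by auto
qed

section \<open>Rational points on the modular curve\<close>

lemma coprime_square_factors:
  fixes m n c :: nat
  assumes "m * n = c^2" "coprime m n" "m > 0" "n > 0"
  obtains r s where "m = r^2" "n = s^2"
proof -
  have "is_nth_power 2 (m * n)" unfolding assms(1) ..
  then have "is_nth_power 2 m" "is_nth_power 2 n"
    using assms(2-4) is_nth_power_mult_coprime_natD by blast+
  then show thesis using that by (auto elim!: is_nth_powerE)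
qed

lemma odd_square_mod_8: "odd (n::nat) \<Longrightarrow> n\<^sup>2 mod 8 = 1"
proof -
  assume "odd n"
  then obtain k where n: "n = 2 * k + 1" by (elim oddE)
  have "even (k * (k + 1))" by simp
  then obtain l where "k * (k + 1) = 2 * l" by (elim evenE)
  then have "n^2 = 8 * l + 1" unfolding n by (simp add: power2_eq_square algebra_simps)
  then show ?thesis by simp
qed

lemma square_mod_3: "(n::nat)^2 mod 3 = (if 3 dvd n then 0 else 1)"
proof -
  have "n mod 3 = 0 \<or> n mod 3 = 1 \<or> n mod 3 = 2" by presburger
  moreover have "n^2 mod 3 = (n mod 3)^2 mod 3" by (simp add: power_mod)
  ultimately show ?thesis by (elim disjE) (simp_all add: dvd_eq_mod_eq_0)
qed

lemma primitive_pythagorean: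
  fixes p e q :: nat
  assumes eq: "p^2 + e^2 = q^2" and cop: "coprime p e" and "odd p" "even e" "e > 0"
  obtains a b where "p + b^2 = a^2" "e = 2 * a * b" "coprime a b" "odd (a + b)"
proof -
  obtain f where f: "e = 2 * f" using \<open>even e\<close> by (elim evenE)
  have "odd (q^2)" unfolding eq[symmetric] using \<open>odd p\<close> \<open>even e\<close> by simp
  then have "odd q" by simp
  have "p^2 < q^2" using eq \<open>e > 0\<close> by (metis less_add_same_cancel1 zero_less_power)
  then have "p < q" using power_less_imp_less_base by blast
  then obtain v where v: "q = p + 2 * v" "v > 0"
    using \<open>odd p\<close> \<open>odd q\<close> by (metis even_diff_nat evenE less_imp_add_positive add_diff_cancel_left' even_add
        nat_0_less_mult_iff)
  have fv: "(p + v) * v = f^2"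
    using eq unfolding v f by (simp add: power2_eq_square algebra_simps)
  have "coprime p (f^2)" using cop unfolding f by simp
  then have "coprime p v" unfolding fv[symmetric] by simp
  then have "coprime (p + v) v" by (metis coprime_iff_gcd_eq_1 gcd_add1)
  then obtain a b where ab: "p + v = a^2" "v = b^2"
    using coprime_square_factors[OF fv] v(2) by auto
  have "f^2 = (a * b)^2" using fv ab by (simp add: power_mult_distrib)
  then have "f = a * b" by (simp add: power2_eq_iff_nonneg)
  moreover have "coprime (a^2) (b^2)" using \<open>coprime (p + v) v\<close> ab by metis
  then have "coprime a b" by simp
  moreover have "odd (a^2 + b^2)" using \<open>odd p\<close> ab by (metis even_add)
  ultimately show thesis using that[of b a] ab f by simp
qed

text \<open>Eliminating \<open>W\<close> or \<open>X\<close> shows that \<open>k\<close> divides 15.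
  The factor 3 is impossible because -1 is not a square modulo 3, and \<open>k = 5\<close> fails
  modulo 8 in the second equation.\<close>

lemma concordant_multiplier:
  fixes X W Y Z k :: nat
  assumes 1: "X^2 + W^2 = k * Y^2" and 2: "16 * X^2 + W^2 = k * Z^2"
    and cop: "coprime X W" and "odd W" "odd Z"
  shows "k = 1"
proof -
  have "k dvd 16 * (X^2 + W^2) - (16 * X^2 + W^2)" "k dvd (16 * X^2 + W^2) - (X^2 + W^2)"
    unfolding 1 2 by (metis dvd_diff_nat dvd_triv_left mult.left_commute)+
  then have "k dvd 15 * W^2" "k dvd 15 * X^2" by simp_all
  then have "k dvd gcd (15 * X^2) (15 * W^2)" by simp
  also have "\<dots> = 15 * gcd (X^2) (W^2)" by (rule gcd_mult_distrib_nat[symmetric])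
  also have "gcd (X^2) (W^2) = 1" using cop by (metis coprime_iff_gcd_eq_1 coprime_power_left_iff coprime_power_right_iff)
  finally have k: "k dvd 15" by simp
  have "\<not> 3 dvd k"
  proof
    assume "3 dvd k"
    then have "3 dvd X^2 + W^2" unfolding 1 by simp
    then have "(X^2 mod 3 + W^2 mod 3) mod 3 = 0" by presburger
    then have "3 dvd X" "3 dvd W" unfolding square_mod_3 by (auto split: if_splits)
    then have "3 dvd gcd X W" by simp
    then show False using cop by simp
  qed
  have "k \<noteq> 5"
  proof
    assume "k = 5"
    have "(16 * X^2 + W^2) mod 8 = 1" using odd_square_mod_8[OF \<open>odd W\<close>] by presburger
    moreover have "(5 * Z^2) mod 8 = 5" using odd_square_mod_8[OF \<open>odd Z\<close>] by presburger
    ultimately show False using 2 \<open>k = 5\<close> by simp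
  qed
  have "k \<le> 15" using k by (rule dvd_imp_le) simp
  then have "k = 0 \<or> k = 1 \<or> k = 2 \<or> k = 3 \<or> k = 4 \<or> k = 5 \<or> k = 6 \<or> k = 7 \<or> k = 8 \<or> k = 9
      \<or> k = 10 \<or> k = 11 \<or> k = 12 \<or> k = 13 \<or> k = 14 \<or> k = 15" by presburger
  then show ?thesis using k \<open>\<not> 3 dvd k\<close> \<open>k \<noteq> 5\<close> by (elim disjE) simp_all
qed

lemma concordant_coprime_ratio:
  fixes X W Y Z :: nat
  assumes eq: "Z^2 * (X^2 + W^2) = Y^2 * (16 * X^2 + W^2)"
    and "coprime X W" "coprime Y Z" "odd W" "odd Z" "Y > 0"
  shows "X^2 + W^2 = Y^2" "16 * X^2 + W^2 = Z^2"
proof -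
  have "Y^2 dvd Z^2 * (X^2 + W^2)" unfolding eq by simp
  then have "Y^2 dvd X^2 + W^2"
    using \<open>coprime Y Z\<close> by (simp add: coprime_dvd_mult_right_iff)
  then obtain k where k: "X^2 + W^2 = k * Y^2" by (metis dvdE mult.commute)
  then have "Y^2 * (16 * X^2 + W^2) = Y^2 * (k * Z^2)" using eq unfolding k by (metis mult.assoc mult.commute)
  then have k': "16 * X^2 + W^2 = k * Z^2" using \<open>Y > 0\<close> by simp
  have "k = 1" using concordant_multiplier[OF k k'] assms by simp
  then show "X^2 + W^2 = Y^2" "16 * X^2 + W^2 = Z^2" using k k' by simp_all
qed

text \<open>Descent on \<open>p * e\<close>. In a coprime solution with \<open>p\<close> odd,
  \<open>p\<close> is the odd leg of two primitive Pythagorean triples with even legs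
  \<open>e\<close> and \<open>4 e\<close>; comparing their parameters yields a smaller solution. If
  \<open>p\<close> is even it is divisible by 4, and \<open>(e, p / 4)\<close> is a solution with
  the two equations exchanged.\<close>

lemma no_concordant_1_16:
  fixes p e M q :: nat
  assumes "p^2 + e^2 = M^2" "p^2 + 16 * e^2 = q^2" "p > 0" "e > 0"
  shows False
  using assms
proof (induction "p * e" arbitrary: p e M q rule: less_induct)
  case less
  note eq = less.prems(1,2)
  show False
  proof (cases "coprime p e")
    case False
    define g where "g = gcd p e"
    have "g > 0" using less.prems(3) by (simp add: g_def)
    moreover have "g \<noteq> 1" using False by (simp add: g_def coprime_iff_gcd_eq_1)
    ultimately have "g > 1" by linarith
    obtain p' e' where pe: "p = g * p'" "e = g * e'"
      unfolding g_def by (meson dvdE gcd_dvd1 gcd_dvd2)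
    have "g^2 * (p'^2 + e'^2) = M^2" "g^2 * (p'^2 + 16 * e'^2) = q^2"
      using eq unfolding pe by (simp_all add: power2_eq_square algebra_simps)
    then have "g^2 dvd M^2" "g^2 dvd q^2" by (metis dvd_triv_left)+
    then obtain M' q' where Mq: "M = g * M'" "q = g * q'" by (auto elim!: dvdE)
    have "p'^2 + e'^2 = M'^2" "p'^2 + 16 * e'^2 = q'^2"
      using \<open>g^2 * (p'^2 + e'^2) = M^2\<close> \<open>g^2 * (p'^2 + 16 * e'^2) = q^2\<close> \<open>g > 0\<close>
      unfolding Mq by (simp_all add: power_mult_distrib)
    moreover have "p' > 0" "e' > 0" using less.prems(3,4) pe by simp_all
    moreover have "p' * e' < p * e"
    proof -
      have "1 < g * g" using \<open>g > 1\<close> by (metis less_1_mult)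
      then have "1 * (p' * e') < (g * g) * (p' * e')"
        using \<open>p' > 0\<close> \<open>e' > 0\<close> by (intro mult_strict_right_mono) simp_all
      then show ?thesis unfolding pe by (simp add: mult_ac)
    qed
    ultimately show False using less.hyps by blast
  next
    case True
    have "\<not> (odd p \<and> odd e)"
    proof
      assume "odd p \<and> odd e"
      then have "(p^2 mod 8 + e^2 mod 8) mod 8 = 2"
        by (simp add: odd_square_mod_8)
      then have M8: "M^2 mod 8 = 2" unfolding eq(1)[symmetric] by (simp add: mod_add_eq)
      then have "even M" using odd_square_mod_8[of M] by auto
      then obtain l where "M = 2 * l" by (elim evenE)
      then have "M^2 = 4 * l^2" by (simp add: power2_eq_square)
      then show False using M8 by presburger
    qed
    moreover have "\<not> (even p \<and> even e)"
      using True by (auto dest: coprime_common_divisor)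
    ultimately consider "odd p" "even e" | "even p" "odd e" by blast
    then show False
    proof cases
      case 1
      obtain a b where ab: "p + b^2 = a^2" "e = 2 * a * b" "coprime a b" "odd (a + b)"
        using primitive_pythagorean[OF eq(1) True 1 less.prems(4)] .
      have "p^2 + (4 * e)^2 = q^2" using eq(2) by (simp add: power_mult_distrib)
      moreover have "coprime p 4" using \<open>odd p\<close> coprime_power_right_iff[of p 2 2] by simp
      then have "coprime p (4 * e)" using True by simp
      moreover have "even (4 * e)" "4 * e > 0" using less.prems(4) by simp_all
      ultimately obtain c d where cd: "p + d^2 = c^2" "4 * e = 2 * c * d" "coprime c d" "odd (c + d)"
        using primitive_pythagorean[of p "4 * e" q] 1(1) by blast
      have pos: "a > 0" "b > 0" "c > 0" "d > 0"
        using ab(2) cd(2) less.prems(4) by (auto intro: gr0I)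
      have cdab: "c * d = 4 * (a * b)" using ab(2) cd(2) by simp
      have diff: "a^2 + d^2 = c^2 + b^2" using ab(1) cd(1) by linarith
      have "4 dvd c \<or> 4 dvd d"
      proof (cases "even c")
        case True
        then have "coprime 4 d" using cd(4) coprime_power_left_iff[of 2 2 d] by simp
        moreover have "4 dvd c * d" unfolding cdab by simp
        ultimately show ?thesis by (simp add: coprime_dvd_mult_left_iff)
      next
        case False
        then have "coprime 4 c" using coprime_power_left_iff[of 2 2 c] by simp
        moreover have "4 dvd c * d" unfolding cdab by simp
        ultimately show ?thesis by (simp add: coprime_dvd_mult_right_iff)
      qed
      then show False
      proof
        assume "4 dvd c"
        then obtain c' where c': "c = 4 * c'" by (elim dvdE)
        have "odd d" using cd(4) c' by simp
        have prod: "c' * d = a * b" using cdab c' by simp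
        then have "a dvd c' * d" by simp
        \<comment> \<open>Two factorisations of one number have a common refinement:
          \<open>c' * d = a * b\<close> becomes \<open>a = x z\<close>, \<open>b = y w\<close>,
          \<open>c' = x y\<close>, \<open>d = z w\<close>. Then \<open>a^2 + d^2 = c^2 + b^2\<close>
          turns into a ratio of the two forms in \<open>w\<close> and \<open>x\<close>.\<close>
        then obtain x z where xz: "a = x * z" "x dvd c'" "z dvd d" using division_decomp by blast
        then obtain y w where yw: "c' = x * y" "d = z * w" by (auto elim!: dvdE)
        have b: "b = y * w" using prod pos(1) unfolding xz(1) yw by (auto simp: mult_ac)
        have cop: "coprime x w" "coprime y z"
          using cd(3) unfolding c' yw by (auto simp: coprime_commute)
        have "(x * z)^2 + (z * w)^2 = (4 * (x * y))^2 + (y * w)^2"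
          using diff unfolding c' xz(1) yw b .
        then have "z^2 * (x^2 + w^2) = y^2 * (16 * x^2 + w^2)"
          by (simp add: power2_eq_square algebra_simps)
        moreover have "odd w" "odd z" "y > 0" using \<open>odd d\<close> pos(2) yw(2) b by auto
        ultimately have "x^2 + w^2 = y^2" "16 * x^2 + w^2 = z^2"
          using concordant_coprime_ratio cop by blast+
        then have new: "w^2 + x^2 = y^2" "w^2 + 16 * x^2 = z^2" by simp_all
        have posn: "w > 0" "x > 0" "z > 0" "y > 0" using pos b xz(1) by (auto intro: gr0I)
        have "w * x < p * e"
        proof -
          have "w * x * 1 \<le> (w * x) * (z * y)" using posn by (intro mult_le_mono) auto
          also have "\<dots> < e" unfolding ab(2) xz(1) b using posn by simp
          also have "\<dots> \<le> p * e" using less.prems(3) by simp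
          finally show ?thesis by simp
        qed
        then show False using less.hyps new posn by blast
      next
        assume "4 dvd d"
        then obtain d' where d': "d = 4 * d'" by (elim dvdE)
        have "odd c" using cd(4) d' by simp
        have prod: "d' * c = a * b" using cdab d' by (simp add: mult.commute)
        then have "a dvd d' * c" by simp
        then obtain x z where xz: "a = x * z" "x dvd d'" "z dvd c" using division_decomp by blast
        then obtain y w where yw: "d' = x * y" "c = z * w" by (auto elim!: dvdE)
        have b: "b = y * w" using prod pos(1) unfolding xz(1) yw by (auto simp: mult_ac)
        have cop: "coprime x w" "coprime y z"
          using cd(3) unfolding d' yw by (auto simp: coprime_commute)
        have "(x * z)^2 + (4 * (x * y))^2 = (z * w)^2 + (y * w)^2"
          using diff unfolding d' xz(1) yw b .
        then have "w^2 * (y^2 + z^2) = x^2 * (16 * y^2 + z^2)"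
          by (simp add: power2_eq_square algebra_simps)
        moreover have "odd w" "odd z" "x > 0" using \<open>odd c\<close> pos(1) yw(2) xz(1) by auto
        ultimately have "y^2 + z^2 = x^2" "16 * y^2 + z^2 = w^2"
          using concordant_coprime_ratio cop by blast+
        then have new: "z^2 + y^2 = x^2" "z^2 + 16 * y^2 = w^2" by simp_all
        have posn: "w > 0" "x > 0" "z > 0" "y > 0" using pos b xz(1) by (auto intro: gr0I)
        have "z * y < p * e"
        proof -
          have "z * y * 1 \<le> (z * y) * (w * x)" using posn by (intro mult_le_mono) auto
          also have "\<dots> < e" unfolding ab(2) xz(1) b using posn by simp
          also have "\<dots> \<le> p * e" using less.prems(3) by simp
          finally show ?thesis by simp
        qed
        then show False using less.hyps new posn by blast
      qed
    next
      case 2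
      obtain p1 where p1: "p = 2 * p1" using 2(1) by (elim evenE)
      have "even (q^2)" unfolding eq(2)[symmetric] using 2(1) by simp
      then obtain q1 where q1: "q = 2 * q1" by (auto elim: evenE)
      have e1: "p1^2 + 4 * e^2 = q1^2" using eq(2) unfolding p1 q1 by (simp add: power_mult_distrib)
      have "even p1"
      proof (rule ccontr)
        assume "odd p1"
        then have "(p1^2 mod 8 + (4 * (e^2 mod 8)) mod 8) mod 8 = 5"
          using odd_square_mod_8[of p1] odd_square_mod_8[OF 2(2)] by simp
        then have "(p1^2 + 4 * e^2) mod 8 = 5"
          by (metis mod_add_eq mod_mult_right_eq)
        then have "q1^2 mod 8 = 5" unfolding e1 .
        moreover have "odd (q1^2)" unfolding e1[symmetric] using \<open>odd p1\<close> by simp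
        then have "odd q1" by simp
        ultimately show False using odd_square_mod_8[of q1] by simp
      qed
      then obtain p2 where p2: "p1 = 2 * p2" by (elim evenE)
      have "even (q1^2)" unfolding e1[symmetric] using \<open>even p1\<close> by simp
      then obtain q2 where q2: "q1 = 2 * q2" by (auto elim: evenE)
      have "e^2 + p2^2 = q2^2" using e1 unfolding p2 q2 by (simp add: power_mult_distrib)
      moreover have "e^2 + 16 * p2^2 = M^2" using eq(1) unfolding p1 p2 by (simp add: power_mult_distrib)
      moreover have "p2 > 0" using less.prems(3) p1 p2 by simp
      moreover have "e * p2 < p * e" unfolding p1 p2 using less.prems(4) \<open>p2 > 0\<close> by simp
      ultimately show False using less.hyps less.prems(4) by blast
    qed
  qed
qed

section \<open>The 2-descent on \<open>Y^2 = X (X - 1) (X + 15)\<close>\<close>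

lemma rat_common_denominator3:
  fixes x y z :: rat
  obtains a b c n :: int where "n > 0" "x = of_int a / of_int n" "y = of_int b / of_int n" "z = of_int c / of_int n"
proof -
  obtain a1 n1 where 1: "quotient_of x = (a1, n1)" by fastforce
  obtain a2 n2 where 2: "quotient_of y = (a2, n2)" by fastforce
  obtain a3 n3 where 3: "quotient_of z = (a3, n3)" by fastforce
  have pos: "n1 > 0" "n2 > 0" "n3 > 0" using 1 2 3 quotient_of_denom_pos by blast+
  have "x = of_int a1 / of_int n1" "y = of_int a2 / of_int n2" "z = of_int a3 / of_int n3"
    using 1 2 3 quotient_of_div by blast+
  then show thesis
    using pos by (intro that[of "n1 * n2 * n3" "a1 * n2 * n3" "a2 * n1 * n3" "a3 * n1 * n2"]) simp_all
qed

lemma rat_no_concordant_1_16: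
  fixes p a b :: rat
  assumes "p^2 + 1 = a^2" "p^2 + 16 = b^2"
  shows "p = 0"
proof (rule ccontr)
  assume "p \<noteq> 0"
  obtain P A B n :: int where n: "n > 0" and pab: "p = of_int P / of_int n" "a = of_int A / of_int n" "b = of_int B / of_int n"
    using rat_common_denominator3 .
  have "(of_int (P^2 + n^2) :: rat) = of_int (A^2)" "(of_int (P^2 + 16 * n^2) :: rat) = of_int (B^2)"
    using assms n unfolding pab by (simp_all add: power_divide field_simps)
  then have eq: "P^2 + n^2 = A^2" "P^2 + 16 * n^2 = B^2" unfolding of_int_eq_iff .
  have "(nat \<bar>P\<bar>)^2 + (nat \<bar>n\<bar>)^2 = (nat \<bar>A\<bar>)^2" "(nat \<bar>P\<bar>)^2 + 16 * (nat \<bar>n\<bar>)^2 = (nat \<bar>B\<bar>)^2"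
    using eq by (simp_all flip: of_nat_eq_iff[where 'a=int])
  then show False
    using no_concordant_1_16[of "nat \<bar>P\<bar>" "nat \<bar>n\<bar>"] \<open>p \<noteq> 0\<close> n pab(1) by auto
qed

lemma rat_square_int:
  fixes r :: rat
  assumes "r^2 = of_int n"
  obtains c :: int where "n = c^2"
proof -
  obtain u v where uv: "quotient_of r = (u, v)" by fastforce
  then have v: "v > 0" and cop: "coprime u v" and r: "r = of_int u / of_int v"
    using quotient_of_denom_pos quotient_of_coprime quotient_of_div by blast+
  have "(of_int (u^2) :: rat) = of_int (n * v^2)"
    using assms v unfolding r by (simp add: power_divide field_simps)
  then have *: "u^2 = n * v^2" unfolding of_int_eq_iff .
  then have "v^2 dvd u^2" by simp
  then have "v dvd u" by simp
  then have "is_unit v" using cop by (meson coprime_common_divisor dvd_refl)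
  then have "v = 1" using v by simp
  then show thesis using * that[of u] by simp
qed

lemma int_product_square:
  fixes u v c :: int
  assumes "u * v = c^2" "u \<noteq> 0" "v \<noteq> 0"
  obtains \<sigma> M N where "\<sigma> = 1 \<or> \<sigma> = - 1" "u = \<sigma> * gcd u v * M^2" "v = \<sigma> * gcd u v * N^2"
proof -
  define g where "g = gcd u v"
  have "g > 0" using assms(2) by (simp add: g_def)
  obtain u' v' where uv: "u = g * u'" "v = g * v'" and cop: "coprime u' v'"
    unfolding g_def using gcd_coprime_exists[of u v] assms(2) by (auto simp: mult.commute)
  have "g^2 * (u' * v') = c^2" using assms(1) unfolding uv by (simp add: power2_eq_square algebra_simps)
  then have "g^2 dvd c^2" by (metis dvd_triv_left)
  then obtain c' where c: "c = g * c'" by (auto elim!: dvdE)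
  have "u' * v' = c'^2"
    using \<open>g^2 * (u' * v') = c^2\<close> \<open>g > 0\<close> unfolding c by (simp add: power_mult_distrib)
  then have "nat \<bar>u'\<bar> * nat \<bar>v'\<bar> = (nat \<bar>c'\<bar>)^2"
    by (simp flip: of_nat_eq_iff[where 'a=int] abs_mult)
  moreover have "coprime (nat \<bar>u'\<bar>) (nat \<bar>v'\<bar>)" using cop by (simp add: coprime_nat_abs_left_iff coprime_nat_abs_right_iff flip: coprime_int_iff)
  moreover have nz: "u' \<noteq> 0" "v' \<noteq> 0" using assms(2,3) uv by auto
  ultimately obtain r s where "nat \<bar>u'\<bar> = r^2" "nat \<bar>v'\<bar> = s^2"
    by (elim coprime_square_factors) auto
  then have rs: "\<bar>u'\<bar> = (int r)^2" "\<bar>v'\<bar> = (int s)^2"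
    by (metis abs_ge_zero int_nat_eq of_nat_power)+
  have "sgn u' * sgn v' = sgn (c'^2)" using \<open>u' * v' = c'^2\<close> by (metis sgn_mult)
  moreover have "c' \<noteq> 0" using nz \<open>u' * v' = c'^2\<close> by auto
  ultimately have "sgn u' * sgn v' = 1" by (simp add: sgn_if)
  then have "sgn v' = sgn u'" using nz by (auto simp: sgn_if split: if_splits)
  then have "u = sgn u' * g * (int r)^2" "v = sgn u' * g * (int s)^2"
    unfolding uv rs[symmetric] using sgn_mult_abs[of u'] sgn_mult_abs[of v'] by (simp_all add: mult_ac)
  moreover have "sgn u' = 1 \<or> sgn u' = - 1" using nz by (simp add: sgn_if)
  ultimately show thesis using that unfolding g_def by blast
qed

text \<open>Both factors are the gcd times a square up to a common sign, which \<open>v > 0\<close>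
  makes positive; a divisor of 16 is a square or twice a square.\<close>

lemma int_product_square_gcd16:
  fixes u v c :: int
  assumes "u * v = c^2" "u \<noteq> 0" "v > 0" "gcd u v dvd 16"
  obtains (square) r s where "u = r^2" "v = s^2" | (double) r s where "u = 2 * r^2" "v = 2 * s^2"
proof -
  let ?g = "gcd u v"
  obtain \<sigma> M N where MN: "\<sigma> = 1 \<or> \<sigma> = - 1" "u = \<sigma> * ?g * M^2" "v = \<sigma> * ?g * N^2"
    using int_product_square[of u v c] assms by auto
  have g0: "?g > 0" using assms(2) by simp
  have "\<sigma> = 1"
  proof (rule ccontr)
    assume "\<sigma> \<noteq> 1"
    then have "v = - (?g * N^2)" using MN(1,3) by auto
    moreover have "?g * N^2 \<ge> 0" by simp
    ultimately show False using assms(3) by linarith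
  qed
  then have uv: "u = ?g * M^2" "v = ?g * N^2" using MN by simp_all
  have "?g \<le> 16" using assms(4) by (rule zdvd_imp_le) simp
  then have "?g = 1 \<or> ?g = 2 \<or> ?g = 3 \<or> ?g = 4 \<or> ?g = 5 \<or> ?g = 6 \<or> ?g = 7
     \<or> ?g = 8 \<or> ?g = 9 \<or> ?g = 10 \<or> ?g = 11 \<or> ?g = 12 \<or> ?g = 13 \<or> ?g = 14
     \<or> ?g = 15 \<or> ?g = 16" using g0 by presburger
  then have "?g = 1 \<or> ?g = 2 \<or> ?g = 4 \<or> ?g = 8 \<or> ?g = 16"
    using assms(4) by (elim disjE) simp_all
  then consider "?g = 1^2" | "?g = 2^2" | "?g = 4^2" | "?g = 2 * 1^2" | "?g = 2 * 2^2"
    by (elim disjE) simp_all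
  moreover have thesis if "?g = k^2" for k
    using square[of "k * M" "k * N"] uv unfolding \<open>?g = k^2\<close> by (simp add: power_mult_distrib mult.assoc)
  moreover have thesis if "?g = 2 * k^2" for k
    using double[of "k * M" "k * N"] uv unfolding \<open>?g = 2 * k^2\<close> by (simp add: power_mult_distrib mult.assoc)
  ultimately show thesis by metis
qed

lemma three_dvd_sum_squares:
  fixes x y :: int
  assumes "3 dvd x^2 + y^2"
  shows "3 dvd x" "3 dvd y"
proof -
  have "x mod 3 = 0 \<or> x mod 3 = 1 \<or> x mod 3 = 2" "y mod 3 = 0 \<or> y mod 3 = 1 \<or> y mod 3 = 2" by presburger+
  moreover have "((x mod 3)^2 + (y mod 3)^2) mod 3 = (x^2 + y^2) mod 3"
    by (intro mod_add_cong) (simp_all add: power_mod)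
  then have "((x mod 3)^2 + (y mod 3)^2) mod 3 = 0" using assms by simp
  ultimately have "x mod 3 = 0 \<and> y mod 3 = 0" by (elim disjE) simp_all
  then show "3 dvd x" "3 dvd y" by (simp_all add: dvd_eq_mod_eq_0)
qed

lemma five_dvd_nonresidue:
  fixes x y :: int
  assumes "5 dvd x^2 + 2 * y^2 \<or> 5 dvd x^2 + 3 * y^2"
  shows "5 dvd x" "5 dvd y"
proof -
  have "x mod 5 = 0 \<or> x mod 5 = 1 \<or> x mod 5 = 2 \<or> x mod 5 = 3 \<or> x mod 5 = 4"
    "y mod 5 = 0 \<or> y mod 5 = 1 \<or> y mod 5 = 2 \<or> y mod 5 = 3 \<or> y mod 5 = 4" by presburger+
  moreover have "((x mod 5)^2 + k * (y mod 5)^2) mod 5 = (x^2 + k * y^2) mod 5" for k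
    by (intro mod_add_cong mod_mult_cong) (simp_all add: power_mod)
  then have "((x mod 5)^2 + 2 * (y mod 5)^2) mod 5 = 0 \<or> ((x mod 5)^2 + 3 * (y mod 5)^2) mod 5 = 0"
    using assms by (simp add: dvd_eq_mod_eq_0)
  ultimately have "x mod 5 = 0 \<and> y mod 5 = 0" by (elim disjE) simp_all
  then show "5 dvd x" "5 dvd y" by (simp_all add: dvd_eq_mod_eq_0)
qed

lemma dvd_of_square_mult:
  fixes x :: int
  assumes "p^2 dvd m * x^2" "prime p" "\<not> p\<^sup>2 dvd m"
  shows "p dvd x"
proof (rule ccontr)
  assume "\<not> p dvd x"
  then have "coprime p x" using assms(2) by (simp add: prime_imp_coprime)
  then have "coprime (p^2) (x^2)" by simp
  then show False using assms(1,3) by (simp add: coprime_dvd_mult_left_iff)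
qed

lemma gcd_dvd_16:
  fixes A B u v a b c d :: int
  assumes "coprime A B" "a * u + b * v = 16 * A^2" "c * u + d * v = 16 * B^2"
  shows "gcd u v dvd 16"
proof -
  have "gcd u v dvd 16 * A^2" "gcd u v dvd 16 * B^2"
    unfolding assms(2,3)[symmetric] by (simp_all add: dvd_add dvd_mult)
  then have "gcd u v dvd gcd (16 * A^2) (16 * B^2)" by simp
  also have "\<dots> = 16 * gcd (A^2) (B^2)" by (simp only: gcd_mult_left) simp
  also have "gcd (A^2) (B^2) = 1" using assms(1) by (metis coprime_iff_gcd_eq_1 coprime_power_left_iff coprime_power_right_iff)
  finally show ?thesis by simp
qed

text \<open>If both factors are squares, \<open>r\<close> and \<open>B\<close> solve Fermat's pair
  of equations. If both are twice squares, 3 divides \<open>A^2 + s^2\<close>, hence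
  \<open>A\<close> and then \<open>B\<close>.\<close>

lemma descent_quartic_1:
  fixes A B N :: int
  assumes "coprime A B" "A \<noteq> 0" "B \<noteq> 0" "A^2 \<noteq> B^2" "(A^2 - B^2) * (A^2 + 15 * B^2) = N^2"
  shows False
proof -
  have pos: "A^2 + 15 * B^2 > 0" using assms(2) by (simp add: add_pos_nonneg)
  have "15 * (A^2 - B^2) + 1 * (A^2 + 15 * B^2) = 16 * A^2"
    "- 1 * (A^2 - B^2) + 1 * (A^2 + 15 * B^2) = 16 * B^2" by simp_all
  then have g: "gcd (A^2 - B^2) (A^2 + 15 * B^2) dvd 16" by (rule gcd_dvd_16[OF assms(1)])
  have nz: "A^2 - B^2 \<noteq> 0" using assms(4) by simp
  show False
  proof (rule int_product_square_gcd16[OF assms(5) nz pos g])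
    fix r s assume rs: "A^2 - B^2 = r^2" "A^2 + 15 * B^2 = s^2"
    then have "r^2 + B^2 = A^2" "r^2 + 16 * B^2 = s^2" by simp_all
    then have "(nat \<bar>r\<bar>)^2 + (nat \<bar>B\<bar>)^2 = (nat \<bar>A\<bar>)^2" "(nat \<bar>r\<bar>)^2 + 16 * (nat \<bar>B\<bar>)^2 = (nat \<bar>s\<bar>)^2"
      by (simp_all flip: of_nat_eq_iff[where 'a=int])
    moreover have "r \<noteq> 0" using rs(1) nz by auto
    ultimately show False using no_concordant_1_16[of "nat \<bar>r\<bar>" "nat \<bar>B\<bar>"] assms(3) by auto
  next
    fix r s assume rs: "A^2 - B^2 = 2 * r^2" "A^2 + 15 * B^2 = 2 * s^2"
    then have "A^2 + s^2 = 3 * (s^2 - 5 * B^2)" by simp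
    then have "3 dvd A" "3 dvd s" using three_dvd_sum_squares[of A s] by simp_all
    then have "3^2 dvd 2 * s^2 - A^2" by (intro dvd_diff dvd_mult) (simp_all only: dvd_power_same)
    also have "2 * s^2 - A^2 = 15 * B^2" using rs by simp
    finally have "3 dvd B" by (rule dvd_of_square_mult) simp_all
    then show False using \<open>3 dvd A\<close> assms(1) by (auto dest: coprime_common_divisor)
  qed
qed

text \<open>The one quartic with admissible points: \<open>A^2 = B^2\<close> corresponds to
  \<open>X = 5\<close>, and to \<open>X = -3\<close> after exchanging \<open>A\<close> and
  \<open>B\<close>. A translation by a point of order 4 reduces any other solution to Fermat's
  pair.\<close>

lemma descent_quartic_5:
  fixes A B N :: int
  assumes "coprime A B" "A \<noteq> 0" "B \<noteq> 0" "5 * A^2 \<noteq> B^2" "(5 * A^2 - B^2) * (A^2 + 3 * B^2) = N^2"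
  shows "A^2 = B^2"
proof -
  have pos: "A^2 + 3 * B^2 > 0" using assms(2) by (simp add: add_pos_nonneg)
  have "3 * (5 * A^2 - B^2) + 1 * (A^2 + 3 * B^2) = 16 * A^2"
    "- 1 * (5 * A^2 - B^2) + 5 * (A^2 + 3 * B^2) = 16 * B^2" by simp_all
  then have g: "gcd (5 * A^2 - B^2) (A^2 + 3 * B^2) dvd 16" by (rule gcd_dvd_16[OF assms(1)])
  have nz: "5 * A^2 - B^2 \<noteq> 0" using assms(4) by simp
  show ?thesis
  proof (rule int_product_square_gcd16[OF assms(5) nz pos g])
    fix r s assume rs: "5 * A^2 - B^2 = r^2" "A^2 + 3 * B^2 = s^2"
    define M where "M = (of_int A / of_int B :: rat)"
    define R where "R = (of_int r / of_int B :: rat)"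
    define S where "S = (of_int s / of_int B :: rat)"
    have "(of_int (5 * A^2 - B^2) :: rat) = of_int (r^2)" "(of_int (A^2 + 3 * B^2) :: rat) = of_int (s^2)"
      unfolding rs by simp_all
    then have RS: "5 * M^2 - 1 = R^2" "M^2 + 3 = S^2"
      using assms(3) unfolding M_def R_def S_def by (simp_all add: power_divide field_simps)
    have "M^2 = 1"
    proof (rule ccontr)
      assume M1: "M^2 \<noteq> 1"
      define D where "D = M^2 - 1"
      have D: "D \<noteq> 0" using M1 by (simp add: D_def)
      text \<open>Translation by the point \<open>(5, 20)\<close> of order 4.\<close>
      have "(2 * (R - M * S))^2 + D^2 = (4 * M - R * S)^2" "(2 * (R - M * S))^2 + 16 * D^2 = (2 * (S - R * M))^2 * 1"
        unfolding D_def using RS by algebra+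
      then have "(2 * (R - M * S) / D)^2 + 1 = ((4 * M - R * S) / D)^2" "(2 * (R - M * S) / D)^2 + 16 = ((2 * (S - R * M)) / D)^2"
        using D by (simp_all add: power_divide field_simps)
      then have "2 * (R - M * S) / D = 0" by (rule rat_no_concordant_1_16)
      then have "R = M * S" using D by simp
      then have "(M^2 - 1)^2 = 0" using RS by algebra
      then show False using M1 by simp
    qed
    then have "(of_int (A^2) :: rat) = of_int (B^2)"
      using assms(3) unfolding M_def by (simp add: power_divide field_simps)
    then show ?thesis unfolding of_int_eq_iff .
  next
    fix r s assume rs: "5 * A^2 - B^2 = 2 * r^2" "A^2 + 3 * B^2 = 2 * s^2"
    then have "A^2 + s^2 = 3 * (s^2 - B^2)" by simp
    then have "3 dvd A" "3 dvd s" using three_dvd_sum_squares[of A s] by simp_all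
    then have "3^2 dvd 2 * s^2 - A^2" by (intro dvd_diff dvd_mult) (simp_all only: dvd_power_same)
    also have "2 * s^2 - A^2 = 3 * B^2" using rs by simp
    finally have "3 dvd B" by (rule dvd_of_square_mult) simp_all
    then show ?thesis using \<open>3 dvd A\<close> assms(1) by (auto dest: coprime_common_divisor)
  qed
qed

text \<open>Only local obstructions occur: a pair of squares fails at 3, where -1 is a nonresidue,
  and a pair of doubled squares fails at 5, where -2 is one.\<close>

lemma descent_quartic_neg1:
  fixes A B N :: int
  assumes "coprime A B" "A \<noteq> 0" "B \<noteq> 0" "15 * B^2 \<noteq> A^2" "(15 * B^2 - A^2) * (A^2 + B^2) = N^2"
  shows False
proof -
  have pos: "A^2 + B^2 > 0" using assms(2) by (simp add: add_pos_nonneg)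
  have "- 1 * (15 * B^2 - A^2) + 15 * (A^2 + B^2) = 16 * A^2"
    "1 * (15 * B^2 - A^2) + 1 * (A^2 + B^2) = 16 * B^2" by simp_all
  then have g: "gcd (15 * B^2 - A^2) (A^2 + B^2) dvd 16" by (rule gcd_dvd_16[OF assms(1)])
  have nz: "15 * B^2 - A^2 \<noteq> 0" using assms(4) by simp
  show ?thesis
  proof (rule int_product_square_gcd16[OF assms(5) nz pos g])
    fix r s assume rs: "15 * B^2 - A^2 = r^2"
    then have "A^2 + r^2 = 3 * (5 * B^2)" by simp
    then have "3 dvd A" "3 dvd r" using three_dvd_sum_squares[of A r] by simp_all
    then have "3^2 dvd A^2 + r^2" by (intro dvd_add) (simp_all only: dvd_power_same)
    also have "A^2 + r^2 = 15 * B^2" using rs by simp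
    finally have "3 dvd B" by (rule dvd_of_square_mult) simp_all
    then show False using \<open>3 dvd A\<close> assms(1) by (auto dest: coprime_common_divisor)
  next
    fix r s assume rs: "15 * B^2 - A^2 = 2 * r^2"
    then have "A^2 + 2 * r^2 = 5 * (3 * B^2)" by simp
    then have "5 dvd A" "5 dvd r" using five_dvd_nonresidue[of A r] by simp_all
    then have "5^2 dvd A^2 + 2 * r^2" by (intro dvd_add dvd_mult) (simp_all only: dvd_power_same)
    also have "A^2 + 2 * r^2 = 15 * B^2" using rs by simp
    finally have "5 dvd B" by (rule dvd_of_square_mult) simp_all
    then show False using \<open>5 dvd A\<close> assms(1) by (auto dest: coprime_common_divisor)
  qed
qed

text \<open>Again the obstructions are local: squares fail at 3, doubled squares at 5, now because
  -3 is a nonresidue there.\<close>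

lemma descent_quartic_neg5:
  fixes A B N :: int
  assumes "coprime A B" "A \<noteq> 0" "B \<noteq> 0" "3 * B^2 \<noteq> A^2" "(3 * B^2 - A^2) * (5 * A^2 + B^2) = N^2"
  shows False
proof -
  have pos: "5 * A^2 + B^2 > 0" using assms(2) by (simp add: add_pos_nonneg)
  have "- 1 * (3 * B^2 - A^2) + 3 * (5 * A^2 + B^2) = 16 * A^2"
    "5 * (3 * B^2 - A^2) + 1 * (5 * A^2 + B^2) = 16 * B^2" by simp_all
  then have g: "gcd (3 * B^2 - A^2) (5 * A^2 + B^2) dvd 16" by (rule gcd_dvd_16[OF assms(1)])
  have nz: "3 * B^2 - A^2 \<noteq> 0" using assms(4) by simp
  show ?thesis
  proof (rule int_product_square_gcd16[OF assms(5) nz pos g])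
    fix r s assume rs: "3 * B^2 - A^2 = r^2"
    then have "A^2 + r^2 = 3 * B^2" by simp
    then have "3 dvd A" "3 dvd r" using three_dvd_sum_squares[of A r] by simp_all
    then have "3^2 dvd A^2 + r^2" by (intro dvd_add) (simp_all only: dvd_power_same)
    also have "A^2 + r^2 = 3 * B^2" using rs by simp
    finally have "3 dvd B" by (rule dvd_of_square_mult) simp_all
    then show False using \<open>3 dvd A\<close> assms(1) by (auto dest: coprime_common_divisor)
  next
    fix r s assume rs: "5 * A^2 + B^2 = 2 * s^2"
    then have "B^2 + 3 * s^2 = 5 * (s^2 - A^2)" by simp
    then have "5 dvd B" "5 dvd s" using five_dvd_nonresidue[of B s] by simp_all
    then have "5^2 dvd 2 * s^2 - B^2" by (intro dvd_diff dvd_mult) (simp_all only: dvd_power_same)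
    also have "2 * s^2 - B^2 = 5 * A^2" using rs by simp
    finally have "5 dvd A" by (rule dvd_of_square_mult) simp_all
    then show False using \<open>5 dvd B\<close> assms(1) by (auto dest: coprime_common_divisor)
  qed
qed

lemma int_dvd_15:
  fixes g :: int
  assumes "g dvd 15" "g > 0"
  shows "g = 1 \<or> g = 3 \<or> g = 5 \<or> g = 15"
proof -
  have "g \<le> 15" using assms(1) by (rule zdvd_imp_le) simp
  then have "g = 1 \<or> g = 2 \<or> g = 3 \<or> g = 4 \<or> g = 5 \<or> g = 6 \<or> g = 7
     \<or> g = 8 \<or> g = 9 \<or> g = 10 \<or> g = 11 \<or> g = 12 \<or> g = 13 \<or> g = 14 \<or> g = 15"
    using assms(2) by presburger
  then show ?thesis using assms(1) by (elim disjE) simp_all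
qed

text \<open>In lowest terms the denominator of \<open>x\<close> is a square \<open>e^2\<close> and
  the numerator is \<open>\<tau> * g * M^2\<close> with \<open>g\<close> dividing 15, which makes
  eight classes. Translation by the 2-torsion point \<open>(0, 0)\<close> is
  \<open>x -> -15 / x\<close>; it exchanges \<open>M\<close> and \<open>e\<close> and pairs the
  classes, so that four quartics cover them all.\<close>

lemma rational_points_15a:
  fixes x y :: rat
  assumes eq: "x * (x - 1) * (x + 15) = y^2"
  shows "x \<in> {0, 1, - 15, 5, - 3}"
proof (rule ccontr)
  assume not: "x \<notin> {0, 1, - 15, 5, - 3}"
  obtain a b where ab: "quotient_of x = (a, b)" by fastforce
  then have b: "b > 0" and cop: "coprime a b" and x: "x = of_int a / of_int b"
    using quotient_of_denom_pos quotient_of_coprime quotient_of_div by blast+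
  have nz: "a \<noteq> 0" "a - b \<noteq> 0" "a + 15 * b \<noteq> 0"
  proof -
    show "a \<noteq> 0" using not x by auto
    show "a - b \<noteq> 0" using not x b by auto
    show "a + 15 * b \<noteq> 0"
    proof
      assume "a + 15 * b = 0"
      then have "a = - 15 * b" by simp
      then show False using not x b by simp
    qed
  qed
  have "(y * (of_int b)^2)^2 = of_int (b * (a * ((a - b) * (a + 15 * b))))"
  proof -
    have xb: "x * of_int b = of_int a" using b x by simp
    have "(y * (of_int b)^2)^2 = of_int b * ((x * of_int b) * ((x * of_int b - of_int b) * (x * of_int b + 15 * of_int b)))"
      using eq by algebra
    then show ?thesis unfolding xb by simp
  qed
  then obtain c where c: "b * (a * ((a - b) * (a + 15 * b))) = c^2"
    by (rule rat_square_int)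
  define W where "W = (a - b) * (a + 15 * b)"
  have W0: "W \<noteq> 0" using nz by (simp add: W_def)
  have "coprime b (a - b)" "coprime b (a + 15 * b)"
  proof -
    have "gcd b (a - b) = gcd b a" by (metis gcd_diff1 gcd.commute)
    then show "coprime b (a - b)" using cop by (simp add: coprime_iff_gcd_eq_1 gcd.commute)
    have "gcd b (15 * b + a) = gcd b a" by (rule gcd_add_mult)
    then show "coprime b (a + 15 * b)" using cop by (simp add: coprime_iff_gcd_eq_1 gcd.commute add.commute)
  qed
  then have copb: "coprime b (a * W)" unfolding W_def using cop by (simp add: coprime_commute)
  obtain \<sigma> e d where e: "\<sigma> = 1 \<or> \<sigma> = - 1" "b = \<sigma> * gcd b (a * W) * e^2" "a * W = \<sigma> * gcd b (a * W) * d^2"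
    using int_product_square[of b "a * W" c] c b nz(1) W0 unfolding W_def by auto
  have "gcd b (a * W) = 1" using copb by simp
  moreover have "\<sigma> = 1"
  proof (rule ccontr)
    assume "\<sigma> \<noteq> 1"
    then have "b = - (e^2)" using e(1,2) calculation by auto
    moreover have "e^2 \<ge> 0" by simp
    ultimately show False using b by linarith
  qed
  ultimately have be: "b = e^2" and aW: "a * W = d^2" using e by simp_all
  have "e \<noteq> 0" using be b by auto
  obtain \<tau> M N where MN: "\<tau> = 1 \<or> \<tau> = - 1" "a = \<tau> * gcd a W * M^2" "W = \<tau> * gcd a W * N^2"
    using int_product_square[OF aW nz(1) W0] .
  define g where "g = gcd a W"
  have "g dvd 15"
  proof -
    have "g dvd a" "g dvd W" by (simp_all add: g_def)
    \<comment> \<open>\<open>W\<close> is congruent to \<open>- 15 b^2\<close> modulo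
      \<open>a\<close>, and \<open>g\<close> is prime to \<open>b\<close>.\<close>
    moreover have "15 * b^2 = a * (a + 14 * b) - W" by (simp add: W_def power2_eq_square algebra_simps)
    ultimately have "g dvd 15 * b^2" by simp
    moreover have "coprime g b" using cop \<open>g dvd a\<close> by (meson coprime_divisors dvd_refl)
    ultimately show ?thesis by (simp add: coprime_dvd_mult_left_iff)
  qed
  moreover have "g > 0" using nz(1) by (simp add: g_def)
  ultimately have g: "g = 1 \<or> g = 3 \<or> g = 5 \<or> g = 15" by (rule int_dvd_15)
  have M0: "M \<noteq> 0" using nz(1) MN(2) by auto
  have "M dvd a" using MN(2) by (metis dvd_triv_right dvd_mult_left mult.commute power2_eq_square)
  then have "coprime M b" using cop by (meson coprime_divisors dvd_refl)
  then have Me: "coprime M e" "coprime e M" unfolding be by (simp_all add: coprime_commute)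
  have a: "a = \<tau> * g * M^2" and "W = \<tau> * g * N^2"
    using MN(2,3) unfolding g_def .
  then have W: "(a - e^2) * (a + 15 * e^2) = \<tau> * g * N^2"
    unfolding W_def be by simp
  have nz': "a \<noteq> e^2" "a \<noteq> - 15 * e^2" using nz be by auto
  have xM: "x = of_int (\<tau> * g) * (of_int (M^2) / of_int (e^2))" unfolding x be a by simp
  show False
  proof (cases "\<tau> = 1")
    case True
    from g show False
    proof (elim disjE)
      assume "g = 1"
      then have a': "a = M^2" using a True by simp
      have "(M^2 - e^2) * (M^2 + 15 * e^2) = N^2" using W \<open>g = 1\<close> True unfolding a' by simp
      then show False using descent_quartic_1[OF Me(1) M0 \<open>e \<noteq> 0\<close>] nz'(1) a' by blast
    next
      assume "g = 3"
      then have a': "a = 3 * M^2" using a True by simp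
      have "3 * ((3 * M^2 - e^2) * (5 * e^2 + M^2)) = 3 * N^2"
        using W \<open>g = 3\<close> True unfolding a' by (simp add: algebra_simps)
      then have "(3 * M^2 - e^2) * (5 * e^2 + M^2) = N^2" by simp
      then show False using descent_quartic_neg5[OF Me(2) \<open>e \<noteq> 0\<close> M0] nz'(1) a' by metis
    next
      assume "g = 5"
      then have a': "a = 5 * M^2" using a True by simp
      have "5 * ((5 * M^2 - e^2) * (M^2 + 3 * e^2)) = 5 * N^2"
        using W \<open>g = 5\<close> True unfolding a' by (simp add: algebra_simps)
      then have "(5 * M^2 - e^2) * (M^2 + 3 * e^2) = N^2" by simp
      then have "M^2 = e^2" using descent_quartic_5[OF Me(1) M0 \<open>e \<noteq> 0\<close>] nz'(1) a' by metis
      then show False using xM \<open>e \<noteq> 0\<close> M0 \<open>g = 5\<close> True not by simp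
    next
      assume "g = 15"
      then have a': "a = 15 * M^2" using a True by simp
      have "15 * ((15 * M^2 - e^2) * (e^2 + M^2)) = 15 * N^2"
        using W \<open>g = 15\<close> True unfolding a' by (simp add: algebra_simps)
      then have "(15 * M^2 - e^2) * (e^2 + M^2) = N^2" by simp
      then show False using descent_quartic_neg1[OF Me(2) \<open>e \<noteq> 0\<close> M0] nz'(1) a' by metis
    qed
  next
    case False
    then have True: "\<tau> = - 1" using MN(1) by simp
    from g show False
    proof (elim disjE)
      assume "g = 1"
      then have a': "a = - (M^2)" using a True by simp
      have "(15 * e^2 - M^2) * (M^2 + e^2) = N^2"
        using W \<open>g = 1\<close> True unfolding a' by (simp add: algebra_simps)
      moreover have "15 * e^2 \<noteq> M^2" using nz'(2) a' by simp
      ultimately show False using descent_quartic_neg1[OF Me(1) M0 \<open>e \<noteq> 0\<close>] by metis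
    next
      assume "g = 3"
      then have a': "a = - 3 * M^2" using a True by simp
      have "3 * ((5 * e^2 - M^2) * (e^2 + 3 * M^2)) = 3 * N^2"
        using W \<open>g = 3\<close> True unfolding a' by (simp add: algebra_simps)
      then have "(5 * e^2 - M^2) * (e^2 + 3 * M^2) = N^2" by simp
      moreover have "5 * e^2 \<noteq> M^2" using nz'(2) a' by simp
      ultimately have "e^2 = M^2" using descent_quartic_5[OF Me(2) \<open>e \<noteq> 0\<close> M0] by metis
      then show False using xM \<open>e \<noteq> 0\<close> M0 \<open>g = 3\<close> True not by simp
    next
      assume "g = 5"
      then have a': "a = - 5 * M^2" using a True by simp
      have "5 * ((3 * e^2 - M^2) * (5 * M^2 + e^2)) = 5 * N^2"
        using W \<open>g = 5\<close> True unfolding a' by (simp add: algebra_simps)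
      then have "(3 * e^2 - M^2) * (5 * M^2 + e^2) = N^2" by simp
      moreover have "3 * e^2 \<noteq> M^2" using nz'(2) a' by simp
      ultimately show False using descent_quartic_neg5[OF Me(1) M0 \<open>e \<noteq> 0\<close>] by metis
    next
      assume "g = 15"
      then have a': "a = - 15 * M^2" using a True by simp
      have "15 * ((e^2 - M^2) * (e^2 + 15 * M^2)) = 15 * N^2"
        using W \<open>g = 15\<close> True unfolding a' by (simp add: algebra_simps)
      then have "(e^2 - M^2) * (e^2 + 15 * M^2) = N^2" by simp
      moreover have "e^2 \<noteq> M^2" using nz'(2) a' by simp
      ultimately show False using descent_quartic_1[OF Me(2) \<open>e \<noteq> 0\<close> M0] by metis
    qed
  qed
qed

text \<open>
  The quartic is the 3-division polynomial of \<open>y\<^sup>2 + (1 - t) x y - t y = x\<^sup>3 - t x\<^sup>2\<close>, the Tate normal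
  form of a curve with a point of order 5.
\<close>

lemma tate_curve_rational_flex:
  fixes t x :: rat
  assumes "t \<noteq> 0"
    and eq: "3 * x^4 + (t^2 - 6 * t + 1) * x^3 + 3 * (t^2 - t) * x^2 + 3 * t^2 * x - t^3 = 0"
  shows "t \<in> {1/2, - 2, 8, - 1/8}"
proof -
  have "x \<noteq> 0" using assms by auto
  \<comment> \<open>With \<open>t = m x\<close> the quartic becomes \<open>x^3\<close> times a
    quadratic in \<open>x\<close> with discriminant \<open>(m - 1)^3 (4 m - 3) (m + 3)\<close>. Its
    being a square puts \<open>4 m - 3\<close> on \<open>Y^2 = X (X - 1) (X + 15)\<close>.\<close>
  define m where "m = t / x"
  have t: "t = m * x" using \<open>x \<noteq> 0\<close> by (simp add: m_def)
  have "m \<noteq> 0" using t assms(1) by auto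
  have "x^3 * (m^2 * x^2 + 3 * (m - 1)^2 * x - (m - 1)^3) = 0"
    using eq unfolding t by algebra
  then have q: "m^2 * x^2 + 3 * (m - 1)^2 * x - (m - 1)^3 = 0" using \<open>x \<noteq> 0\<close> by simp
  have "m \<noteq> 1" using q \<open>x \<noteq> 0\<close> by auto
  then have m1: "m - 1 \<noteq> 0" by simp
  define y where "y = 4 * (2 * m^2 * x + 3 * (m - 1)^2) / (m - 1)"
  have y: "y * (m - 1) = 4 * (2 * m^2 * x + 3 * (m - 1)^2)" using m1 by (simp add: y_def)
  have "(m - 1)^2 * ((4 * m - 3) * (4 * m - 3 - 1) * (4 * m - 3 + 15)) = (m - 1)^2 * y^2"
  proof -
    have "(m - 1)^2 * y^2 = 16 * (2 * m^2 * x + 3 * (m - 1)^2)^2" using y by algebra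
    also have "\<dots> = 16 * (m - 1)^3 * (4 * m^2 + 9 * m - 9)" using q by algebra
    finally show ?thesis by algebra
  qed
  then have "(4 * m - 3) * (4 * m - 3 - 1) * (4 * m - 3 + 15) = y^2" using m1 by simp
  then have "4 * m - 3 \<in> {0, 1, - 15, 5, - 3}" by (rule rational_points_15a)
  then have "4 * m - 3 = 0 \<or> 4 * m - 3 = - 15 \<or> 4 * m - 3 = 5"
    using \<open>m \<noteq> 0\<close> m1 by auto
  then consider "m = 3/4" | "m = - 3" | "m = 2" by (auto simp: field_simps)
  then show ?thesis
  proof cases
    case 1
    have "(6 * x + 1)^2 = 0" using q unfolding 1 by (simp add: power2_eq_square power3_eq_cube field_simps)
    then have "x = - 1/6" by (simp add: field_simps)
    then show ?thesis using t 1 by simp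
  next
    case 2
    have "(3 * x + 8)^2 = 0" using q unfolding 2 by (simp add: power2_eq_square power3_eq_cube field_simps)
    then have "3 * x = - 8" by (simp add: eq_neg_iff_add_eq_0)
    then show ?thesis using t 2 by simp
  next
    case 3
    have "(4 * x - 1) * (x + 1) = 0" using q unfolding 3 by (simp add: power2_eq_square power3_eq_cube field_simps)
    then have "4 * x = 1 \<or> x = - 1" by (auto simp: eq_neg_iff_add_eq_0)
    then have "x = 1/4 \<or> x = - 1" by auto
    then show ?thesis using t 3 by auto
  qed
qed

section \<open>Invariants\<close>

definition b2_of :: "'a::comm_ring_1 weierstrass \<Rightarrow> 'a" where
  "b2_of W = (a\<^sub>1 W)^2 + 4 * a\<^sub>2 W"

definition b4_of :: "'a::comm_ring_1 weierstrass \<Rightarrow> 'a" where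
  "b4_of W = 2 * a\<^sub>4 W + a\<^sub>1 W * a\<^sub>3 W"

definition b6_of :: "'a::comm_ring_1 weierstrass \<Rightarrow> 'a" where
  "b6_of W = (a\<^sub>3 W)^2 + 4 * a\<^sub>6 W"

definition c4_of :: "'a::comm_ring_1 weierstrass \<Rightarrow> 'a" where
  "c4_of W = (b2_of W)^2 - 24 * b4_of W"

definition c6_of :: "'a::comm_ring_1 weierstrass \<Rightarrow> 'a" where
  "c6_of W = - ((b2_of W)^3) + 36 * b2_of W * b4_of W - 216 * b6_of W"

lemma discriminant_c4_c6: "1728 * discriminant W = (c4_of W)^3 - (c6_of W)^2"
  unfolding discriminant_def Let_def c4_of_def c6_of_def b2_of_def b4_of_def b6_of_def
  by (simp add: power2_eq_square power3_eq_cube algebra_simps)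

text \<open>The conditions on \<open>a\<^sub>1\<close>, \<open>a\<^sub>2\<close>,
  \<open>a\<^sub>3\<close> determine \<open>s\<close>, \<open>r\<close>, \<open>t\<close>. Then
  \<open>c4\<close> and \<open>c6\<close> give the transformation of \<open>b4\<close> and
  \<open>b6\<close>, from which the two remaining conditions follow.\<close>

lemma rat_isomorphic_of_invariants:
  assumes u: "u \<noteq> 0" and c4: "c4_of W = u^4 * c4_of W'" and c6: "c6_of W = u^6 * c6_of W'"
  shows "rat_isomorphic W W'"
proof -
  define s where "s = (u * a\<^sub>1 W' - a\<^sub>1 W) / 2"
  define r where "r = (u^2 * a\<^sub>2 W' - a\<^sub>2 W + s * a\<^sub>1 W + s^2) / 3"
  define t where "t = (u^3 * a\<^sub>3 W' - a\<^sub>3 W - r * a\<^sub>1 W) / 2"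
  have 1: "u * a\<^sub>1 W' = a\<^sub>1 W + 2 * s" by (simp add: s_def field_simps)
  have 2: "u^2 * a\<^sub>2 W' = a\<^sub>2 W - s * a\<^sub>1 W + 3 * r - s^2" by (simp add: r_def field_simps)
  have 3: "u^3 * a\<^sub>3 W' = a\<^sub>3 W + r * a\<^sub>1 W + 2 * t" by (simp add: t_def field_simps)
  have b2: "u^2 * b2_of W' = b2_of W + 12 * r"
    unfolding b2_of_def using 1 2 by algebra
  have "24 * (u^4 * b4_of W') = (u^2 * b2_of W')^2 - u^4 * c4_of W'"
    unfolding c4_of_def by algebra
  also have "\<dots> = 24 * (b4_of W + r * b2_of W + 6 * r^2)"
    unfolding b2 c4[symmetric] unfolding c4_of_def by algebra
  finally have b4: "u^4 * b4_of W' = b4_of W + r * b2_of W + 6 * r^2" by simp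
  have "216 * (u^6 * b6_of W') = - ((u^2 * b2_of W')^3) + 36 * (u^2 * b2_of W') * (u^4 * b4_of W') - u^6 * c6_of W'"
    unfolding c6_of_def by algebra
  also have "\<dots> = 216 * (b6_of W + 2 * r * b4_of W + r^2 * b2_of W + 4 * r^3)"
    unfolding b2 b4 c6[symmetric] unfolding c6_of_def by algebra
  finally have b6: "u^6 * b6_of W' = b6_of W + 2 * r * b4_of W + r^2 * b2_of W + 4 * r^3" by simp
  have "2 * (u^4 * a\<^sub>4 W') = u^4 * b4_of W' - (u * a\<^sub>1 W') * (u^3 * a\<^sub>3 W')"
    unfolding b4_of_def by algebra
  also have "\<dots> = 2 * (a\<^sub>4 W - s * a\<^sub>3 W + 2 * r * a\<^sub>2 W - (t + r * s) * a\<^sub>1 W + 3 * r^2 - 2 * s * t)"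
    unfolding b4 1 3 unfolding b4_of_def b2_of_def by algebra
  finally have 4: "u^4 * a\<^sub>4 W' = a\<^sub>4 W - s * a\<^sub>3 W + 2 * r * a\<^sub>2 W - (t + r * s) * a\<^sub>1 W + 3 * r^2 - 2 * s * t"
    by simp
  have "4 * (u^6 * a\<^sub>6 W') = u^6 * b6_of W' - (u^3 * a\<^sub>3 W')^2"
    unfolding b6_of_def by algebra
  also have "\<dots> = 4 * (a\<^sub>6 W + r * a\<^sub>4 W + r^2 * a\<^sub>2 W + r^3 - t * a\<^sub>3 W - t^2 - r * t * a\<^sub>1 W)"
    unfolding b6 3 unfolding b6_of_def b4_of_def b2_of_def by algebra
  finally have 6: "u^6 * a\<^sub>6 W' = a\<^sub>6 W + r * a\<^sub>4 W + r^2 * a\<^sub>2 W + r^3 - t * a\<^sub>3 W - t^2 - r * t * a\<^sub>1 W"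
    by simp
  show ?thesis unfolding rat_isomorphic_def using u 1 2 3 4 6 by blast
qed

text \<open>The invariants of the Tate normal form \<open>y\<^sup>2 + (1 - t) x y - t y = x\<^sup>3 - t x\<^sup>2\<close>.\<close>

definition tate_c4 :: "'a::comm_ring_1 \<Rightarrow> 'a" where
  "tate_c4 t = t^4 - 12 * t^3 + 14 * t^2 + 12 * t + 1"

definition tate_c6 :: "'a::comm_ring_1 \<Rightarrow> 'a" where
  "tate_c6 t = - (t^2 + 1) * (t^4 - 18 * t^3 + 74 * t^2 + 18 * t + 1)"

text \<open>\<open>J\<close> below is the j-invariant. Its rationality bounds the degree of
  \<open>h\<close>, but two steps need the finer information that \<open>u^4 * tate_c4 t\<close> and
  \<open>u^6 * tate_c6 t\<close> are rational: the exclusion of \<open>t^2 = -1\<close>, and the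
  passage from rational \<open>h\<close> to rational \<open>t\<close>.\<close>

lemma tate_parameter_rational:
  fixes t u :: "'k::field_char_0"
  assumes deg: "degree_over_rat TYPE('k) = 6"
    and u: "u \<noteq> 0" and t0: "t \<noteq> 0"
    and e4: "of_rat e4 = u^4 * tate_c4 t" and e6: "of_rat e6 = u^6 * tate_c6 t"
    and disc: "e4^3 \<noteq> e6^2"
  obtains t' k where "t = of_rat t'" "u^2 = of_rat k"
proof -
  define h where "h = t - 1 / t - 11"
  have "t * h = t * t - 1 - 11 * t" using t0 by (simp add: h_def algebra_simps)
  then have t2: "t^2 = (h + 11) * t + 1" by algebra
  have c4h: "tate_c4 t = t^2 * (h^2 + 10 * h + 5)"
    unfolding tate_c4_def using t2 by algebra
  have c6h: "tate_c6 t = - (t^2 + 1) * t^2 * (h^2 + 4 * h - 1)"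
    unfolding tate_c6_def using t2 by algebra
  have d1728: "(tate_c4 t)^3 - (tate_c6 t)^2 = 1728 * t^6 * h"
    unfolding tate_c4_def tate_c6_def using t2 by algebra
  define d where "d = e4^3 - e6^2"
  have "d \<noteq> 0" using disc by (simp add: d_def)
  have d: "of_rat d = 1728 * u^12 * t^6 * h"
  proof -
    have "of_rat d = (of_rat e4)^3 - (of_rat e6 :: 'k)^2" by (simp add: d_def of_rat_simps)
    also have "\<dots> = u^12 * ((tate_c4 t)^3 - (tate_c6 t)^2)" unfolding e4 e6 by algebra
    finally show ?thesis unfolding d1728 by algebra
  qed
  define J where "J = 1728 * e4^3 / d"
  have Jd: "of_rat J * of_rat d = 1728 * (of_rat e4 :: 'k)^3"
    using \<open>d \<noteq> 0\<close> by (simp add: J_def of_rat_simps)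
  have "of_rat d * ((h^2 + 10 * h + 5)^3) = of_rat d * (of_rat J * h)"
  proof -
    have "of_rat d * (of_rat J * h) = 1728 * (of_rat e4)^3 * h" using Jd by algebra
    also have "\<dots> = 1728 * u^12 * t^6 * h * (h^2 + 10 * h + 5)^3" unfolding e4 c4h by algebra
    finally show ?thesis unfolding d by (rule sym)
  qed
  then have J: "(h^2 + 10 * h + 5)^3 = of_rat J * h"
    using \<open>d \<noteq> 0\<close> by (metis mult_left_cancel of_rat_eq_0_iff)
  show thesis
  proof (rule degree_six_cases[OF deg, of h])
    fix s p assume hq: "h \<notin> \<rat>" "h * h = of_rat s * h - of_rat p"
    have ti: "t^2 = - 1" by (rule hauptmodul_not_quadratic[OF deg t2 J hq])
    have "t \<notin> \<rat>"
    proof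
      assume "t \<in> \<rat>"
      then have "h \<in> \<rat>" unfolding h_def by (intro Rats_diff Rats_divide) auto
      then show False using hq(1) by simp
    qed
    \<comment> \<open>\<open>2 t - 1\<close> has norm 5 and \<open>u^2\<close> lies in the field of
      \<open>t\<close>; a rational \<open>u^4 * (2 t - 1)\<close> would again make 5 a
      square.\<close>
    have c4t: "tate_c4 t = 12 * (2 * t - 1)" unfolding tate_c4_def using ti by algebra
    have "60 * (u^2 * u^2) = - of_rat e4 * (2 * t + 1)"
      unfolding e4 c4t using ti by algebra
    then have u4: "u^2 * u^2 = of_rat (- e4 / 60) + of_rat (- e4 / 30) * t + u^2 * (of_rat 0 + of_rat 0 * t)"
      by (simp add: of_rat_simps field_simps)
    have "t * t = of_rat 0 * t - of_rat 1" using ti by (simp add: power2_eq_square)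
    then obtain f g where fg: "u^2 = of_rat f + of_rat g * t"
      using quadratic_over_quadratic[OF deg \<open>t \<notin> \<rat>\<close> _ u4] by metis
    have "of_rat (f^2 - g^2) + of_rat (2 * f * g) * t = u^2 * u^2"
      unfolding fg of_rat_simps of_rat_numeral_eq using ti by algebra
    also have "\<dots> = of_rat (- e4 / 60) + of_rat (- e4 / 30) * t" unfolding u4 by simp
    finally have "of_rat (f^2 - g^2) + of_rat (2 * f * g) * t = of_rat (- e4 / 60) + of_rat (- e4 / 30) * t" .
    note q = rat_indep2[OF \<open>t \<notin> \<rat>\<close> this]
    then have "f^2 - g^2 = f * g" by simp
    then have "(2 * f - g)^2 = 5 * g^2" by algebra
    then have "2 * f - g = 0" "g = 0" by (rule rat_square_5)+
    then have "u^2 = 0" using fg by simp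
    then show thesis using u by simp
  next
    fix p q r assume "evalq [:r, q, p, 1:] h = 0" "\<And>f. evalq f h = 0 \<Longrightarrow> [:r, q, p, 1:] dvd f"
    then show thesis using hauptmodul_not_cubic[OF deg J] by blast
  next
    fix p assume "\<And>f. evalq f h = 0 \<Longrightarrow> degree f < 6 \<Longrightarrow> f = 0" "rat_vs.dim (adjoin h) = 6"
    then show thesis using hauptmodul_not_sextic[OF deg t2 J] by blast
  next
    fix h' assume h': "h = of_rat h'"
    define v where "v = h' + 11"
    have tv: "t^2 = of_rat v * t + 1" using t2 by (simp add: v_def h' of_rat_simps)
    define p where "p = h'^2 + 10 * h' + 5"
    define q where "q = h'^2 + 4 * h' - 1"
    \<comment> \<open>The discriminants 80 and 20 of \<open>p\<close> and \<open>q\<close> as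
      polynomials in \<open>h'\<close> are 5 times squares, so neither has a rational zero. Hence
      \<open>e4\<close> and \<open>e6\<close> are nonzero and may be divided.\<close>
    have "p \<noteq> 0"
    proof
      assume "p = 0"
      then have "(h' + 5)^2 = 5 * 2^2" unfolding p_def by (simp add: power2_eq_square algebra_simps)
      then show False using rat_square_5(2) by fastforce
    qed
    have "q \<noteq> 0"
    proof
      assume "q = 0"
      then have "(h' + 2)^2 = 5 * 1^2" unfolding q_def by (simp add: power2_eq_square algebra_simps)
      then show False using rat_square_5(2) by fastforce
    qed
    have c4p: "tate_c4 t = t^2 * of_rat p" unfolding c4h h' p_def by (simp add: of_rat_simps)
    have c6q: "tate_c6 t = - (t^2 + 1) * t^2 * of_rat q" unfolding c6h h' q_def by (simp add: of_rat_simps)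
    have "t^2 + 1 \<noteq> 0"
    proof
      assume *: "t^2 + 1 = 0"
      then have vt: "of_rat v * t = - 2" using tv by algebra
      then have "v \<noteq> 0" by auto
      then have "t = of_rat (- 2 / v)" using vt by (simp add: of_rat_simps field_simps)
      then have "of_rat ((2 / v)^2 + 1) = (0 :: 'k)" using * by (simp add: of_rat_simps)
      then have "(2 / v)^2 + 1 = 0" by (simp only: of_rat_eq_0_iff)
      moreover have "(2 / v)^2 + 1 > 0" by (rule add_nonneg_pos) simp_all
      ultimately show False by simp
    qed
    have "- (t^2 + 1) \<noteq> 0" using \<open>t^2 + 1 \<noteq> 0\<close> by (metis neg_equal_0_iff_equal)
    then have "of_rat e4 \<noteq> (0 :: 'k)" "of_rat e6 \<noteq> (0 :: 'k)"
      unfolding e4 e6 c4p c6q using u t0 \<open>p \<noteq> 0\<close> \<open>q \<noteq> 0\<close>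
      by (auto simp only: mult_eq_0_iff power_eq_0_iff of_rat_eq_0_iff)
    then have e0: "e4 \<noteq> 0" "e6 \<noteq> 0" by simp_all
    define r where "r = - e6 * p / (e4 * q)"
    have "r \<noteq> 0" using e0 \<open>p \<noteq> 0\<close> by (simp add: r_def \<open>q \<noteq> 0\<close>)
    have "of_rat r * (of_rat e4 * of_rat q) = - of_rat e6 * (of_rat p :: 'k)"
      using e0 \<open>q \<noteq> 0\<close> by (simp add: r_def of_rat_simps)
    then have "(u^4 * t^2 * of_rat p * of_rat q) * (u^2 * (t^2 + 1)) = (u^4 * t^2 * of_rat p * of_rat q) * of_rat r"
      unfolding e4 e6 c4p c6q by algebra
    then have ut: "u^2 * (t^2 + 1) = of_rat r" using u t0 \<open>p \<noteq> 0\<close> \<open>q \<noteq> 0\<close> by simp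
    have "t \<in> \<rat>"
    proof (rule ccontr)
      assume "t \<notin> \<rat>"
      have v4: "v^2 + 4 > 0" by (rule add_nonneg_pos) simp_all
      define k where "k = r / (v^2 + 4)"
      have kv: "k * (v^2 + 4) = r" using v4 by (simp add: k_def)
      have "k \<noteq> 0" using kv \<open>r \<noteq> 0\<close> by auto
      \<comment> \<open>\<open>v^2 + 2 - v t\<close> is the conjugate of \<open>t^2 + 1\<close>, and
        their product \<open>v^2 + 4\<close> is the discriminant of \<open>t\<close>. Since
        \<open>u^2\<close> is \<open>k\<close> times this conjugate and \<open>u\<close> lies in the
        field of \<open>t\<close>, the norm makes \<open>v^2 + 4\<close> a square.\<close>
      have "of_rat (v^2 + 4) * (u * u) = of_rat (v^2 + 4) * (of_rat k * (of_rat (v^2 + 2) - of_rat v * t))"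
      proof -
        have "(of_rat (v^2 + 2) - of_rat v * t) * (t^2 + 1) = of_rat (v^2 + 4)"
          unfolding of_rat_simps of_rat_numeral_eq using tv by algebra
        then have "of_rat (v^2 + 4) * (u * u) = ((of_rat (v^2 + 2) - of_rat v * t) * (t^2 + 1)) * (u * u)"
          by simp
        also have "\<dots> = u^2 * (t^2 + 1) * (of_rat (v^2 + 2) - of_rat v * t)"
          by (simp only: power2_eq_square mult_ac)
        also have "\<dots> = of_rat (k * (v^2 + 4)) * (of_rat (v^2 + 2) - of_rat v * t)"
          unfolding ut kv ..
        finally show ?thesis by (simp add: of_rat_mult)
      qed
      then have uu: "u * u = of_rat k * (of_rat (v^2 + 2) - of_rat v * t)"
        using v4 by (metis less_irrefl mult_left_cancel of_rat_eq_0_iff)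
      then have "u * u = of_rat (k * (v^2 + 2)) + of_rat (- k * v) * t + u * (of_rat 0 + of_rat 0 * t)"
        by (simp add: of_rat_simps algebra_simps)
      moreover have "t * t = of_rat v * t - of_rat (- 1)" using tv by (simp add: power2_eq_square of_rat_minus)
      ultimately obtain f g where fg: "u = of_rat f + of_rat g * t"
        using quadratic_over_quadratic[OF deg \<open>t \<notin> \<rat>\<close>] by metis
      have "of_rat (f^2 + g^2) + of_rat (2 * f * g + g^2 * v) * t = u * u"
        unfolding fg of_rat_simps of_rat_numeral_eq using tv by algebra
      also have "\<dots> = of_rat (k * (v^2 + 2)) + of_rat (- k * v) * t"
        unfolding uu by (simp add: of_rat_simps algebra_simps)
      finally have "of_rat (f^2 + g^2) + of_rat (2 * f * g + g^2 * v) * t = of_rat (k * (v^2 + 2)) + of_rat (- k * v) * t" .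
      note q = rat_indep2[OF \<open>t \<notin> \<rat>\<close> this]
      define s where "s = (f^2 + f * g * v - g^2) / k"
      have "(f^2 + f * g * v - g^2)^2 = k^2 * (v^2 + 4)" using q by algebra
      then have s: "s^2 = v^2 + 4" using \<open>k \<noteq> 0\<close> by (simp add: s_def power_divide)
      have "(2 * t - of_rat v - of_rat s) * (2 * t - of_rat v + of_rat s) = of_rat (v^2 + 4 - s^2)"
        unfolding of_rat_simps of_rat_numeral_eq using tv by algebra
      then have "2 * t - of_rat v - of_rat s = 0 \<or> 2 * t - of_rat v + of_rat s = 0" using s by simp
      then have "t = of_rat ((v + s) / 2) \<or> t = of_rat ((v - s) / 2)"
        by (auto simp: of_rat_simps field_simps)
      then show False using \<open>t \<notin> \<rat>\<close> by auto
    qed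
    then obtain t' where t': "t = of_rat t'" by (elim Rats_cases)
    have "u^2 = of_rat (r / (t'^2 + 1))"
      using ut \<open>t^2 + 1 \<noteq> 0\<close> unfolding t' by (simp add: of_rat_simps field_simps)
    then show thesis using t' that by blast
  qed
qed

text \<open>Since \<open>K\<close> is quadratic over the field of \<open>\<theta>\<close>, the cubic
  acquires a root in that field. An irrational such root generates the pure cubic field, so the
  discriminant \<open>- (4 p^3 + 27 q^2)\<close> must be -3 times a square.\<close>

lemma cubic_root_over_pure_cubic:
  fixes \<theta> \<alpha> :: "'k::field_char_0"
  assumes deg: "degree_over_rat TYPE('k) = 6"
    and th: "\<theta>^3 = of_rat C" and noncube: "\<And>w. w^3 \<noteq> C"
    and al: "\<alpha>^3 + of_rat p * \<alpha> + of_rat q = 0"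
  obtains x where "x^3 + p * x + q = 0" | w where "4 * p^3 + 27 * q^2 = 3 * w^2"
proof -
  have evth: "evalq [:- C, 0, 0, 1:] \<theta> = 0"
    using th by (simp add: of_rat_minus power3_eq_cube mult.assoc)
  have "(\<forall>f. evalq f \<theta> = 0 \<longrightarrow> [:- C, 0, 0, 1:] dvd f) \<and> rat_vs.dim (adjoin \<theta>) = 3"
  proof (rule degree_six_cases[OF deg, of \<theta>])
    fix a assume "\<theta> = of_rat a"
    then have "of_rat (a^3) = (of_rat C :: 'k)" using th by (simp add: of_rat_power)
    then have "a^3 = C" by (simp only: of_rat_eq_iff)
    then show ?thesis using noncube by blast
  next
    fix s m assume q: "\<theta> \<notin> \<rat>" "\<theta> * \<theta> = of_rat s * \<theta> - of_rat m"
    have "of_rat C + of_rat 0 * \<theta> = of_rat (- s * m) + of_rat (s^2 - m) * \<theta>"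
      unfolding of_rat_simps of_rat_0 th[symmetric] using q(2) by algebra
    note e = rat_indep2[OF q(1) this]
    then have "(- s)^3 = C" by algebra
    then show ?thesis using noncube by blast
  next
    fix a b c assume m: "\<And>f. evalq f \<theta> = 0 \<Longrightarrow> [:c, b, a, 1:] dvd f" and dim: "rat_vs.dim (adjoin \<theta>) = 3"
    have "[:c, b, a, 1:] dvd [:- C, 0, 0, 1:]" by (rule m[OF evth])
    then obtain k where k: "[:- C, 0, 0, 1:] = [:c, b, a, 1:] * k" by (elim dvdE)
    then have "k \<noteq> 0" by auto
    then have "degree [:- C, 0, 0, 1:] = 3 + degree k" unfolding k by (subst degree_mult_eq) auto
    then have "degree k = 0" by simp
    then obtain k0 where "k = [:k0:]" using degree_eq_zeroE by blast
    then have "[:c, b, a, 1:] = [:- C, 0, 0, 1:]" using k by auto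
    then show ?thesis using m dim by simp
  next
    fix m assume "\<And>f. evalq f \<theta> = 0 \<Longrightarrow> degree f < 6 \<Longrightarrow> f = 0"
    from this[OF evth] show ?thesis by simp
  qed
  then have min: "\<And>f. evalq f \<theta> = 0 \<Longrightarrow> [:- C, 0, 0, 1:] dvd f" and dim: "rat_vs.dim (adjoin \<theta>) = 3"
    by blast+
  have deg0: "degree_over_rat TYPE('k) > 0" using deg by simp
  note sub = adjoin_subalgebra[of \<theta>]
  obtain B D where BD: "\<alpha> * \<alpha> = B + \<alpha> * D" "B \<in> adjoin \<theta>" "D \<in> adjoin \<theta>"
    using quadratic_over_cubic_subalgebra[OF deg sub dim] .
  \<comment> \<open>The remainder of the cubic modulo \<open>X^2 - D X - B\<close>. If it vanishes,
    the third root is \<open>- D\<close>; otherwise \<open>\<alpha>\<close> itself lies in the field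
    of \<open>\<theta>\<close>.\<close>
  have lin: "(B + D * D + of_rat p) * \<alpha> = - (D * B + of_rat q)"
    using al BD(1) by algebra
  obtain g where g: "g \<in> adjoin \<theta>" "g^3 + of_rat p * g + of_rat q = 0"
  proof (cases "B + D * D + of_rat p = 0")
    case True
    then have "D * B + of_rat q = 0" using lin by algebra
    then have "(- D)^3 + of_rat p * (- D) + of_rat q = 0" using True by algebra
    moreover have "of_rat (- 1) * D \<in> adjoin \<theta>"
      using subalgebra_mult[OF sub subalgebra_of_rat[OF sub] BD(3)] .
    then have "- D \<in> adjoin \<theta>" by (simp add: of_rat_minus)
    ultimately show thesis by (intro that)
  next
    case False
    then have "\<alpha> = (of_rat (- 1) * (D * B + of_rat q)) / (B + D * D + of_rat p)"
      using lin by (simp add: of_rat_minus field_simps)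
    moreover have "(of_rat (- 1) * (D * B + of_rat q)) / (B + D * D + of_rat p) \<in> adjoin \<theta>"
      by (intro subalgebra_divide[OF deg0 sub] subalgebra_add[OF sub] subalgebra_mult[OF sub]
          subalgebra_of_rat[OF sub] BD)
    ultimately show thesis using al that by simp
  qed
  obtain z where "g = cubic_eval \<theta> z" using cubic_adjoin[OF evth g(1)] .
  moreover obtain a b d where "z = (a, b, d)" by (metis surj_pair)
  ultimately have gz: "g = of_rat a + of_rat b * \<theta> + of_rat d * \<theta>^2" by (simp add: cubic_eval_def)
  define r0 where "r0 = a^3 + b^3 * C + d^3 * C^2 + 6 * a * b * d * C + p * a + q"
  define r1 where "r1 = 3 * a^2 * b + 3 * b^2 * d * C + 3 * a * d^2 * C + p * b"
  define r2 where "r2 = 3 * a^2 * d + 3 * a * b^2 + 3 * b * d^2 * C + p * d"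
  have "cubic_eval \<theta> (r0, r1, r2) = g^3 + of_rat p * g + of_rat q"
    unfolding cubic_eval_def split_conv r0_def r1_def r2_def gz of_rat_simps of_rat_numeral_eq
      th[symmetric]
    by algebra
  also have "\<dots> = cubic_eval \<theta> (0, 0, 0)" using g(2) by (simp add: cubic_eval_def)
  finally have "(r0, r1, r2) = (0, 0, 0)" by (rule cubic_eval_inj[rotated]) (rule min)
  then have r: "r0 = 0" "r1 = 0" "r2 = 0" by simp_all
  have C0: "C \<noteq> 0" using noncube[of 0] by auto
  show thesis
  proof (cases "b = 0 \<and> d = 0")
    case True
    then have "a^3 + p * a + q = 0" using r(1) by (simp add: r0_def)
    then show thesis by (rule that(1))
  next
    case False
    \<comment> \<open>For irrational \<open>g\<close>, \<open>3 a\<close> is its trace, which is 0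
      as the cubic has no square term.\<close>
    have "a = 0"
    proof (rule ccontr)
      assume "a \<noteq> 0"
      have "3 * a * (d^3 * C - b^3) = d * r1 - b * r2" unfolding r1_def r2_def by algebra
      then have *: "d^3 * C = b^3" using r \<open>a \<noteq> 0\<close> by simp
      show False
      proof (cases "d = 0")
        case True
        then show False using * False by simp
      next
        case False
        then have "(b / d)^3 = C" using * by (simp add: power_divide field_simps)
        then show False using noncube by blast
      qed
    qed
    then have "b * (3 * b * d * C + p) = 0" "d * (3 * b * d * C + p) = 0" and q: "q = - (b^3 * C + d^3 * C^2)"
      using r unfolding r0_def r1_def r2_def by (simp_all add: power2_eq_square algebra_simps eq_neg_iff_add_eq_0)
    then have "3 * b * d * C + p = 0" using False by auto
    then have "4 * p^3 + 27 * q^2 = 3 * (3 * C * (b^3 - d^3 * C))^2"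
      using q by algebra
    then show thesis by (rule that(2))
  qed
qed

section \<open>The chord-tangent law\<close>

fun ec_neg :: "'a::field weierstrass \<Rightarrow> 'a ec_point \<Rightarrow> 'a ec_point" where
  "ec_neg W Infty = Infty"
| "ec_neg W (Affine x y) = Affine x (- y - a\<^sub>1 W * x - a\<^sub>3 W)"

lemma affine_in_ec_points [simp]:
  "Affine x y \<in> ec_points W \<longleftrightarrow> y\<^sup>2 + a\<^sub>1 W * x * y + a\<^sub>3 W * y = x^3 + a\<^sub>2 W * x^2 + a\<^sub>4 W * x + a\<^sub>6 W"
  and infty_in_ec_points [simp]: "Infty \<in> ec_points W"
  by (auto simp: ec_points_def)

lemma ec_add_infty_right [simp]: "ec_add W P Infty = P"
  by (cases P) simp_all

lemma ec_points_same_abscissa: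
  assumes "Affine x y1 \<in> ec_points W" "Affine x y2 \<in> ec_points W" "y1 + y2 + a\<^sub>1 W * x + a\<^sub>3 W \<noteq> 0"
  shows "y1 = y2"
proof -
  have "(y1 - y2) * (y1 + y2 + a\<^sub>1 W * x + a\<^sub>3 W) = 0"
    using assms(1,2) by simp algebra
  then show ?thesis using assms(3) by simp
qed

lemma ec_add_chord:
  assumes "x1 \<noteq> x2" "l = (y2 - y1) / (x2 - x1)" "x3 = l^2 + a\<^sub>1 W * l - a\<^sub>2 W - x1 - x2"
  shows "ec_add W (Affine x1 y1) (Affine x2 y2) = Affine x3 (- (l + a\<^sub>1 W) * x3 - (y1 - l * x1) - a\<^sub>3 W)"
  using assms by (simp add: Let_def)

lemma ec_add_tangent:
  assumes "2 * y + a\<^sub>1 W * x + a\<^sub>3 W \<noteq> 0"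
    and "l = (3 * x^2 + 2 * a\<^sub>2 W * x + a\<^sub>4 W - a\<^sub>1 W * y) / (2 * y + a\<^sub>1 W * x + a\<^sub>3 W)"
    and "x3 = l^2 + a\<^sub>1 W * l - a\<^sub>2 W - x - x"
  shows "ec_add W (Affine x y) (Affine x y) = Affine x3 (- (l + a\<^sub>1 W) * x3 - (y - l * x) - a\<^sub>3 W)"
proof -
  have "y + y + a\<^sub>1 W * x + a\<^sub>3 W \<noteq> 0" using assms(1) by (simp flip: mult_2)
  then show ?thesis using assms(2,3) by (simp add: Let_def)
qed

lemma ec_neg_in_points: "P \<in> ec_points W \<Longrightarrow> ec_neg W P \<in> ec_points W"
  by (cases P) (auto simp: power2_eq_square algebra_simps)

lemma ec_add_neg_neg:
  assumes "P \<in> ec_points W" "Q \<in> ec_points W"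
  shows "ec_add W (ec_neg W P) (ec_neg W Q) = ec_neg W (ec_add W P Q)"
proof (cases P; cases Q)
  fix x1 y1 x2 y2 assume PQ: "P = Affine x1 y1" "Q = Affine x2 y2"
  let ?A = "a\<^sub>1 W" and ?B = "a\<^sub>3 W"
  consider (chord) "x1 \<noteq> x2" | (opp) "x1 = x2" "y1 + y2 + ?A * x2 + ?B = 0"
    | (tangent) "x1 = x2" "y1 = y2" "2 * y1 + ?A * x1 + ?B \<noteq> 0"
    using ec_points_same_abscissa assms unfolding PQ by (metis mult_2)
  then show ?thesis
  proof cases
    case chord
    define l where "l = (y2 - y1) / (x2 - x1)"
    have "- (l + ?A) = ((- y2 - ?A * x2 - ?B) - (- y1 - ?A * x1 - ?B)) / (x2 - x1)"
      using chord by (simp add: l_def field_simps)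
    note neg = ec_add_chord[OF chord this refl]
    show ?thesis
      unfolding PQ ec_neg.simps neg ec_add_chord[OF chord l_def refl] ec_point.inject
      by (simp add: power2_eq_square algebra_simps)
  next
    case opp
    have "- y1 - ?A * x1 - ?B + (- y2 - ?A * x2 - ?B) + ?A * x2 + ?B = - (y1 + y2 + ?A * x2 + ?B)"
      unfolding opp(1) by simp
    then have "- y1 - ?A * x1 - ?B + (- y2 - ?A * x2 - ?B) + ?A * x2 + ?B = 0" unfolding opp(2) by simp
    then show ?thesis unfolding PQ using opp by simp
  next
    case tangent
    define m where "m = 2 * y1 + ?A * x1 + ?B"
    define n where "n = 3 * x1^2 + 2 * a\<^sub>2 W * x1 + a\<^sub>4 W - ?A * y1"
    define l where "l = n / m"
    have "m \<noteq> 0" using tangent by (simp add: m_def)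
    have den: "2 * (- y1 - ?A * x1 - ?B) + ?A * x1 + ?B = - m" by (simp add: m_def)
    have num: "3 * x1^2 + 2 * a\<^sub>2 W * x1 + a\<^sub>4 W - ?A * (- y1 - ?A * x1 - ?B) = n + ?A * m"
      unfolding m_def n_def by algebra
    have nz: "2 * (- y1 - ?A * x1 - ?B) + ?A * x1 + ?B \<noteq> 0" unfolding den using \<open>m \<noteq> 0\<close> by simp
    have slope: "- (l + ?A) = (3 * x1^2 + 2 * a\<^sub>2 W * x1 + a\<^sub>4 W - ?A * (- y1 - ?A * x1 - ?B))
        / (2 * (- y1 - ?A * x1 - ?B) + ?A * x1 + ?B)"
      unfolding num den using \<open>m \<noteq> 0\<close> by (simp add: l_def field_simps)
    show ?thesis
      unfolding PQ tangent(1,2)[symmetric] ec_neg.simps ec_add_tangent[OF nz slope refl]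
        ec_add_tangent[OF tangent(3) l_def[unfolded m_def n_def] refl] ec_point.inject
      by (simp add: power2_eq_square algebra_simps)
  qed
qed simp_all

text \<open>The substitution \<open>x = x' + r\<close>, \<open>y = y' + s x' + t\<close>, without
  scaling. It serves to move a given point to the origin and to tilt its tangent.\<close>

definition ec_shift :: "'a::field \<Rightarrow> 'a \<Rightarrow> 'a \<Rightarrow> 'a weierstrass \<Rightarrow> 'a weierstrass" where
  "ec_shift r s t W = \<lparr>a\<^sub>1 = a\<^sub>1 W + 2 * s, a\<^sub>2 = a\<^sub>2 W - s * a\<^sub>1 W + 3 * r - s^2, a\<^sub>3 = a\<^sub>3 W + r * a\<^sub>1 W + 2 * t,
     a\<^sub>4 = a\<^sub>4 W - s * a\<^sub>3 W + 2 * r * a\<^sub>2 W - (t + r * s) * a\<^sub>1 W + 3 * r^2 - 2 * s * t,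
     a\<^sub>6 = a\<^sub>6 W + r * a\<^sub>4 W + r^2 * a\<^sub>2 W + r^3 - t * a\<^sub>3 W - t^2 - r * t * a\<^sub>1 W\<rparr>"

fun point_shift :: "'a::field \<Rightarrow> 'a \<Rightarrow> 'a \<Rightarrow> 'a ec_point \<Rightarrow> 'a ec_point" where
  "point_shift r s t Infty = Infty"
| "point_shift r s t (Affine x y) = Affine (x - r) (y - s * (x - r) - t)"

lemma point_shift_inj: "point_shift r s t P = point_shift r s t Q \<longleftrightarrow> P = Q"
  by (cases P; cases Q) auto

lemma point_shift_in_points: "point_shift r s t P \<in> ec_points (ec_shift r s t W) \<longleftrightarrow> P \<in> ec_points W"
proof (cases P)
  case (Affine x y)
  let ?x = "x - r" and ?y = "y - s * (x - r) - t" and ?W = "ec_shift r s t W"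
  have "(?y^2 + a\<^sub>1 ?W * ?x * ?y + a\<^sub>3 ?W * ?y) - (?x^3 + a\<^sub>2 ?W * ?x^2 + a\<^sub>4 ?W * ?x + a\<^sub>6 ?W)
      = (y^2 + a\<^sub>1 W * x * y + a\<^sub>3 W * y) - (x^3 + a\<^sub>2 W * x^2 + a\<^sub>4 W * x + a\<^sub>6 W)"
    unfolding ec_shift_def weierstrass.simps by algebra
  then show ?thesis unfolding Affine point_shift.simps affine_in_ec_points by (rule diff_eq_diff_eq)
qed simp

lemma point_shift_add:
  assumes "P \<in> ec_points W" "Q \<in> ec_points W"
  shows "point_shift r s t (ec_add W P Q) = ec_add (ec_shift r s t W) (point_shift r s t P) (point_shift r s t Q)"
proof (cases P; cases Q)
  fix x1 y1 x2 y2 assume PQ: "P = Affine x1 y1" "Q = Affine x2 y2"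
  let ?A = "a\<^sub>1 W" and ?B = "a\<^sub>3 W" and ?W = "ec_shift r s t W"
  consider (chord) "x1 \<noteq> x2" | (opp) "x1 = x2" "y1 + y2 + ?A * x2 + ?B = 0"
    | (tangent) "x1 = x2" "y1 = y2" "2 * y1 + ?A * x1 + ?B \<noteq> 0"
    using ec_points_same_abscissa assms unfolding PQ by (metis mult_2)
  then show ?thesis
  proof cases
    case chord
    define l where "l = (y2 - y1) / (x2 - x1)"
    have "l - s = ((y2 - s * (x2 - r) - t) - (y1 - s * (x1 - r) - t)) / ((x2 - r) - (x1 - r))"
      using chord by (simp add: l_def field_simps)
    moreover have "x1 - r \<noteq> x2 - r" using chord by simp
    ultimately have shifted: "ec_add ?W (point_shift r s t P) (point_shift r s t Q)
      = (let x3 = (l - s)^2 + a\<^sub>1 ?W * (l - s) - a\<^sub>2 ?W - (x1 - r) - (x2 - r)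
         in Affine x3 (- (l - s + a\<^sub>1 ?W) * x3 - (y1 - s * (x1 - r) - t - (l - s) * (x1 - r)) - a\<^sub>3 ?W))"
      unfolding PQ point_shift.simps Let_def by (intro ec_add_chord refl)
    show ?thesis
      unfolding shifted unfolding PQ ec_add_chord[OF chord l_def refl] point_shift.simps Let_def ec_point.inject
        ec_shift_def weierstrass.simps
      by (simp add: power2_eq_square algebra_simps)
  next
    case opp
    have "(y1 - s * (x1 - r) - t) + (y2 - s * (x2 - r) - t) + a\<^sub>1 ?W * (x2 - r) + a\<^sub>3 ?W
        = y1 + y2 + ?A * x2 + ?B"
      unfolding ec_shift_def weierstrass.simps opp(1) by algebra
    then have "(y1 - s * (x1 - r) - t) + (y2 - s * (x2 - r) - t) + a\<^sub>1 ?W * (x2 - r) + a\<^sub>3 ?W = 0"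
      unfolding opp(2) .
    then show ?thesis unfolding PQ using opp by simp
  next
    case tangent
    define m where "m = 2 * y1 + ?A * x1 + ?B"
    define n where "n = 3 * x1^2 + 2 * a\<^sub>2 W * x1 + a\<^sub>4 W - ?A * y1"
    define l where "l = n / m"
    let ?x = "x1 - r" and ?y = "y1 - s * (x1 - r) - t"
    have "m \<noteq> 0" using tangent by (simp add: m_def)
    have m: "2 * ?y + a\<^sub>1 ?W * ?x + a\<^sub>3 ?W = m"
      unfolding m_def ec_shift_def weierstrass.simps by algebra
    then have nz: "2 * ?y + a\<^sub>1 ?W * ?x + a\<^sub>3 ?W \<noteq> 0" using \<open>m \<noteq> 0\<close> by simp
    have num: "3 * ?x^2 + 2 * a\<^sub>2 ?W * ?x + a\<^sub>4 ?W - a\<^sub>1 ?W * ?y = n - s * m"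
      unfolding m_def n_def ec_shift_def weierstrass.simps by algebra
    have slope: "l - s = (3 * ?x^2 + 2 * a\<^sub>2 ?W * ?x + a\<^sub>4 ?W - a\<^sub>1 ?W * ?y) / (2 * ?y + a\<^sub>1 ?W * ?x + a\<^sub>3 ?W)"
      unfolding m num using \<open>m \<noteq> 0\<close> by (simp add: l_def field_simps)
    show ?thesis
      unfolding PQ tangent(1,2)[symmetric] point_shift.simps ec_add_tangent[OF nz slope refl]
        ec_add_tangent[OF tangent(3) l_def[unfolded m_def n_def] refl] ec_point.inject
      unfolding ec_shift_def weierstrass.simps
      by (simp add: power2_eq_square algebra_simps)
  qed
qed simp_all

lemma discriminant_ec_shift:
  fixes W :: "'a::field_char_0 weierstrass"
  shows "discriminant (ec_shift r s t W) = discriminant W"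
proof -
  let ?W = "ec_shift r s t W"
  have b: "b2_of ?W = b2_of W + 12 * r" "b4_of ?W = b4_of W + r * b2_of W + 6 * r^2"
    "b6_of ?W = b6_of W + 2 * r * b4_of W + r^2 * b2_of W + 4 * r^3"
    unfolding b2_of_def b4_of_def b6_of_def ec_shift_def weierstrass.simps by algebra+
  have "c4_of ?W = c4_of W" "c6_of ?W = c6_of W"
    unfolding c4_of_def c6_of_def b by algebra+
  then have "1728 * discriminant ?W = 1728 * discriminant W"
    by (simp add: discriminant_c4_c6)
  then show ?thesis by simp
qed

text \<open>With \<open>P\<close> at the origin, a line \<open>y = l x\<close> meets the curve in
  two further abscissas with sum \<open>l^2 + a1 l - a2\<close> and product
  \<open>a4 - a3 l\<close>. Chord and tangent slopes both satisfy the product relation, which is all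
  that \<open>line\<close> asks for.\<close>

lemma ec_add_closed:
  assumes P: "P \<in> ec_points W" and Q: "Q \<in> ec_points W"
  shows "ec_add W P Q \<in> ec_points W"
proof (cases P)
  case (Affine x0 y0)
  define V where "V = ec_shift x0 0 y0 W"
  define R where "R = point_shift x0 0 y0 Q"
  let ?A = "a\<^sub>1 V" and ?B = "a\<^sub>3 V" and ?C = "a\<^sub>2 V" and ?E = "a\<^sub>4 V"
  have P': "point_shift x0 0 y0 P = Affine 0 0" by (simp add: Affine)
  have "Affine 0 0 \<in> ec_points V" using P point_shift_in_points P' V_def by metis
  then have a6: "a\<^sub>6 V = 0" by simp
  have R: "R \<in> ec_points V" using Q by (simp add: R_def V_def point_shift_in_points)
  have "ec_add V (Affine 0 0) R \<in> ec_points V"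
  proof (cases R)
    case (Affine x y)
    have eq: "y^2 + ?A * x * y + ?B * y = x^3 + ?C * x^2 + ?E * x" using R Affine a6 by simp
    have line: "Affine (l^2 + ?A * l - ?C - x) (- (l + ?A) * (l^2 + ?A * l - ?C - x) - ?B) \<in> ec_points V"
      if "x * (l^2 + ?A * l - ?C - x) + ?B * l = ?E" for l
      unfolding affine_in_ec_points a6 that[symmetric] by algebra
    consider "x \<noteq> 0" | "x = 0" "y + ?B = 0" | "x = 0" "y = 0" "?B \<noteq> 0"
    proof -
      have "x = 0 \<Longrightarrow> y * (y + ?B) = 0" using eq by (simp add: power2_eq_square algebra_simps)
      then show thesis using that by (cases "x = 0"; cases "y + ?B = 0") auto
    qed
    then show ?thesis
    proof cases
      case 1
      define l where "l = y / x"
      have y: "y = l * x" using 1 by (simp add: l_def)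
      have "x * (x * (l^2 + ?A * l - ?C - x) + ?B * l) = x * ?E" using eq unfolding y by algebra
      then have "x * (l^2 + ?A * l - ?C - x) + ?B * l = ?E" using 1 by simp
      from line[OF this] show ?thesis unfolding Affine using 1
        by (simp add: Let_def flip: l_def)
    next
      case 2
      then show ?thesis unfolding Affine by simp
    next
      case 3
      define l where "l = ?E / ?B"
      have "x * (l^2 + ?A * l - ?C - x) + ?B * l = ?E" using 3 by (simp add: l_def)
      from line[OF this] show ?thesis unfolding Affine using 3
        by (simp add: Let_def flip: l_def)
    qed
  qed (simp add: a6)
  moreover have "point_shift x0 0 y0 (ec_add W P Q) = ec_add V (Affine 0 0) R"
    unfolding point_shift_add[OF P Q] P' V_def R_def ..
  ultimately show ?thesis using point_shift_in_points V_def by metis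
qed (simp add: Q)

text \<open>The origin has a horizontal tangent, so its double is \<open>(- C, A C - B)\<close>. In
  the generic case \<open>l\<close> is the slope from \<open>Q\<close> to the origin,
  \<open>m\<close> the slope from \<open>Q\<close> to the double (the tangent slope if they
  coincide), and \<open>l * (m + A) = x\<close> makes \<open>m - l\<close> the slope of the second
  chord from \<open>Q + P\<close>.\<close>

lemma ec_add_double_normal_form:
  fixes A B C :: "'a::field"
  defines "W \<equiv> \<lparr>a\<^sub>1 = A, a\<^sub>2 = C, a\<^sub>3 = B, a\<^sub>4 = 0, a\<^sub>6 = 0\<rparr>"
  assumes B: "B \<noteq> 0" and Q: "Q \<in> ec_points W"
  shows "ec_add W Q (ec_add W (Affine 0 0) (Affine 0 0)) = ec_add W (ec_add W Q (Affine 0 0)) (Affine 0 0)"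
proof (cases Q)
  case (Affine x y)
  have W: "a\<^sub>1 W = A" "a\<^sub>2 W = C" "a\<^sub>3 W = B" "a\<^sub>4 W = 0" "a\<^sub>6 W = 0" by (simp_all add: W_def)
  have D: "ec_add W (Affine 0 0) (Affine 0 0) = Affine (- C) (A * C - B)"
    using B by (simp add: W)
  have eq: "y^2 + A * x * y + B * y = x^3 + C * x^2" using Q by (simp add: Affine W)
  consider "x = 0" "y = 0" | "x = 0" "y = - B" | "x \<noteq> 0" "y = 0" | "x \<noteq> 0" "y \<noteq> 0"
  proof -
    have "x = 0 \<Longrightarrow> y * (y + B) = 0" using eq by (simp add: power2_eq_square algebra_simps)
    then show thesis using that by (auto simp: eq_neg_iff_add_eq_0)
  qed
  then show ?thesis
  proof cases
    case 1
    show ?thesis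
    proof (cases "C = 0")
      case True
      then show ?thesis unfolding Affine D using B 1 by (simp add: W Let_def)
    next
      case False
      define k where "k = (A * C - B) / C"
      have "A * C - B = k * C" "B - A * C = - (k * C)" using False by (simp_all add: k_def)
      then show ?thesis unfolding Affine D using B 1 False by (simp add: W Let_def)
    qed
  next
    case 2
    have "- B - B + B \<noteq> 0" using B by simp
    moreover have "A * B / (- B) = - A" "A * C / C = (if C = 0 then 0 else A)" using B by simp_all
    ultimately show ?thesis unfolding Affine D using B 2 by (simp add: W Let_def power2_eq_square)
  next
    case 3
    have "x^2 * (x + C) = 0" using eq 3 by algebra
    then have "x = - C" using 3 by (simp add: eq_neg_iff_add_eq_0)
    then show ?thesis unfolding Affine D using B 3 by (simp add: W Let_def)
  next
    case 4
    define l where "l = y / x"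
    have y: "y = l * x" using 4 by (simp add: l_def)
    define m where "m = x^2 / y - A"
    have m: "(m + A) * y = x^2" using 4 by (simp add: m_def)
    define x' where "x' = l^2 + A * l - C - x"
    have "x^2 * x' = - (B * y)" using eq unfolding x'_def y by algebra
    then have "x' \<noteq> 0" using 4 B by auto
    have mx': "(m + A) * x' = - B"
    proof -
      have "y * ((m + A) * x') = y * (- B)" using m \<open>x^2 * x' = - (B * y)\<close> by algebra
      then show ?thesis using 4(2) mult_left_cancel by blast
    qed
    define y' where "y' = - (l + A) * x' - B"
    have y': "y' = (m - l) * x'" unfolding y'_def using mx' by algebra
    have QP: "ec_add W Q (Affine 0 0) = Affine x' y'"
      unfolding Affine using 4 by (simp add: W Let_def x'_def y'_def flip: l_def) (simp add: y)
    have R: "ec_add W (Affine x' y') (Affine 0 0)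
       = Affine ((m - l)^2 + A * (m - l) - C - x') (- (m - l + A) * ((m - l)^2 + A * (m - l) - C - x') - B)"
      using \<open>x' \<noteq> 0\<close> y' by (simp add: W Let_def)
    define X where "X = m^2 + A * m - x"
    have ml: "l * (m + A) = x"
    proof -
      have "x * (l * (m + A)) = x * x" using m unfolding y by algebra
      then show ?thesis using 4 by simp
    qed
    have X': "(m - l)^2 + A * (m - l) - C - x' = X" unfolding X_def x'_def ml[symmetric] by (simp add: power2_eq_square algebra_simps)
    have "l * X = m * (l * (m + A)) - l * x"
      unfolding X_def by (simp add: power2_eq_square algebra_simps)
    then have lX: "l * X = m * x - y" unfolding ml y .
    have "- (m - l + A) * X - B = - (m + A) * X + l * X - B" by (simp add: algebra_simps)
    then have Y: "- (m - l + A) * X - B = - (m + A) * X - (y - m * x) - B" unfolding lX by simp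
    have L: "ec_add W Q (Affine (- C) (A * C - B)) = Affine X (- (m + A) * X - (y - m * x) - B)"
    proof (cases "x = - C")
      case True
      have "y * (y + A * x + B) = 0" using eq True by algebra
      then have "y + A * x + B = 0" using 4(2) by (metis mult_eq_0_iff)
      then have y2: "y = A * C - B" using True by (simp add: algebra_simps)
      have n: "y + (A * C - B) + A * (- C) + B \<noteq> 0" using y2 4 by simp
      have "(3 * x^2 + 2 * C * x - A * y) / (2 * y + A * x + B) = m"
      proof -
        have den: "2 * y + A * x + B = y" using y2 True by simp
        have num: "3 * x^2 + 2 * C * x - A * y = x^2 - A * y" using True by algebra
        show ?thesis unfolding den num using 4 by (simp add: m_def diff_divide_distrib)
      qed
      then show ?thesis unfolding Affine using n True by (simp add: W Let_def X_def)
    next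
      case False
      have "x + C \<noteq> 0" using False by (simp add: eq_neg_iff_add_eq_0)
      have "m * (x + C) = y - A * C + B"
      proof -
        have "y * (m * (x + C)) = y * (y - A * C + B)" using m eq by algebra
        then show ?thesis using 4 by simp
      qed
      then have "(A * C - B - y) / (- C - x) = m"
        using \<open>x + C \<noteq> 0\<close> False by (simp add: field_simps)
      then show ?thesis unfolding Affine using False by (simp add: W Let_def X_def)
    qed
    show ?thesis unfolding D QP R L X' Y ..
  qed
qed simp

lemma ec_add_two_torsion_normal_form:
  fixes A C E :: "'a::field"
  defines "W \<equiv> \<lparr>a\<^sub>1 = A, a\<^sub>2 = C, a\<^sub>3 = 0, a\<^sub>4 = E, a\<^sub>6 = 0\<rparr>"
  assumes E: "E \<noteq> 0" and Q: "Q \<in> ec_points W"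
  shows "ec_add W (ec_add W Q (Affine 0 0)) (Affine 0 0) = Q"
proof (cases Q)
  case (Affine x y)
  have W: "a\<^sub>1 W = A" "a\<^sub>2 W = C" "a\<^sub>3 W = 0" "a\<^sub>4 W = E" "a\<^sub>6 W = 0" by (simp_all add: W_def)
  have eq: "y^2 + A * x * y = x^3 + C * x^2 + E * x" using Q by (simp add: Affine W)
  show ?thesis
  proof (cases "x = 0")
    case True
    then have "y = 0" using eq by simp
    then show ?thesis unfolding Affine using True by (simp add: W)
  next
    case False
    define l where "l = y / x"
    have y: "y = l * x" using False by (simp add: l_def)
    define x' where "x' = l^2 + A * l - C - x"
    have "x * (x * x') = x * E" using eq unfolding x'_def y by algebra
    then have "x * x' = E" using False by simp
    then have "x' \<noteq> 0" using E by auto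
    have QP: "ec_add W Q (Affine 0 0) = Affine x' (- (l + A) * x')"
      unfolding Affine using False by (simp add: W Let_def x'_def flip: l_def) (simp add: y)
    have "ec_add W (Affine x' (- (l + A) * x')) (Affine 0 0) = Affine ((l + A)^2 - A * (l + A) - C - x') (l * ((l + A)^2 - A * (l + A) - C - x'))"
    proof -
      have "- (l + A) = (0 - (- (l + A) * x')) / (0 - x')" using \<open>x' \<noteq> 0\<close> by simp
      note sum = ec_add_chord[OF \<open>x' \<noteq> 0\<close> this refl, of W]
      show ?thesis unfolding sum W ec_point.inject by (simp add: power2_eq_square algebra_simps)
    qed
    moreover have "(l + A)^2 - A * (l + A) - C - x' = x"
      unfolding x'_def by (simp add: power2_eq_square algebra_simps)
    ultimately have "ec_add W (ec_add W Q (Affine 0 0)) (Affine 0 0) = Affine x (l * x)" unfolding QP by simp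
    then show ?thesis by (simp only: Affine y[symmetric])
  qed
qed (simp add: W_def)

text \<open>\<open>P\<close> is moved to the origin. If \<open>P\<close> is not of order 2, the
  shear \<open>s\<close> makes its tangent horizontal, giving \<open>a\<^sub>4 = 0\<close>; if it
  is, then \<open>a\<^sub>3 = 0\<close>, and \<open>a\<^sub>4\<close> is nonzero because the curve
  is smooth.\<close>

lemma ec_add_double:
  fixes W :: "'a::field_char_0 weierstrass"
  assumes disc: "discriminant W \<noteq> 0" and P: "P \<in> ec_points W" and Q: "Q \<in> ec_points W"
  shows "ec_add W Q (ec_add W P P) = ec_add W (ec_add W Q P) P"
proof (cases P)
  case (Affine x0 y0)
  have transfer: ?thesis
    if V: "V = ec_shift x0 s y0 W" and "\<And>R. R \<in> ec_points V \<Longrightarrow>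
        ec_add V R (ec_add V (Affine 0 0) (Affine 0 0)) = ec_add V (ec_add V R (Affine 0 0)) (Affine 0 0)" for s V
  proof -
    have "point_shift x0 s y0 P = Affine 0 0" by (simp add: Affine)
    moreover have "point_shift x0 s y0 Q \<in> ec_points V" using Q by (simp add: V point_shift_in_points)
    ultimately have "point_shift x0 s y0 (ec_add W Q (ec_add W P P)) = point_shift x0 s y0 (ec_add W (ec_add W Q P) P)"
      using that(2) by (simp add: point_shift_add P Q ec_add_closed V)
    then show ?thesis by (simp only: point_shift_inj)
  qed
  let ?B = "2 * y0 + a\<^sub>1 W * x0 + a\<^sub>3 W"
  let ?n = "3 * x0^2 + 2 * a\<^sub>2 W * x0 + a\<^sub>4 W - a\<^sub>1 W * y0"
  have eq: "y0^2 + a\<^sub>1 W * x0 * y0 + a\<^sub>3 W * y0 = x0^3 + a\<^sub>2 W * x0^2 + a\<^sub>4 W * x0 + a\<^sub>6 W"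
    using P Affine by simp
  show ?thesis
  proof (cases "?B = 0")
    case False
    define s where "s = ?n / ?B"
    define V where "V = ec_shift x0 s y0 W"
    have "s * ?B = ?n" using False by (simp add: s_def)
    then have "a\<^sub>4 V = 0" unfolding V_def ec_shift_def weierstrass.simps by algebra
    moreover have "a\<^sub>6 V = 0" unfolding V_def ec_shift_def weierstrass.simps using eq by algebra
    moreover have "a\<^sub>3 V \<noteq> 0" using False unfolding V_def ec_shift_def by (simp add: algebra_simps)
    ultimately show ?thesis
      using transfer[OF V_def] ec_add_double_normal_form[of "a\<^sub>3 V" _ "a\<^sub>1 V" "a\<^sub>2 V"]
      by (cases V) simp
  next
    case True
    define V where "V = ec_shift x0 0 y0 W"
    have a3: "a\<^sub>3 V = 0" using True unfolding V_def ec_shift_def by (simp add: algebra_simps)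
    have a6: "a\<^sub>6 V = 0" unfolding V_def ec_shift_def weierstrass.simps using eq by algebra
    have "a\<^sub>4 V \<noteq> 0"
    proof
      assume "a\<^sub>4 V = 0"
      then have "discriminant V = 0" using a3 a6 by (simp add: discriminant_def)
      then show False using disc by (simp add: V_def discriminant_ec_shift)
    qed
    then show ?thesis
      using transfer[OF V_def] ec_add_two_torsion_normal_form[of "a\<^sub>4 V" _ "a\<^sub>1 V" "a\<^sub>2 V"] a3 a6
      by (cases V) simp
  qed
qed simp

section \<open>Torsion points\<close>

lemma mult_ec_group [simp]: "monoid.mult (ec_group W) = ec_add W"
  and one_ec_group [simp]: "monoid.one (ec_group W) = Infty"
  by (simp_all add: ec_group_def)

lemma ec_pow_in_points: "P \<in> ec_points W \<Longrightarrow> P [^]\<^bsub>ec_group W\<^esub> (n::nat) \<in> ec_points W"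
  by (induction n) (simp_all add: ec_add_closed)

lemma ec_pow_double:
  fixes W :: "'a::field_char_0 weierstrass"
  assumes "discriminant W \<noteq> 0" "P \<in> ec_points W"
  shows "ec_add W P P [^]\<^bsub>ec_group W\<^esub> (n::nat) = P [^]\<^bsub>ec_group W\<^esub> (2 * n)"
  by (induction n) (simp_all add: ec_add_double assms ec_pow_in_points)

lemma ec_pow_add_period:
  assumes "P [^]\<^bsub>ec_group W\<^esub> (n::nat) = Infty"
  shows "P [^]\<^bsub>ec_group W\<^esub> (n + k) = P [^]\<^bsub>ec_group W\<^esub> k"
  by (induction k) (simp_all add: assms)

lemma ec_pow_neg:
  assumes "P \<in> ec_points W"
  shows "ec_neg W P [^]\<^bsub>ec_group W\<^esub> (n::nat) = ec_neg W (P [^]\<^bsub>ec_group W\<^esub> n)"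
  by (induction n) (simp_all add: ec_add_neg_neg assms ec_pow_in_points)

lemma ec_add_neg_self: "ec_add W P (ec_neg W P) = Infty"
  by (cases P) simp_all

lemma in_torsion_over:
  "P \<in> carrier (torsion_over E TYPE('k::field_char_0)) \<longleftrightarrow>
     P \<in> ec_points (base_change E :: 'k weierstrass) \<and>
     (\<exists>n::nat. n > 0 \<and> P [^]\<^bsub>ec_group (base_change E :: 'k weierstrass)\<^esub> n = Infty)"
  by (simp add: torsion_over_def torsion_subgroup_def ec_group_def)

lemma torsion_over_infty: "Infty \<in> carrier (torsion_over E TYPE('k::field_char_0))"
  unfolding in_torsion_over by (auto intro!: exI[of _ "Suc 0"])

text \<open>
  Associativity of the chord-tangent law is only needed in the form
  \<open>Q + 2P = (Q + P) + P\<close>: closure of the torsion set under doubling and negation suffices to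
  transport relations from an abstract cyclic group.
\<close>

lemma torsion_over_double:
  fixes E :: "rat weierstrass"
  assumes "discriminant (base_change E :: 'k::field_char_0 weierstrass) \<noteq> 0"
    and "P \<in> carrier (torsion_over E TYPE('k))"
  shows "ec_add (base_change E) P P \<in> carrier (torsion_over E TYPE('k))"
proof -
  let ?W = "base_change E :: 'k weierstrass"
  obtain n :: nat where n: "P \<in> ec_points ?W" "n > 0" "P [^]\<^bsub>ec_group ?W\<^esub> n = Infty"
    using assms(2) unfolding in_torsion_over by blast
  have "ec_add ?W P P [^]\<^bsub>ec_group ?W\<^esub> n = P [^]\<^bsub>ec_group ?W\<^esub> (n + n)"
    using ec_pow_double[OF assms(1) n(1), of n] by (simp add: mult_2)
  also have "\<dots> = Infty" unfolding ec_pow_add_period[OF n(3)] by (rule n(3))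
  finally show ?thesis unfolding in_torsion_over using n ec_add_closed by blast
qed

lemma torsion_over_neg:
  fixes E :: "rat weierstrass"
  assumes "P \<in> carrier (torsion_over E TYPE('k::field_char_0))"
  shows "ec_neg (base_change E) P \<in> carrier (torsion_over E TYPE('k))"
proof -
  let ?W = "base_change E :: 'k weierstrass"
  obtain n :: nat where n: "P \<in> ec_points ?W" "n > 0" "P [^]\<^bsub>ec_group ?W\<^esub> n = Infty"
    using assms unfolding in_torsion_over by blast
  then have "ec_neg ?W P [^]\<^bsub>ec_group ?W\<^esub> n = Infty" by (simp add: ec_pow_neg)
  then show ?thesis unfolding in_torsion_over using n ec_neg_in_points by blast
qed

section \<open>Relations between torsion points, read off from a cyclic group\<close>

locale cyclic_torsion =
  fixes E :: "rat weierstrass" and W :: "'k::field_char_0 weierstrass" and n :: nat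
    and f :: "'k ec_point \<Rightarrow> int"
  assumes W: "W = base_change E" and n: "n > 0" and disc: "discriminant W \<noteq> 0"
    and iso: "f \<in> Group.iso (torsion_over E TYPE('k)) (integer_mod_group n)"
begin

abbreviation T :: "'k ec_point set" where
  "T \<equiv> carrier (torsion_over E TYPE('k))"

lemma f_range: "P \<in> T \<Longrightarrow> 0 \<le> f P \<and> f P < int n"
  using iso n by (auto simp: iso_def hom_def carrier_integer_mod_group Pi_def)

lemma f_add: "P \<in> T \<Longrightarrow> Q \<in> T \<Longrightarrow> f (ec_add W P Q) = (f P + f Q) mod int n"
  using iso by (auto simp: iso_def hom_def torsion_over_def torsion_subgroup_def ec_group_def W)

lemma f_inj: "P \<in> T \<Longrightarrow> Q \<in> T \<Longrightarrow> f P = f Q \<Longrightarrow> P = Q"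
  using iso by (auto simp: iso_def bij_betw_def inj_on_def)

lemma f_surj:
  assumes "0 \<le> i" "i < int n"
  obtains P where "P \<in> T" "f P = i"
proof -
  have "i \<in> f ` T" using iso assms n by (auto simp: iso_def bij_betw_def carrier_integer_mod_group)
  then show thesis using that by blast
qed

lemma f_infty: "f Infty = 0"
proof -
  have "f Infty = (f Infty + f Infty) mod int n"
    using f_add[OF torsion_over_infty torsion_over_infty] by simp
  moreover have "0 \<le> f Infty" "f Infty < int n" using f_range[OF torsion_over_infty] by auto
  ultimately show ?thesis
    by (smt (verit) mod_add_self2 mod_pos_pos_trivial minus_mod_self2)
qed

lemma f_neg: "P \<in> T \<Longrightarrow> (f P + f (ec_neg W P)) mod int n = 0"
  using f_add[of P "ec_neg W P"] torsion_over_neg[of P E] f_infty ec_add_neg_self[of W P]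
  by (simp add: W)

lemma double_in_T: "P \<in> T \<Longrightarrow> ec_add W P P \<in> T"
  using torsion_over_double[of E P] disc by (simp add: W)

lemma neg_in_T: "P \<in> T \<Longrightarrow> ec_neg W P \<in> T"
  using torsion_over_neg[of P E] by (simp add: W)

lemma T_subset: "P \<in> T \<Longrightarrow> P \<in> ec_points W"
  by (simp add: in_torsion_over W)

lemma order_2_point:
  assumes "int n = 2 * m"
  obtains P where "P \<in> ec_points W" "P \<noteq> Infty" "ec_neg W P = P"
proof -
  have m: "0 < m" "m < int n" using assms n by auto
  obtain P where P: "P \<in> T" "f P = m" using f_surj[of m] m by auto
  have "0 \<le> f (ec_neg W P)" "f (ec_neg W P) < 2 * m" using f_range[OF neg_in_T[OF P(1)]] assms by auto
  moreover have "(m + f (ec_neg W P)) mod (2 * m) = 0" using f_neg[OF P(1)] P(2) assms by simp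
  ultimately have "f (ec_neg W P) = m"
    by (smt (verit) m(1) mod_pos_pos_trivial mod_add_self2 minus_mod_self2)
  then have "ec_neg W P = P" using f_inj[OF neg_in_T[OF P(1)] P(1)] P(2) by simp
  moreover have "P \<noteq> Infty" using f_infty P(2) m by auto
  ultimately show thesis using that T_subset[OF P(1)] by blast
qed

lemma f_neg_eq:
  assumes "P \<in> T" "f P > 0"
  shows "f (ec_neg W P) = int n - f P"
proof -
  have "0 \<le> f (ec_neg W P)" "f (ec_neg W P) < int n" using f_range[OF neg_in_T[OF assms(1)]] by auto
  moreover have "f P < int n" using f_range[OF assms(1)] by auto
  moreover have "(f P + f (ec_neg W P)) mod int n = 0" using f_neg[OF assms(1)] .
  ultimately show ?thesis
    using assms(2) by (smt (verit) mod_pos_pos_trivial mod_add_self2 minus_mod_self2)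
qed

lemma order_3_point:
  assumes "int n = 3 * m"
  obtains P where "P \<in> ec_points W" "P \<noteq> Infty" "ec_add W P P = ec_neg W P"
proof -
  have m: "0 < m" "m < int n" using assms n by auto
  obtain P where P: "P \<in> T" "f P = m" using f_surj[of m] m by auto
  have "f (ec_add W P P) = 2 * m"
    using f_add[OF P(1) P(1)] P(2) assms m(1) by simp
  moreover have "f (ec_neg W P) = 2 * m" using f_neg_eq[OF P(1)] P(2) assms m by simp
  ultimately have "ec_add W P P = ec_neg W P"
    using f_inj[OF double_in_T[OF P(1)] neg_in_T[OF P(1)]] by simp
  moreover have "P \<noteq> Infty" using f_infty P(2) m by auto
  ultimately show thesis using that T_subset[OF P(1)] by blast
qed

text \<open>The point mapped to \<open>m\<close> has order 5. The relation \<open>4 P = - P\<close>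
  is phrased with two doublings, so that both sides are known to be torsion points and injectivity
  of \<open>f\<close> applies.\<close>

lemma order_5_point:
  assumes "int n = 5 * m"
  obtains P D where "P \<in> ec_points W" "P \<noteq> Infty" "D = ec_add W P P" "D \<noteq> P" "D \<noteq> ec_neg W P"
    "ec_add W D D = ec_neg W P"
proof -
  have m: "0 < m" "m < int n" using assms n by auto
  obtain P where P: "P \<in> T" "f P = m" using f_surj[of m] m by auto
  let ?D = "ec_add W P P"
  have D: "?D \<in> T" "f ?D = 2 * m"
    using double_in_T[OF P(1)] f_add[OF P(1) P(1)] P(2) assms m(1) by simp_all
  have "f (ec_add W ?D ?D) = 4 * m"
    using f_add[OF D(1) D(1)] D(2) assms m(1) by simp
  moreover have neg: "f (ec_neg W P) = 4 * m" using f_neg_eq[OF P(1)] P(2) assms m by simp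
  ultimately have "ec_add W ?D ?D = ec_neg W P"
    using f_inj[OF double_in_T[OF D(1)] neg_in_T[OF P(1)]] by simp
  moreover have "?D \<noteq> P" "?D \<noteq> ec_neg W P" "P \<noteq> Infty" using D(2) P(2) neg m f_infty by auto
  ultimately show thesis using that T_subset[OF P(1)] by blast
qed

end

section \<open>Coordinates of points of order 2, 3 and 5\<close>

lemma order_2_abscissa:
  fixes W :: "'a::field_char_0 weierstrass"
  assumes "P \<in> ec_points W" "P \<noteq> Infty" "ec_neg W P = P"
  obtains X where "X^3 - 27 * c4_of W * X - 54 * c6_of W = 0"
proof -
  obtain x y where P: "P = Affine x y" using assms(2) by (cases P) auto
  have eq: "y^2 + a\<^sub>1 W * x * y + a\<^sub>3 W * y = x^3 + a\<^sub>2 W * x^2 + a\<^sub>4 W * x + a\<^sub>6 W"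
    using assms(1) P by simp
  have neg: "- y - a\<^sub>1 W * x - a\<^sub>3 W = y" using assms(3) P by simp
  have "2 * y + a\<^sub>1 W * x + a\<^sub>3 W = y - (- y - a\<^sub>1 W * x - a\<^sub>3 W)" by simp
  then have e: "2 * y + a\<^sub>1 W * x + a\<^sub>3 W = 0" unfolding neg by (simp only: diff_self)
  have "(2 * y + a\<^sub>1 W * x + a\<^sub>3 W)^2 = 4 * x^3 + b2_of W * x^2 + 2 * b4_of W * x + b6_of W"
    unfolding b2_of_def b4_of_def b6_of_def using eq by algebra
  then have f: "4 * x^3 + b2_of W * x^2 + 2 * b4_of W * x + b6_of W = 0" unfolding e by simp
  \<comment> \<open>\<open>X = 36 x + 3 b2\<close> and \<open>Y = 108 (2 y + a1 x + a3)\<close> lead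
    to the short model \<open>Y^2 = X^3 - 27 c4 X - 54 c6\<close>; here
    \<open>Y = 0\<close>.\<close>
  have "(36 * x + 3 * b2_of W)^3 - 27 * c4_of W * (36 * x + 3 * b2_of W) - 54 * c6_of W
      = 11664 * (4 * x^3 + b2_of W * x^2 + 2 * b4_of W * x + b6_of W)"
    unfolding c4_of_def c6_of_def by algebra
  then show thesis unfolding f by (intro that) simp
qed

text \<open>\<open>2 P = - P\<close> makes the third intersection of the tangent equal to
  \<open>P\<close>, which expresses the square of \<open>2 l + a1\<close> in \<open>x\<close>.
  Multiplying by the squared ordinate eliminates the slope and leaves the 3-division polynomial,
  then rewritten on the short model.\<close>

lemma order_3_flex:
  fixes W :: "'a::field_char_0 weierstrass"
  assumes "P \<in> ec_points W" "P \<noteq> Infty" "ec_add W P P = ec_neg W P"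
  obtains X Y where "Y^2 = X^3 - 27 * c4_of W * X - 54 * c6_of W"
    "3 * X^4 - 162 * c4_of W * X^2 - 648 * c6_of W * X - 729 * (c4_of W)^2 = 0"
proof -
  obtain x y where P: "P = Affine x y" using assms(2) by (cases P) auto
  have eq: "y^2 + a\<^sub>1 W * x * y + a\<^sub>3 W * y = x^3 + a\<^sub>2 W * x^2 + a\<^sub>4 W * x + a\<^sub>6 W"
    using assms(1) P by simp
  define e where "e = 2 * y + a\<^sub>1 W * x + a\<^sub>3 W"
  have "e \<noteq> 0"
  proof
    assume "e = 0"
    then have "y + y + a\<^sub>1 W * x + a\<^sub>3 W = 0" by (simp add: e_def)
    then show False using assms(3) P by simp
  qed
  define l where "l = (3 * x^2 + 2 * a\<^sub>2 W * x + a\<^sub>4 W - a\<^sub>1 W * y) / e"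
  have l: "l * e = 3 * x^2 + 2 * a\<^sub>2 W * x + a\<^sub>4 W - a\<^sub>1 W * y" using \<open>e \<noteq> 0\<close> by (simp add: l_def)
  have "l^2 + a\<^sub>1 W * l - a\<^sub>2 W - x - x = x"
    using assms(3) unfolding P ec_add_tangent[OF \<open>e \<noteq> 0\<close>[unfolded e_def] l_def[unfolded e_def] refl] by simp
  moreover have "(2 * l + a\<^sub>1 W)^2 = 4 * (l^2 + a\<^sub>1 W * l - a\<^sub>2 W - x - x) + 8 * x + b2_of W"
    unfolding b2_of_def by algebra
  ultimately have sq: "(2 * l + a\<^sub>1 W)^2 = 12 * x + b2_of W" by simp
  have e2: "e^2 = 4 * x^3 + b2_of W * x^2 + 2 * b4_of W * x + b6_of W"
    unfolding b2_of_def b4_of_def b6_of_def e_def using eq by algebra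
  have le: "(2 * l + a\<^sub>1 W) * e = 6 * x^2 + b2_of W * x + b4_of W"
  proof -
    have "(2 * l + a\<^sub>1 W) * e = 2 * (l * e) + a\<^sub>1 W * e" by (simp add: algebra_simps)
    also have "\<dots> = 6 * x^2 + b2_of W * x + b4_of W"
      unfolding l unfolding b2_of_def b4_of_def e_def by algebra
    finally show ?thesis .
  qed
  have psi: "(12 * x + b2_of W) * (4 * x^3 + b2_of W * x^2 + 2 * b4_of W * x + b6_of W)
      - (6 * x^2 + b2_of W * x + b4_of W)\<^sup>2 = 0"
    unfolding sq[symmetric] e2[symmetric] le[symmetric] by (simp add: power_mult_distrib)
  define X where "X = 36 * x + 3 * b2_of W"
  have "X^3 - 27 * c4_of W * X - 54 * c6_of W = 11664 * e^2"
    unfolding e2 unfolding X_def c4_of_def c6_of_def by algebra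
  then have "(108 * e)^2 = X^3 - 27 * c4_of W * X - 54 * c6_of W"
    by (simp add: power_mult_distrib)
  moreover have "3 * X^4 - 162 * c4_of W * X^2 - 648 * c6_of W * X - 729 * (c4_of W)^2
      = 419904 * ((12 * x + b2_of W) * (4 * x^3 + b2_of W * x^2 + 2 * b4_of W * x + b6_of W)
      - (6 * x^2 + b2_of W * x + b4_of W)\<^sup>2)"
    unfolding X_def c4_of_def c6_of_def by algebra
  then have "3 * X^4 - 162 * c4_of W * X^2 - 648 * c6_of W * X - 729 * (c4_of W)^2 = 0"
    unfolding psi by simp
  ultimately show thesis by (rule that)
qed

text \<open>With \<open>P\<close> at the origin and its tangent horizontal, \<open>A\<close>,
  \<open>C\<close>, \<open>B\<close> are the coefficients \<open>a1\<close>, \<open>a2\<close>,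
  \<open>a3\<close>. Scaling by \<open>u = B / C\<close> makes the last two equal, and
  \<open>2 D = - P\<close> amounts to \<open>C = u (A - u)\<close>, which leaves the single
  parameter \<open>t\<close>.\<close>

lemma order_5_tate:
  fixes W :: "'a::field_char_0 weierstrass"
  assumes "P \<in> ec_points W" "P \<noteq> Infty" and D: "D = ec_add W P P" "D \<noteq> P" "D \<noteq> ec_neg W P"
    and DD: "ec_add W D D = ec_neg W P"
  obtains u t where "u \<noteq> 0" "t \<noteq> 0" "c4_of W = u^4 * tate_c4 t" "c6_of W = u^6 * tate_c6 t"
proof -
  let ?a1 = "a\<^sub>1 W" and ?a2 = "a\<^sub>2 W" and ?a3 = "a\<^sub>3 W" and ?a4 = "a\<^sub>4 W"
  obtain x0 y0 where P: "P = Affine x0 y0" using assms(2) by (cases P) auto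
  have eq: "y0^2 + ?a1 * x0 * y0 + ?a3 * y0 = x0^3 + ?a2 * x0^2 + ?a4 * x0 + a\<^sub>6 W"
    using assms(1) P by simp
  define B where "B = 2 * y0 + ?a1 * x0 + ?a3"
  have "B \<noteq> 0"
  proof
    assume "B = 0"
    then have "y0 + y0 + ?a1 * x0 + ?a3 = 0" by (simp add: B_def)
    then show False using D(1) DD P by simp
  qed
  define l where "l = (3 * x0^2 + 2 * ?a2 * x0 + ?a4 - ?a1 * y0) / B"
  have l: "l * B = 3 * x0^2 + 2 * ?a2 * x0 + ?a4 - ?a1 * y0" using \<open>B \<noteq> 0\<close> by (simp add: l_def)
  define x2 where "x2 = l^2 + ?a1 * l - ?a2 - x0 - x0"
  define y2 where "y2 = - (l + ?a1) * x2 - (y0 - l * x0) - ?a3"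
  have D': "D = Affine x2 y2"
    unfolding D(1) P y2_def by (rule ec_add_tangent[OF \<open>B \<noteq> 0\<close>[unfolded B_def] l_def[unfolded B_def] x2_def])
  have D_points: "D \<in> ec_points W" unfolding D(1) using assms(1) by (intro ec_add_closed)
  have "x2 \<noteq> x0"
  proof
    assume "x2 = x0"
    then have "y0 = y2 \<or> y0 + y2 + ?a1 * x0 + ?a3 = 0"
      using ec_points_same_abscissa[of x0 y0 W y2] assms(1) D_points unfolding P D' by blast
    then show False
    proof
      assume "y0 = y2"
      then show False using D(2) P D' \<open>x2 = x0\<close> by simp
    next
      assume *: "y0 + y2 + ?a1 * x0 + ?a3 = 0"
      have "y2 = (y0 + y2 + ?a1 * x0 + ?a3) - y0 - ?a1 * x0 - ?a3" by simp
      then have "y2 = - y0 - ?a1 * x0 - ?a3" unfolding * by simp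
      then show False using D(3) P D' \<open>x2 = x0\<close> by simp
    qed
  qed
  define B2 where "B2 = 2 * y2 + ?a1 * x2 + ?a3"
  have "B2 \<noteq> 0"
  proof
    assume "B2 = 0"
    then have "y2 + y2 + ?a1 * x2 + ?a3 = 0" by (simp add: B2_def)
    then show False using DD P D' by simp
  qed
  define m where "m = (3 * x2^2 + 2 * ?a2 * x2 + ?a4 - ?a1 * y2) / B2"
  have m: "m^2 + ?a1 * m - ?a2 - x2 - x2 = x0"
    "- (m + ?a1) * x0 - (y2 - m * x2) - ?a3 = - y0 - ?a1 * x0 - ?a3"
    using DD unfolding P D' ec_add_tangent[OF \<open>B2 \<noteq> 0\<close>[unfolded B2_def] m_def[unfolded B2_def] refl] by auto
  define A where "A = ?a1 + 2 * l"
  define C where "C = x0 - x2"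
  have "C \<noteq> 0" using \<open>x2 \<noteq> x0\<close> by (simp add: C_def)
  define u where "u = B / C"
  have uC: "u * C = B" using \<open>C \<noteq> 0\<close> by (simp add: u_def)
  have "u \<noteq> 0" using uC \<open>B \<noteq> 0\<close> by auto
  have "C * (m - (u - A + l)) = 0"
    using m(2) uC unfolding y2_def A_def B_def C_def by algebra
  then have mu: "m = u - A + l" using \<open>C \<noteq> 0\<close> by simp
  have "C - u * (A - u) = (m^2 + ?a1 * m - ?a2 - x2 - x2) - x0"
    unfolding mu C_def x2_def A_def by algebra
  then have Cu: "C = u * (A - u)" unfolding m(1) by simp
  define t where "t = 1 - A / u"
  have A: "A = u * (1 - t)" using \<open>u \<noteq> 0\<close> by (simp add: t_def)
  have C: "C = - t * u^2" unfolding Cu A by algebra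
  have B: "B = - t * u^3" unfolding uC[symmetric] C by algebra
  have "t \<noteq> 0" using C \<open>C \<noteq> 0\<close> by auto
  have b2: "b2_of W + 12 * x0 = A^2 + 4 * C"
    unfolding b2_of_def A_def C_def x2_def by algebra
  have b4: "b4_of W + x0 * b2_of W + 6 * x0^2 = A * B"
  proof -
    have "A * B = ?a1 * B + 2 * (l * B)" by (simp add: A_def algebra_simps)
    then show ?thesis unfolding l unfolding B_def b2_of_def b4_of_def by algebra
  qed
  have b6: "b6_of W + 2 * x0 * b4_of W + x0^2 * b2_of W + 4 * x0^3 = B^2"
    unfolding b2_of_def b4_of_def b6_of_def B_def using eq by algebra
  have "c4_of W = (b2_of W + 12 * x0)^2 - 24 * (b4_of W + x0 * b2_of W + 6 * x0^2)"
    unfolding c4_of_def by algebra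
  also have "\<dots> = u^4 * tate_c4 t" unfolding b2 b4 unfolding A B C tate_c4_def by algebra
  finally have c4: "c4_of W = u^4 * tate_c4 t" .
  have "c6_of W = - ((b2_of W + 12 * x0)^3) + 36 * (b2_of W + 12 * x0) * (b4_of W + x0 * b2_of W + 6 * x0^2)
      - 216 * (b6_of W + 2 * x0 * b4_of W + x0^2 * b2_of W + 4 * x0^3)"
    unfolding c6_of_def by algebra
  also have "\<dots> = u^6 * tate_c6 t" unfolding b2 b4 b6 unfolding A B C tate_c6_def by algebra
  finally have c6: "c6_of W = u^6 * tate_c6 t" .
  show thesis by (rule that[OF \<open>u \<noteq> 0\<close> \<open>t \<noteq> 0\<close> c4 c6])
qed

section \<open>The curves\<close>

lemma base_change_invariants:
  "c4_of (base_change E :: 'k::field_char_0 weierstrass) = of_rat (c4_of E)"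
  "c6_of (base_change E :: 'k weierstrass) = of_rat (c6_of E)"
  by (simp_all add: c4_of_def c6_of_def b2_of_def b4_of_def b6_of_def base_change_def of_rat_simps)

lemma tate_invariants_of_rat:
  "tate_c4 (of_rat t :: 'k::field_char_0) = of_rat (tate_c4 t)"
  "tate_c6 (of_rat t :: 'k) = of_rat (tate_c6 t)"
  by (simp_all add: tate_c4_def tate_c6_def of_rat_simps)

lemma elliptic_curve_invariants:
  fixes E :: "rat weierstrass"
  assumes "elliptic_curve E"
  shows "(c4_of E)^3 \<noteq> (c6_of E)\<^sup>2" "discriminant (base_change E :: 'k::field_char_0 weierstrass) \<noteq> 0"
proof -
  show *: "(c4_of E)^3 \<noteq> (c6_of E)\<^sup>2"
    using assms discriminant_c4_c6[of E] by (auto simp: elliptic_curve_def)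
  have "1728 * discriminant (base_change E :: 'k weierstrass) = of_rat ((c4_of E)^3 - (c6_of E)^2)"
    by (simp add: discriminant_c4_c6 base_change_invariants of_rat_simps)
  then show "discriminant (base_change E :: 'k weierstrass) \<noteq> 0"
    using * by (metis eq_iff_diff_eq_0 mult_zero_right of_rat_eq_0_iff)
qed

lemma curves_with_5_and_3_torsion:
  fixes u t X Y :: "'k::field_char_0"
  assumes deg: "degree_over_rat TYPE('k) = 6"
    and "u \<noteq> 0" "t \<noteq> 0" and e4: "of_rat e4 = u^4 * tate_c4 t" and e6: "of_rat e6 = u^6 * tate_c6 t"
    and disc: "e4^3 \<noteq> e6^2"
    and curve: "Y^2 = X^3 - 27 * of_rat e4 * X - 54 * of_rat e6"
    and flex: "3 * X^4 - 162 * of_rat e4 * X^2 - 648 * of_rat e6 * X - 729 * (of_rat e4)^2 = 0"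
  obtains \<nu> :: 'k and k :: rat where "\<nu>^2 = of_rat k" "k \<noteq> 0"
    "(e4 = 145 * k^2 \<and> e6 = - 2105 * k^3) \<or> (e4 = - 1055 * k^2 \<and> e6 = 15535 * k^3)"
proof -
  obtain s k where s: "t = of_rat s" and k: "u^2 = of_rat k"
    using tate_parameter_rational[OF deg assms(2-6)] .
  have "s \<noteq> 0" using \<open>t \<noteq> 0\<close> s by auto
  have "k \<noteq> 0" using k \<open>u \<noteq> 0\<close> by auto
  have "of_rat e4 = (u^2)^2 * tate_c4 t" "of_rat e6 = (u^2)^3 * tate_c6 t"
    unfolding e4 e6 by simp_all
  then have "of_rat e4 = (of_rat (k^2 * tate_c4 s) :: 'k)" "of_rat e6 = (of_rat (k^3 * tate_c6 s) :: 'k)"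
    unfolding k s tate_invariants_of_rat by (simp_all add: of_rat_simps)
  then have e: "e4 = k^2 * tate_c4 s" "e6 = k^3 * tate_c6 s" by (simp_all only: of_rat_eq_iff)
  have "Y^2 = X^3 + of_rat (- 27 * e4) * X + of_rat (- 54 * e6)"
    using curve by (simp add: of_rat_simps)
  moreover have "3 * X^4 + 6 * of_rat (- 27 * e4) * X^2 + 12 * of_rat (- 54 * e6) * X - (of_rat (- 27 * e4))^2 = 0"
    using flex by (simp add: of_rat_simps power_mult_distrib)
  ultimately obtain z where z: "3 * z^4 + 6 * (- 27 * e4) * z^2 + 12 * (- 54 * e6) * z - (- 27 * e4)^2 = 0"
    by (rule rational_flex[OF deg])
  \<comment> \<open>The inverse of the passage to the short model for the Tate form, whose
    \<open>b2\<close> is \<open>s^2 - 6 s + 1\<close>, combined with the twist by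
    \<open>k\<close>.\<close>
  define x where "x = (z / k - 3 * (s^2 - 6 * s + 1)) / 36"
  have zx: "z = k * (36 * x + 3 * (s^2 - 6 * s + 1))"
    using \<open>k \<noteq> 0\<close> by (simp add: x_def field_simps)
  have "1679616 * k^4 * (3 * x^4 + (s^2 - 6 * s + 1) * x^3 + 3 * (s^2 - s) * x^2 + 3 * s^2 * x - s^3)
     = 3 * z^4 + 6 * (- 27 * e4) * z^2 + 12 * (- 54 * e6) * z - (- 27 * e4)^2"
    unfolding zx e tate_c4_def tate_c6_def by algebra
  then have "3 * x^4 + (s^2 - 6 * s + 1) * x^3 + 3 * (s^2 - s) * x^2 + 3 * s^2 * x - s^3 = 0"
    unfolding z using \<open>k \<noteq> 0\<close> by simp
  then have "s \<in> {1/2, - 2, 8, - 1/8}" by (rule tate_curve_rational_flex[OF \<open>s \<noteq> 0\<close>])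
  \<comment> \<open>The values pair off under \<open>s -> -1/s\<close>, which multiplies
    \<open>tate_c4\<close> by \<open>s^(-4)\<close> and \<open>tate_c6\<close> by
    \<open>s^(-6)\<close>; the twisting factors \<open>k / 4\<close> and \<open>k / 64\<close>
    absorb this.\<close>
  then consider "s = 1/2" | "s = - 2" | "s = 8" | "s = - 1/8" by auto
  then show thesis
  proof cases
    case 1
    have "(u / 2)^2 = of_rat (k / 4)" using k by (simp add: power_divide of_rat_simps)
    moreover have "e4 = 145 * (k / 4)^2" "e6 = - 2105 * (k / 4)^3"
      unfolding e 1 tate_c4_def tate_c6_def by (simp_all add: power_divide)
    ultimately show thesis using that \<open>k \<noteq> 0\<close> by fastforce
  next
    case 2
    have "e4 = 145 * k^2" "e6 = - 2105 * k^3" unfolding e 2 tate_c4_def tate_c6_def by simp_all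
    then show thesis using that[OF k] \<open>k \<noteq> 0\<close> by blast
  next
    case 3
    have "e4 = - 1055 * k^2" "e6 = 15535 * k^3" unfolding e 3 tate_c4_def tate_c6_def by simp_all
    then show thesis using that[OF k] \<open>k \<noteq> 0\<close> by blast
  next
    case 4
    have "(u / 8)^2 = of_rat (k / 64)" using k by (simp add: power_divide of_rat_simps)
    moreover have "e4 = - 1055 * (k / 64)^2" "e6 = 15535 * (k / 64)^3"
      unfolding e 4 tate_c4_def tate_c6_def by (simp_all add: power_divide)
    ultimately show thesis using that \<open>k \<noteq> 0\<close> by fastforce
  qed
qed

lemma rat_root_monic_cubic_int:
  fixes x :: rat and a b :: int
  assumes "x^3 + of_int a * x + of_int b = 0"
  obtains n :: int where "n^3 + a * n + b = 0"
proof -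
  obtain u v where uv: "quotient_of x = (u, v)" by fastforce
  then have v: "v > 0" and cop: "coprime u v" and x: "x = of_int u / of_int v"
    using quotient_of_denom_pos quotient_of_coprime quotient_of_div by blast+
  have xv: "x * of_int v = of_int u" using v x by simp
  have "(of_int (u^3 + a * u * v^2 + b * v^3) :: rat) = (of_int v)^3 * (x^3 + of_int a * x + of_int b)"
    unfolding of_int_add of_int_mult of_int_power xv[symmetric] by algebra
  then have "(of_int (u^3 + a * u * v^2 + b * v^3) :: rat) = 0" unfolding assms by simp
  then have 0: "u^3 + a * u * v^2 + b * v^3 = 0" by (simp only: of_int_eq_0_iff)
  then have "u^3 = v * (- (a * u * v) - b * v^2)" by algebra
  then have "v dvd u^3" by simp
  moreover have "coprime v (u^3)" using cop by (simp add: coprime_commute)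
  ultimately have "is_unit v" by (meson coprime_common_divisor dvd_refl)
  then have "v = 1" using v by simp
  then show thesis using 0 that by simp
qed

lemma int_mod_11_cases:
  fixes n :: int
  shows "n mod 11 = 0 \<or> n mod 11 = 1 \<or> n mod 11 = 2 \<or> n mod 11 = 3 \<or> n mod 11 = 4 \<or> n mod 11 = 5
    \<or> n mod 11 = 6 \<or> n mod 11 = 7 \<or> n mod 11 = 8 \<or> n mod 11 = 9 \<or> n mod 11 = 10"
  by presburger

text \<open>These are the 2-division cubics of the two untwisted curves, in the variable divided by
  3; neither has a root modulo 11.\<close>

lemma no_integer_root_mod_11:
  fixes n :: int
  shows "n^3 + (- 435) * n + 4210 \<noteq> 0" "n^3 + 3165 * n + (- 31070) \<noteq> 0"
proof -
  have *: "(n^3 + a * n + b) mod 11 = ((n mod 11)^3 + a * (n mod 11) + b) mod 11" for a b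
    by (intro mod_add_cong mod_mult_cong) (simp_all add: power_mod)
  have "(n^3 + (- 435) * n + 4210) mod 11 \<noteq> 0" unfolding *
    using int_mod_11_cases[of n] by (elim disjE) simp_all
  then show "n^3 + (- 435) * n + 4210 \<noteq> 0" by auto
  have "(n^3 + 3165 * n + (- 31070)) mod 11 \<noteq> 0" unfolding *
    using int_mod_11_cases[of n] by (elim disjE) simp_all
  then show "n^3 + 3165 * n + (- 31070) \<noteq> 0" by auto
qed

text \<open>Cubes modulo 7 are 0, 1 and 6, whereas 5 and 10 leave 5 and 3.\<close>

lemma rat_cube_5_10:
  fixes w :: rat
  shows "w^3 \<noteq> 5" "w^3 \<noteq> 10"
proof -
  have *: "(n^3) mod 7 \<noteq> 5 \<and> (n^3) mod 7 \<noteq> 3" for n :: int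
  proof -
    have "0 \<le> n mod 7" "n mod 7 < 7" by simp_all
    then have "n mod 7 = 0 \<or> n mod 7 = 1 \<or> n mod 7 = 2 \<or> n mod 7 = 3 \<or> n mod 7 = 4 \<or> n mod 7 = 5 \<or> n mod 7 = 6"
      by presburger
    moreover have "(n^3) mod 7 = ((n mod 7)^3) mod 7" by (simp add: power_mod)
    ultimately show ?thesis by (elim disjE) simp_all
  qed
  show "w^3 \<noteq> 5"
  proof
    assume "w^3 = 5"
    then have "w^3 + of_int 0 * w + of_int (- 5) = 0" by simp
    then obtain n :: int where "n^3 + 0 * n + (- 5) = 0" by (rule rat_root_monic_cubic_int)
    then have "n^3 = 5" by simp
    then show False using *[of n] by simp
  qed
  show "w^3 \<noteq> 10"
  proof
    assume "w^3 = 10"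
    then have "w^3 + of_int 0 * w + of_int (- 10) = 0" by simp
    then obtain n :: int where "n^3 + 0 * n + (- 10) = 0" by (rule rat_root_monic_cubic_int)
    then have "n^3 = 10" by simp
    then show False using *[of n] by simp
  qed
qed

text \<open>The discriminant of the cubic is -2 times a square, that of a pure cubic field -3 times
  a square; equality of the two classes would make 6 a square.\<close>

lemma no_2_torsion_over_pure_cubic:
  fixes \<theta> \<alpha> :: "'k::field_char_0"
  assumes deg: "degree_over_rat TYPE('k) = 6"
    and th: "\<theta>^3 = of_rat C" "\<And>w. w^3 \<noteq> C"
    and al: "\<alpha>^3 + of_rat p * \<alpha> + of_rat q = 0"
    and noroot: "\<And>x. x^3 + p * x + q \<noteq> 0" and disc: "4 * p^3 + 27 * q^2 = 2 * s^2" "s \<noteq> 0"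
  shows False
proof (rule cubic_root_over_pure_cubic[OF deg th al])
  fix x assume "x^3 + p * x + q = 0"
  then show False using noroot by blast
next
  fix w assume "4 * p^3 + 27 * q^2 = 3 * w^2"
  then have *: "(2 * s)^2 = of_int (2 * 3) * w^2" using disc(1) by simp
  have "w = 0" by (rule rat_square_prime_mult[OF _ _ *]) simp_all
  then show False using * disc(2) by simp
qed

text \<open>The twist by \<open>k\<close> is trivial over \<open>K\<close> because \<open>K\<close>
  contains \<open>\<nu>\<close>, so points may be carried to the curve with
  \<open>k = 1\<close>.\<close>

lemma untwist:
  fixes X Y \<nu> :: "'k::field_char_0"
  assumes \<nu>: "\<nu>^2 = of_rat k" "k \<noteq> 0" and e: "e4 = c * k^2" "e6 = d * k^3"
    and curve: "Y^2 = X^3 - 27 * of_rat e4 * X - 54 * of_rat e6"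
  obtains x y where "X = of_rat k * x" "y^2 = x^3 - 27 * of_rat c * x - 54 * of_rat d"
    "Y = 0 \<Longrightarrow> y = 0"
proof -
  have "\<nu> \<noteq> 0" using \<nu> by auto
  define x where "x = X / \<nu>^2"
  define y where "y = Y / \<nu>^3"
  have X: "X = \<nu>^2 * x" and Y: "Y = \<nu>^3 * y" using \<open>\<nu> \<noteq> 0\<close> by (simp_all add: x_def y_def)
  have E: "of_rat e4 = of_rat c * (\<nu>^2)^2" "of_rat e6 = of_rat d * (\<nu>^2)^3"
    unfolding e \<nu>(1) by (simp_all add: of_rat_simps)
  have "\<nu>^6 * y^2 = \<nu>^6 * (x^3 - 27 * of_rat c * x - 54 * of_rat d)"
    using curve unfolding X Y E by algebra
  then have "y^2 = x^3 - 27 * of_rat c * x - 54 * of_rat d" using \<open>\<nu> \<noteq> 0\<close> by simp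
  then show thesis using X \<nu>(1) y_def by (intro that[of x y]) simp_all
qed

text \<open>For \<open>k = 1\<close> the flex quartic is a linear factor times a cubic. The rational
  root has \<open>y^2\<close> equal to 5 times a square; the roots of the cubic generate the field
  of the cube root of 10.\<close>

lemma first_twist_family:
  fixes X Y \<nu> :: "'k::field_char_0"
  assumes \<nu>: "\<nu>^2 = of_rat k" "k \<noteq> 0" and e: "e4 = 145 * k^2" "e6 = - 2105 * k^3"
    and curve: "Y^2 = X^3 - 27 * of_rat e4 * X - 54 * of_rat e6"
    and flex: "3 * X^4 - 162 * of_rat e4 * X^2 - 648 * of_rat e6 * X - 729 * (of_rat e4)^2 = 0"
  obtains v :: 'k where "v^2 = of_rat 5" | v \<theta> :: 'k where "v^2 = of_rat (- 15)" "\<theta>^3 = of_rat 10"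
proof -
  obtain x y where X: "X = of_rat k * x" and c': "y^2 = x^3 - 27 * of_rat 145 * x - 54 * of_rat (- 2105)"
    using untwist[OF \<nu> e curve] .
  have E: "of_rat e4 = 145 * (of_rat k :: 'k)^2" "of_rat e6 = - 2105 * (of_rat k :: 'k)^3"
    unfolding e by (simp_all add: of_rat_simps)
  have c: "y^2 = x^3 - 3915 * x + 113670" using c' by (simp add: of_rat_minus)
  have "3 * of_rat k ^ 4 * ((x - 15) * (x^3 + 15 * x^2 - 7605 * x + 340605)) = 0"
    using flex unfolding X E by algebra
  then have "x - 15 = 0 \<or> x^3 + 15 * x^2 - 7605 * x + 340605 = 0" using \<nu>(2) by simp
  then show thesis
  proof
    assume "x - 15 = 0"
    then have "x = 15" by simp
    then have "y^2 = 5 * 108^2" using c by simp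
    then have "(y / 108)^2 = of_rat 5" by (simp add: power_divide)
    then show thesis by (rule that(1))
  next
    assume g: "x^3 + 15 * x^2 - 7605 * x + 340605 = 0"
    have "x \<noteq> 123"
    proof
      assume "x = 123"
      then show False using g by simp
    qed
    \<comment> \<open>\<open>y^2 + 15 (x - 123)^2\<close>, with \<open>y^2\<close> replaced by its
      cubic in \<open>x\<close>, is exactly the polynomial in \<open>g\<close>: three points of
      order 3 lie on the line \<open>y = v (x - 123)\<close> with \<open>v^2 = -15\<close>.\<close>
    have "y^2 = - 15 * (x - 123)^2" using c g by algebra
    then have "(y / (x - 123))^2 = of_rat (- 15)" using \<open>x \<noteq> 123\<close> by (simp add: power_divide of_rat_minus)
    \<comment> \<open>Cardano's formula gives \<open>x + 5 = - 8\<theta>\<^sup>2 - 32\<theta>\<close>, which is solved here for \<open>\<theta>\<close>.\<close>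
    moreover have "(5120 - 128 * (x + 5) - (x + 5)^2)^3 = 3456^3 * 10" using g by algebra
    then have "((5120 - 128 * (x + 5) - (x + 5)^2) / 3456)^3 = of_rat 10" by (simp add: power_divide)
    ultimately show thesis by (rule that(2))
  qed
qed

text \<open>As for the first family, with 5 and -15 exchanged and the cube root of 5 in place of
  that of 10.\<close>

lemma second_twist_family:
  fixes X Y \<nu> :: "'k::field_char_0"
  assumes \<nu>: "\<nu>^2 = of_rat k" "k \<noteq> 0" and e: "e4 = - 1055 * k^2" "e6 = 15535 * k^3"
    and curve: "Y^2 = X^3 - 27 * of_rat e4 * X - 54 * of_rat e6"
    and flex: "3 * X^4 - 162 * of_rat e4 * X^2 - 648 * of_rat e6 * X - 729 * (of_rat e4)^2 = 0"
  obtains v :: 'k where "v^2 = of_rat (- 15)" | v \<theta> :: 'k where "v^2 = of_rat 5" "\<theta>^3 = of_rat 5"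
proof -
  obtain x y where X: "X = of_rat k * x" and c': "y^2 = x^3 - 27 * of_rat (- 1055) * x - 54 * of_rat 15535"
    using untwist[OF \<nu> e curve] .
  have E: "of_rat e4 = - 1055 * (of_rat k :: 'k)^2" "of_rat e6 = 15535 * (of_rat k :: 'k)^3"
    unfolding e by (simp_all add: of_rat_simps)
  have c: "y^2 = x^3 + 28485 * x - 838890" using c' by (simp add: of_rat_minus)
  have "3 * of_rat k ^ 4 * ((x + 45) * (x^3 - 45 * x^2 + 58995 * x - 6010335)) = 0"
    using flex unfolding X E by algebra
  then have "x + 45 = 0 \<or> x^3 - 45 * x^2 + 58995 * x - 6010335 = 0" using \<nu>(2) by simp
  then show thesis
  proof
    assume "x + 45 = 0"
    then have "x = - 45" by (simp add: eq_neg_iff_add_eq_0)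
    then have "y^2 = - 15 * 384^2" using c by simp
    then have "(y / 384)^2 = of_rat (- 15)" by (simp add: power_divide of_rat_minus)
    then show thesis by (rule that(1))
  next
    assume g: "x^3 - 45 * x^2 + 58995 * x - 6010335 = 0"
    have "x \<noteq> 339"
    proof
      assume "x = 339"
      then show False using g by simp
    qed
    have "y^2 = 5 * (3 * (x - 339))^2" using c g by algebra
    then have "(y / (3 * (x - 339)))^2 = of_rat 5" using \<open>x \<noteq> 339\<close> by (simp add: power_divide)
    \<comment> \<open>Cardano's formula gives \<open>x - 15 = 108\<theta> - 36\<theta>\<^sup>2\<close>.\<close>
    moreover have "((x - 15)^2 + 324 * (x - 15) + 38880)^3 = 41472^3 * 5" using g by algebra
    then have "(((x - 15)^2 + 324 * (x - 15) + 38880) / 41472)^3 = of_rat 5" by (simp add: power_divide)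
    ultimately show thesis by (rule that(2))
  qed
qed

lemma first_family_no_2_torsion:
  fixes \<alpha> \<nu> \<theta> :: "'k::field_char_0"
  assumes deg: "degree_over_rat TYPE('k) = 6"
    and \<nu>: "\<nu>^2 = of_rat k" "k \<noteq> 0" and e: "e4 = 145 * k^2" "e6 = - 2105 * k^3"
    and root: "\<alpha>^3 - 27 * of_rat e4 * \<alpha> - 54 * of_rat e6 = 0" and th: "\<theta>^3 = of_rat 10"
  shows False
proof -
  \<comment> \<open>A root of the 2-division cubic is a point with ordinate 0, so
    \<open>untwist\<close> applies to it.\<close>
  have "0^2 = \<alpha>^3 - 27 * of_rat e4 * \<alpha> - 54 * of_rat e6" using root by simp
  then obtain x where "x^3 - 27 * of_rat 145 * x - 54 * of_rat (- 2105) = (0 :: 'k)"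
    by (rule untwist[OF \<nu> e]) simp
  then have x: "x^3 + of_rat (- 3915) * x + of_rat 113670 = 0" by (simp add: of_rat_minus)
  have noroot: "z^3 + (- 3915) * z + 113670 \<noteq> 0" for z :: rat
  proof
    assume z: "z^3 + (- 3915) * z + 113670 = 0"
    have "(z / 3)^3 + of_int (- 435) * (z / 3) + of_int 4210 = (z^3 + (- 3915) * z + 113670) / 27"
      by (simp add: power_divide field_simps)
    then have "(z / 3)^3 + of_int (- 435) * (z / 3) + of_int 4210 = 0" unfolding z by simp
    then obtain n :: int where "n^3 + (- 435) * n + 4210 = 0" by (rule rat_root_monic_cubic_int)
    then show False using no_integer_root_mod_11(1) by blast
  qed
  show False
    by (rule no_2_torsion_over_pure_cubic[OF deg th rat_cube_5_10(2) x noroot, of 233280]) simp_all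
qed

lemma second_family_no_2_torsion:
  fixes \<alpha> \<nu> \<theta> :: "'k::field_char_0"
  assumes deg: "degree_over_rat TYPE('k) = 6"
    and \<nu>: "\<nu>^2 = of_rat k" "k \<noteq> 0" and e: "e4 = - 1055 * k^2" "e6 = 15535 * k^3"
    and root: "\<alpha>^3 - 27 * of_rat e4 * \<alpha> - 54 * of_rat e6 = 0" and th: "\<theta>^3 = of_rat 5"
  shows False
proof -
  have "0^2 = \<alpha>^3 - 27 * of_rat e4 * \<alpha> - 54 * of_rat e6" using root by simp
  then obtain x where "x^3 - 27 * of_rat (- 1055) * x - 54 * of_rat 15535 = (0 :: 'k)"
    by (rule untwist[OF \<nu> e]) simp
  then have x: "x^3 + of_rat 28485 * x + of_rat (- 838890) = 0" by (simp add: of_rat_minus)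
  have noroot: "z^3 + 28485 * z + (- 838890) \<noteq> 0" for z :: rat
  proof
    assume z: "z^3 + 28485 * z + (- 838890) = 0"
    have "(z / 3)^3 + of_int 3165 * (z / 3) + of_int (- 31070) = (z^3 + 28485 * z + (- 838890)) / 27"
      by (simp add: power_divide field_simps)
    then have "(z / 3)^3 + of_int 3165 * (z / 3) + of_int (- 31070) = 0" unfolding z by simp
    then obtain n :: int where "n^3 + 3165 * n + (- 31070) = 0" by (rule rat_root_monic_cubic_int)
    then show False using no_integer_root_mod_11(2) by blast
  qed
  show False
    by (rule no_2_torsion_over_pure_cubic[OF deg th rat_cube_5_10(1) x noroot, of 7464960]) simp_all
qed

lemma rat_isomorphic_twist:
  assumes "c4_of E = c * k^2" "c6_of E = d * k^3" "k \<noteq> 0" "m = k * w^2" "w \<noteq> 0"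
    and "c4_of E' = c * m^2" "c6_of E' = d * m^3"
  shows "rat_isomorphic E E'"
proof (rule rat_isomorphic_of_invariants[of "1 / w"])
  show "c4_of E = (1 / w)^4 * c4_of E'" "c6_of E = (1 / w)^6 * c6_of E'"
    unfolding assms using \<open>w \<noteq> 0\<close> by (simp_all add: power_mult_distrib power_divide flip: power_mult)
qed (use assms in simp)

text \<open>\<open>d\<close> is not a square, by irrationality for 5 and by sign for -15, so
  \<open>k\<close> lies in the class of 1 or of \<open>d\<close>. These two classes are the
  admissible twists.\<close>

lemma square_class_5_15:
  fixes \<nu> v :: "'k::field_char_0"
  assumes deg: "degree_over_rat TYPE('k) = 6" and "\<nu>^2 = of_rat k" "k \<noteq> 0" "v^2 = of_rat d"
    and d: "d = 5 \<or> d = - 15"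
  obtains w where "w \<noteq> 0" "1 = k * w^2" | w where "w \<noteq> 0" "d = k * w^2"
proof (rule square_classes[OF deg assms(2,4)])
  fix w assume "k = w^2"
  then show thesis using that(1)[of "1 / w"] \<open>k \<noteq> 0\<close> by (simp add: power_divide)
next
  fix w assume w: "d = w^2"
  have "d \<noteq> - 15" using w zero_le_power2[of w] by linarith
  then have "w^2 = 5 * 1^2" using w d by simp
  then have "(1::rat) = 0" by (rule rat_square_5)
  then show thesis by simp
next
  fix w assume w: "d = k * w^2"
  then have "w \<noteq> 0" using d by auto
  then show thesis using w by (rule that(2))
qed

lemma cremona_invariants:
  "c4_of cremona_50b1 = 145" "c6_of cremona_50b1 = - 2105"
  "c4_of cremona_50a3 = 145 * 5^2" "c6_of cremona_50a3 = - 2105 * 5^3"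
  "c4_of cremona_450b3 = 145 * (- 15)^2" "c6_of cremona_450b3 = - 2105 * (- 15)^3"
  "c4_of cremona_50b2 = - 1055" "c6_of cremona_50b2 = 15535"
  "c4_of cremona_50a4 = - 1055 * 5^2" "c6_of cremona_50a4 = 15535 * 5^3"
  "c4_of cremona_450b4 = - 1055 * (- 15)^2" "c6_of cremona_450b4 = 15535 * (- 15)^3"
  by (simp_all add: c4_of_def c6_of_def b2_of_def b4_of_def b6_of_def weierstrass_of_def cremona_50b1_def
      cremona_50a3_def cremona_450b3_def cremona_50b2_def cremona_50a4_def cremona_450b4_def)

text \<open>The orders 15 and 30 are treated together. Even \<open>c\<close> adds a root of the
  2-division cubic, which excludes exactly the branches where \<open>K\<close> contains a pure cubic
  field; only there do the two extra curves arise.\<close>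

lemma curves_with_cyclic_torsion_15:
  fixes E :: "rat weierstrass"
  assumes E: "elliptic_curve E"
    and deg: "degree_over_rat TYPE('k::field_char_0) = 6"
    and iso: "torsion_over E TYPE('k) \<cong> integer_mod_group (15 * c)" and "c > 0"
  shows "(\<exists>C \<in> {cremona_50a3, cremona_50b1, cremona_50b2, cremona_450b4}. rat_isomorphic E C) \<or>
    odd c \<and> (\<exists>C \<in> {cremona_50a4, cremona_450b3}. rat_isomorphic E C)"
proof -
  define W where "W = (base_change E :: 'k weierstrass)"
  obtain f where f: "f \<in> Group.iso (torsion_over E TYPE('k)) (integer_mod_group (15 * c))"
    using iso unfolding is_iso_def by blast
  note ell = elliptic_curve_invariants[OF E]
  interpret cyclic_torsion E W "15 * c" f
    using f ell(2) \<open>c > 0\<close> by unfold_locales (simp_all add: W_def)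
  note inv = base_change_invariants[of E, where 'k='k, folded W_def]
  obtain P D where "P \<in> ec_points W" "P \<noteq> Infty" "D = ec_add W P P" "D \<noteq> P" "D \<noteq> ec_neg W P"
    "ec_add W D D = ec_neg W P" using order_5_point[of "3 * int c"] by auto
  then obtain u t :: 'k where ut: "u \<noteq> 0" "t \<noteq> 0" "of_rat (c4_of E) = u^4 * tate_c4 t" "of_rat (c6_of E) = u^6 * tate_c6 t"
    unfolding inv[symmetric] by (rule order_5_tate)
  obtain R where "R \<in> ec_points W" "R \<noteq> Infty" "ec_add W R R = ec_neg W R"
    using order_3_point[of "5 * int c"] by auto
  then obtain X Y :: 'k where XY: "Y^2 = X^3 - 27 * of_rat (c4_of E) * X - 54 * of_rat (c6_of E)"
    "3 * X^4 - 162 * of_rat (c4_of E) * X^2 - 648 * of_rat (c6_of E) * X - 729 * (of_rat (c4_of E))^2 = 0"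
    unfolding inv[symmetric] by (rule order_3_flex)
  have two: "\<exists>\<alpha> :: 'k. \<alpha>^3 - 27 * of_rat (c4_of E) * \<alpha> - 54 * of_rat (c6_of E) = 0" if "even c"
  proof -
    obtain b where "c = 2 * b" using \<open>even c\<close> by (elim evenE)
    then obtain Q where "Q \<in> ec_points W" "Q \<noteq> Infty" "ec_neg W Q = Q"
      using order_2_point[of "15 * int b"] by auto
    then show ?thesis unfolding inv[symmetric] by (metis order_2_abscissa)
  qed
  obtain \<nu> :: 'k and k where \<nu>: "\<nu>^2 = of_rat k" and "k \<noteq> 0"
    and fam: "(c4_of E = 145 * k^2 \<and> c6_of E = - 2105 * k^3) \<or> (c4_of E = - 1055 * k^2 \<and> c6_of E = 15535 * k^3)"
    using curves_with_5_and_3_torsion[OF deg ut ell(1) XY] .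
  note sq = square_class_5_15[OF deg \<nu> \<open>k \<noteq> 0\<close>]
  from fam show ?thesis
  proof
    assume e: "c4_of E = 145 * k^2 \<and> c6_of E = - 2105 * k^3"
    note twist = rat_isomorphic_twist[OF conjunct1[OF e] conjunct2[OF e] \<open>k \<noteq> 0\<close>]
    have b1: "rat_isomorphic E cremona_50b1" if "1 = k * w^2" "w \<noteq> 0" for w
      using twist[OF that] by (simp add: cremona_invariants)
    show ?thesis
    proof (rule first_twist_family[OF \<nu> \<open>k \<noteq> 0\<close> conjunct1[OF e] conjunct2[OF e] XY])
      fix v :: 'k assume "v^2 = of_rat 5"
      then show ?thesis
      proof (rule sq)
        fix w assume "w \<noteq> 0" "5 = k * w^2"
        then have "rat_isomorphic E cremona_50a3" using twist[of 5 w] by (simp add: cremona_invariants)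
        then show ?thesis by blast
      qed (use b1 in auto)
    next
      fix v \<theta> :: 'k assume v: "v^2 = of_rat (- 15)" and th: "\<theta>^3 = of_rat 10"
      have "odd c"
        using two first_family_no_2_torsion[OF deg \<nu> \<open>k \<noteq> 0\<close> conjunct1[OF e] conjunct2[OF e] _ th] by blast
      from v show ?thesis
      proof (rule sq)
        fix w assume "w \<noteq> 0" "- 15 = k * w^2"
        then have "rat_isomorphic E cremona_450b3" using twist[of "- 15" w] by (simp add: cremona_invariants)
        then show ?thesis using \<open>odd c\<close> by blast
      qed (use b1 in auto)
    qed
  next
    assume e: "c4_of E = - 1055 * k^2 \<and> c6_of E = 15535 * k^3"
    note twist = rat_isomorphic_twist[OF conjunct1[OF e] conjunct2[OF e] \<open>k \<noteq> 0\<close>]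
    have b2: "rat_isomorphic E cremona_50b2" if "1 = k * w^2" "w \<noteq> 0" for w
      using twist[OF that] by (simp add: cremona_invariants)
    show ?thesis
    proof (rule second_twist_family[OF \<nu> \<open>k \<noteq> 0\<close> conjunct1[OF e] conjunct2[OF e] XY])
      fix v :: 'k assume "v^2 = of_rat (- 15)"
      then show ?thesis
      proof (rule sq)
        fix w assume "w \<noteq> 0" "- 15 = k * w^2"
        then have "rat_isomorphic E cremona_450b4" using twist[of "- 15" w] by (simp add: cremona_invariants)
        then show ?thesis by blast
      qed (use b2 in auto)
    next
      fix v \<theta> :: 'k assume v: "v^2 = of_rat 5" and th: "\<theta>^3 = of_rat 5"
      have "odd c"
        using two second_family_no_2_torsion[OF deg \<nu> \<open>k \<noteq> 0\<close> conjunct1[OF e] conjunct2[OF e] _ th] by blast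
      from v show ?thesis
      proof (rule sq)
        fix w assume "w \<noteq> 0" "5 = k * w^2"
        then have "rat_isomorphic E cremona_50a4" using twist[of 5 w] by (simp add: cremona_invariants)
        then show ?thesis using \<open>odd c\<close> by blast
      qed (use b2 in auto)
    qed
  qed
qed

theorem theorem3p4:
  fixes E :: "rat weierstrass"
  assumes "elliptic_curve E"
    and "degree_over_rat TYPE('k::field_char_0) = 6"
  shows "(torsion_over E TYPE('k) \<cong> integer_mod_group 15 \<longrightarrow>
           (\<exists>C \<in> {cremona_50a3, cremona_50a4, cremona_50b1, cremona_50b2, cremona_450b4, cremona_450b3}.
              rat_isomorphic E C)) \<and>
         (torsion_over E TYPE('k) \<cong> integer_mod_group 30 \<longrightarrow>
           (\<exists>C \<in> {cremona_50a3, cremona_50b1, cremona_50b2, cremona_450b4}.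
              rat_isomorphic E C))"
  using curves_with_cyclic_torsion_15[OF assms, of 1] curves_with_cyclic_torsion_15[OF assms, of 2] by auto

end
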